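(* Let $N\ge 3$, $\alpha\in(0,N)$, $\mu\in(0,N)$ with $0<2\alpha+\mu<N$. Let $1\le q<2$ and $2_{\alpha,\mu}<p<2^*_{\alpha,\mu}$, where $2_{\alpha,\mu}=\frac{2N-2\alpha-\mu}{N}$ and $2^*_{\alpha,\mu}=\frac{2N-2\alpha-\mu}{N-2}$, and put $2^*=\frac{2N}{N-2}$. Let $V:\mathbb{R}^N\to\mathbb{R}$ satisfy $0<V_0\le V(x)\le V_\infty$ for all $x\in\mathbb{R}^N$, with constants $V_0,V_\infty>0$. Let $a,b:\mathbb{R}^N\to\mathbb{R}$ satisfy $a>0$ and $b>0$ in $\mathbb{R}^N$, $a\in L^{r}(\mathbb{R}^N)$ with $r=\frac{2^*}{2^*-q}$, and $b\in L^{\sigma}(\mathbb{R}^N)\cap L^{\sigma+\eta}(\mathbb{R}^N)$ with $\sigma=\frac{2N}{2N-2\alpha-\mu-p(N-2)}$ and some small enough $\eta>0$. Assume that $u_k\rightharpoonup u$ weakly in $H^1(\mathbb{R}^N)$, with $u\in H^1(\mathbb{R}^N)$. Then, as $k\to\infty$, $$\int_{\mathbb{R}^N}\int_{\mathbb{R}^N}\frac{b(x)|u_k(x)|^p\,b(y)|u_k(y)|^p}{|x|^\alpha|x-y|^\mu|y|^\alpha}\,dx\,dy-\int_{\mathbb{R}^N}\int_{\mathbb{R}^N}\frac{b(x)|(u_k-u)(x)|^p\,b(y)|(u_k-u)(y)|^p}{|x|^\alpha|x-y|^\mu|y|^\alpha}\,dx\,dy$$ converges to $$\int_{\mathbb{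R}^N}\int_{\mathbb{R}^N}\frac{b(x)|u(x)|^p\,b(y)|u(y)|^p}{|x|^\alpha|x-y|^\mu|y|^\alpha}\,dx\,dy.$$
   Context: $H^1(\mathbb{R}^N)$ is the usual Sobolev space, endowed with the (equivalent) norm $\|u\|=\left(\int_{\mathbb{R}^N}|\nabla u|^2+V(x)|u|^2\,dx\right)^{1/2}$. *)

theory Defs
  imports "HOL-Analysis.Analysis"
begin

text \<open>
  The space \<open>\<real>\<^sup>N\<close> is an arbitrary Euclidean space \<open>'a\<close> with \<open>N = DIM('a)\<close>.  Elements of Lebesgue and
  Sobolev spaces are represented by Lebesgue measurable functions, without passing to the quotient
  by equality almost everywhere.
\<close>

definition sobolev_exponent :: "nat \<Rightarrow> real" where
  "sobolev_exponent N = 2 * real N / (real N - 2)"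

definition lower_critical_exponent :: "nat \<Rightarrow> real \<Rightarrow> real \<Rightarrow> real" where
  "lower_critical_exponent N \<alpha> \<mu> = (2 * real N - 2 * \<alpha> - \<mu>) / real N"

definition upper_critical_exponent :: "nat \<Rightarrow> real \<Rightarrow> real \<Rightarrow> real" where
  "upper_critical_exponent N \<alpha> \<mu> = (2 * real N - 2 * \<alpha> - \<mu>) / (real N - 2)"

definition Lp :: "real \<Rightarrow> ('a::euclidean_space \<Rightarrow> 'b::euclidean_space) set" where
  "Lp s = {f \<in> borel_measurable lebesgue. integrable lebesgue (\<lambda>x. norm (f x) powr s)}"

definition locally_integrable :: "('a::euclidean_space \<Rightarrow> 'b::euclidean_space) \<Rightarrow> bool" where
  "locally_integrable f \<longleftrightarrow> (\<forall>K. compact K \<longrightarrow> set_integrable lebesgue K f)"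

definition partial_deriv :: "'a::euclidean_space \<Rightarrow> ('a \<Rightarrow> real) \<Rightarrow> 'a \<Rightarrow> real" where
  "partial_deriv e f x = frechet_derivative f (at x) e"

text \<open>
  Frechet differentiability of all iterated partial derivatives forces each of them to be
  continuous, so this is \<open>C\<^sup>\<infinity>\<close>.
\<close>

definition smooth :: "('a::euclidean_space \<Rightarrow> real) \<Rightarrow> bool" where
  "smooth f \<longleftrightarrow>
    (\<forall>es. set es \<subseteq> Basis \<longrightarrow> (\<forall>x. foldr partial_deriv es f differentiable (at x)))"

definition test_functions :: "('a::euclidean_space \<Rightarrow> real) set" where
  "test_functions = {\<phi>. smooth \<phi> \<and> compact (closure {x. \<phi> x \<noteq> 0})}"

definition has_weak_gradient ::
    "('a::euclidean_space \<Rightarrow> real) \<Rightarrow> ('a \<Rightarrow> 'a) \<Rightarrow> bool" where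
  "has_weak_gradient u g \<longleftrightarrow>
    locally_integrable u \<and> locally_integrable g \<and>
    (\<forall>\<phi>\<in>test_functions. \<forall>e\<in>Basis.
      (\<integral>x. u x * partial_deriv e \<phi> x \<partial>lebesgue) = - (\<integral>x. (g x \<bullet> e) * \<phi> x \<partial>lebesgue))"

text \<open>The weak gradient is unique up to null sets; \<open>SOME\<close> picks a representative.\<close>

definition weak_gradient :: "('a::euclidean_space \<Rightarrow> real) \<Rightarrow> 'a \<Rightarrow> 'a" where
  "weak_gradient u = (SOME g. has_weak_gradient u g)"

definition H1 :: "('a::euclidean_space \<Rightarrow> real) set" where
  "H1 = {u \<in> Lp 2. \<exists>g \<in> Lp 2. has_weak_gradient u g}"

definition H1_norm :: "('a::euclidean_space \<Rightarrow> real) \<Rightarrow> ('a \<Rightarrow> real) \<Rightarrow> real" where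
  "H1_norm V u =
    sqrt (\<integral>x. (norm (weak_gradient u x))\<^sup>2 + V x * (u x)\<^sup>2 \<partial>lebesgue)"

text \<open>
  Bounded linear functionals on \<open>H\<^sup>1\<close>.  Boundedness makes them insensitive to changes of the
  argument on null sets, so they are the elements of the dual of the quotient space.
\<close>

definition H1_dual :: "('a::euclidean_space \<Rightarrow> real) \<Rightarrow> (('a \<Rightarrow> real) \<Rightarrow> real) set" where
  "H1_dual V = {L.
    (\<forall>u\<in>H1. \<forall>v\<in>H1. L (\<lambda>x. u x + v x) = L u + L v) \<and>
    (\<forall>c. \<forall>u\<in>H1. L (\<lambda>x. c * u x) = c * L u) \<and>
    (\<exists>C. \<forall>u\<in>H1. \<bar>L u\<bar> \<le> C * H1_norm V u)}"

definition weakly_converges_H1 ::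
    "('a::euclidean_space \<Rightarrow> real) \<Rightarrow> (nat \<Rightarrow> 'a \<Rightarrow> real) \<Rightarrow> ('a \<Rightarrow> real) \<Rightarrow> bool" where
  "weakly_converges_H1 V w u \<longleftrightarrow>
    (\<forall>k. w k \<in> H1) \<and> u \<in> H1 \<and> (\<forall>L\<in>H1_dual V. (\<lambda>k. L (w k)) \<longlonglongrightarrow> L u)"

text \<open>The singular set of the kernel, where division yields \<open>0\<close>, is a null set.\<close>

definition double_integral ::
    "('a::euclidean_space \<Rightarrow> real) \<Rightarrow> real \<Rightarrow> real \<Rightarrow> real \<Rightarrow> ('a \<Rightarrow> real) \<Rightarrow> real" where
  "double_integral b p \<alpha> \<mu> w =
    (\<integral>y. (\<integral>x. (b x * \<bar>w x\<bar> powr p * (b y * \<bar>w y\<bar> powr p)) /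
                (norm x powr \<alpha> * norm (x - y) powr \<mu> * norm y powr \<alpha>) \<partial>lebesgue) \<partial>lebesgue)"

end

(* By the Stein-Weiss inequality the double integral is a bounded form on L^t with
   t = 2N / (2N - 2 alpha - mu), and the exponents are chosen so that b|w|^p lies in L^t for w in H1.
   Since p is below the upper critical exponent and b lies in L^(sigma + eta), there is room on both
   sides of t: b|w|^p lies in L^t1 and in L^t2 with t1 < t < t2.  Hence the sharp inequality can be
   replaced by pointwise Young inequalities against the integrable pieces of the kernel near and away
   from its singularity, and the critical Sobolev embedding by the embeddings into L^s with s < 2*.

   Boundedness of the sequence follows by a gliding hump argument.  The difference z_k = u_k - u is
   smoothed at scale 2^-n.  The error is summed over the dyadic scales, where consecutive smoothings
   differ by averages of the gradient over small cubes, so it is small in L^s uniformly in k; the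
   smoothed functions tend to 0 pointwise by weak convergence.  Therefore b|z_k|^p tends to 0 in L^t1
   and L^t2, the double integral of z_k tends to 0, and that of u_k tends to that of u. *)

theory Submission
  imports Defs
begin

section \<open>Smooth step and bump on the line, and test functions as products over the
  coordinates\<close>

section \<open>Smooth product functions\<close>

text \<open>The shape of the kernels is forced by the fact that a weak gradient is known only
  through pairings with test functions. Kernels are products over the coordinates: a partial
  derivative touches one factor only, so smoothness reduces to the line. Each factor is the
  derivative of an explicit step, so the difference of two mollifiers is a sum of partial
  derivatives of compactly supported products. One scale step thereby gains a factor of the scale on
  the gradient; interpolating between its L2 bound and its supremum bound leaves a positive power of
  the scale exactly below the critical exponent, and the scales can be summed.

  Pointwise Young inequalities are not homogeneous and leave an additive constant in the estimate of
  the form. Homogeneity is restored by multiplying the vanishing argument by a large constant.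

  The passage from z_k to u_k is a comparison: |u_k|^p <= c |u|^p + C |z_k|^p with c arbitrarily
  close to 1, and the same with u and u_k exchanged, squeeze the form of u_k between multiples of
  the form of u, up to terms that contain z_k.\<close>

primrec times_differentiable :: "nat \<Rightarrow> (real \<Rightarrow> real) \<Rightarrow> bool" where
  "times_differentiable 0 f \<longleftrightarrow> True"
| "times_differentiable (Suc n) f \<longleftrightarrow>
     (\<exists>f'. (\<forall>x. (f has_real_derivative f' x) (at x)) \<and> times_differentiable n f')"

definition smooth_real :: "(real \<Rightarrow> real) \<Rightarrow> bool" where
  "smooth_real f \<longleftrightarrow> (\<forall>n. times_differentiable n f)"

lemma times_differentiable_Suc_deriv:
  "times_differentiable (Suc n) f \<longleftrightarrow>
     (\<forall>x. (f has_real_derivative deriv f x) (at x)) \<and> times_differentiable n (deriv f)"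
proof
  assume "times_differentiable (Suc n) f"
  then obtain f' where f': "\<And>x. (f has_real_derivative f' x) (at x)" "times_differentiable n f'"
    by auto
  then have "deriv f = f'" by (auto simp: fun_eq_iff intro!: DERIV_imp_deriv)
  with f' show "(\<forall>x. (f has_real_derivative deriv f x) (at x)) \<and> times_differentiable n (deriv f)"
    by auto
qed auto

lemma times_differentiable_SucD: "times_differentiable (Suc n) f \<Longrightarrow> times_differentiable n f"
proof (induction n arbitrary: f)
  case (Suc n)
  from Suc.prems obtain f' where "\<And>x. (f has_real_derivative f' x) (at x)"
    "times_differentiable (Suc n) f'" unfolding times_differentiable.simps(2)[of "Suc n"] by blast
  then show ?case using Suc.IH[of f'] by auto
qed simp

lemma times_differentiable_const: "times_differentiable n (\<lambda>x. c)"
proof (induction n arbitrary: c)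
  case (Suc n)
  show ?case using Suc[of 0] by (auto intro!: exI[of _ "\<lambda>x. 0"])
qed simp

lemma times_differentiable_add:
  "times_differentiable n f \<Longrightarrow> times_differentiable n g \<Longrightarrow> times_differentiable n (\<lambda>x. f x + g x)"
proof (induction n arbitrary: f g)
  case (Suc n)
  from Suc.prems obtain f' g' where "\<And>x. (f has_real_derivative f' x) (at x)"
    "times_differentiable n f'" "\<And>x. (g has_real_derivative g' x) (at x)"
    "times_differentiable n g'" by auto
  with Suc.IH[of f' g'] show ?case
    by (auto intro!: exI[of _ "\<lambda>x. f' x + g' x"] derivative_eq_intros)
qed simp

lemma times_differentiable_mult:
  "times_differentiable n f \<Longrightarrow> times_differentiable n g \<Longrightarrow> times_differentiable n (\<lambda>x. f x * g x)"
proof (induction n arbitrary: f g)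
  case (Suc n)
  from Suc.prems obtain f' g' where *: "\<And>x. (f has_real_derivative f' x) (at x)"
    "times_differentiable n f'" "\<And>x. (g has_real_derivative g' x) (at x)"
    "times_differentiable n g'" by auto
  have "times_differentiable n (\<lambda>x. f' x * g x)" "times_differentiable n (\<lambda>x. f x * g' x)"
    by (intro Suc.IH times_differentiable_SucD[OF Suc.prems(1)]
        times_differentiable_SucD[OF Suc.prems(2)] *)+
  from times_differentiable_add[OF this] * show ?case
    by (auto intro!: exI[of _ "\<lambda>x. f' x * g x + f x * g' x"] derivative_eq_intros)
qed simp

lemma times_differentiable_inverse:
  assumes nz: "\<And>x. f x \<noteq> 0"
  shows "times_differentiable n f \<Longrightarrow> times_differentiable n (\<lambda>x. inverse (f x))"
proof (induction n)
  case (Suc n)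
  from Suc.prems obtain f' where *: "\<And>x. (f has_real_derivative f' x) (at x)"
    "times_differentiable n f'" by auto
  have i: "times_differentiable n (\<lambda>x. inverse (f x))"
    by (rule Suc.IH[OF times_differentiable_SucD[OF Suc.prems]])
  have "times_differentiable n (\<lambda>x. -1 * (inverse (f x) * f' x * inverse (f x)))"
    by (intro times_differentiable_mult times_differentiable_const i *)
  moreover have "((\<lambda>x. inverse (f x)) has_real_derivative
      -1 * (inverse (f x) * f' x * inverse (f x))) (at x)" for x
    using DERIV_inverse'[OF *(1) nz, of x] by simp
  ultimately show ?case unfolding times_differentiable.simps(2) by (intro exI conjI allI)
qed simp

text \<open>Arguments are later only rescaled, shifted or reflected, and for such compositions the
  chain rule contributes just a constant factor at each order.\<close>

lemma times_differentiable_affine: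
  "times_differentiable n f \<Longrightarrow> times_differentiable n (\<lambda>x. f (m * x + c))"
proof (induction n arbitrary: f)
  case (Suc n)
  from Suc.prems obtain f' where *: "\<And>x. (f has_real_derivative f' x) (at x)"
    "times_differentiable n f'" by auto
  have "times_differentiable n (\<lambda>x. f' (m * x + c) * m)"
    by (intro times_differentiable_mult times_differentiable_const Suc.IH *)
  moreover have "((\<lambda>x. f (m * x + c)) has_real_derivative f' (m * x + c) * m) (at x)" for x
    by (rule DERIV_chain2[OF *(1)]) (auto intro!: derivative_eq_intros)
  ultimately show ?case unfolding times_differentiable.simps(2) by (intro exI conjI allI)
qed simp

lemmas smooth_real_intros =
  times_differentiable_const times_differentiable_add times_differentiable_mult
  times_differentiable_affine times_differentiable_inverse

lemma smooth_real_DERIV: "smooth_real f \<Longrightarrow> (f has_real_derivative deriv f x) (at x)"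
  unfolding smooth_real_def using times_differentiable_Suc_deriv[of 0 f] by blast

lemma smooth_real_deriv: "smooth_real f \<Longrightarrow> smooth_real (deriv f)"
  unfolding smooth_real_def using times_differentiable_Suc_deriv[of _ f] by blast

lemma smooth_real_continuous: "smooth_real f \<Longrightarrow> continuous_on A f"
  by (meson DERIV_continuous_on smooth_real_DERIV has_field_derivative_at_within)

text \<open>The powers of 1 / s are carried along because differentiating exp(-1 / s) produces them:
  the family over all \<open>m\<close> is closed under derivatives up to linear combinations, so one
  induction on the order covers every member.\<close>

definition flat_exp :: "nat \<Rightarrow> real \<Rightarrow> real" where
  "flat_exp m s = (if 0 < s then inverse s ^ m * exp (- inverse s) else 0)"

text \<open>This is the difference quotient at the gluing point 0, where \<open>flat_exp\<close>
  vanishes. Substituting 1 / s turns its right-hand limit into that of a power against the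
  exponential at infinity.\<close>

lemma flat_exp_tendsto_0: "((\<lambda>s. flat_exp m s / s) \<longlongrightarrow> 0) (at 0)"
proof -
  have "((\<lambda>s::real. s ^ Suc m * exp (- s)) \<longlongrightarrow> 0) at_top"
    using tendsto_power_div_exp_0[of "Suc m"] by (simp add: exp_minus divide_inverse)
  then have "((\<lambda>s::real. inverse s ^ Suc m * exp (- inverse s)) \<longlongrightarrow> 0) (at_right 0)"
    by (rule filterlim_compose[OF _ filterlim_inverse_at_top_right])
  then have r: "((\<lambda>s. flat_exp m s / s) \<longlongrightarrow> 0) (at_right 0)"
    by (rule Lim_transform_eventually)
       (auto simp: eventually_at_right_field flat_exp_def divide_inverse intro!: exI[of _ 1])
  have "((\<lambda>s. flat_exp m s / s) \<longlongrightarrow> 0) (at_left 0)"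
    by (rule Lim_transform_eventually[OF tendsto_const])
       (auto simp: eventually_at_left_field flat_exp_def intro!: exI[of _ "-1"])
  with r show ?thesis by (simp add: filterlim_split_at)
qed

lemma flat_exp_DERIV:
  "(flat_exp m has_real_derivative (- real m * flat_exp (Suc m) s + flat_exp (m + 2) s)) (at s)"
proof (cases "s = 0")
  case True
  with flat_exp_tendsto_0[of m] show ?thesis
    by (simp add: DERIV_def flat_exp_def)
next
  case False
  show ?thesis
  proof (cases "0 < s")
    case True
    have "((\<lambda>s. inverse s ^ m * exp (- inverse s)) has_real_derivative
       (- real m * flat_exp (Suc m) s + flat_exp (m + 2) s)) (at s)"
    proof -
      have i: "(inverse has_real_derivative - (inverse s)\<^sup>2) (at s)"
        using DERIV_inverse[of s] True by (simp add: power2_eq_square numeral_2_eq_2)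
      have p: "((\<lambda>s. inverse s ^ m) has_real_derivative - real m * inverse s ^ Suc m) (at s)"
        using DERIV_power[OF i, of m] by (cases m) (simp_all add: power2_eq_square algebra_simps)
      have e: "((\<lambda>s. exp (- inverse s)) has_real_derivative exp (- inverse s) * (inverse s)\<^sup>2) (at s)"
        using DERIV_chain2[OF DERIV_exp DERIV_minus[OF i]] by simp
      show ?thesis
        using DERIV_mult[OF p e] True by (simp add: flat_exp_def power2_eq_square algebra_simps)
    qed
    then show ?thesis
      by (rule has_field_derivative_transform_within_open[of _ _ _ "{0<..}"])
         (use True in \<open>auto simp: flat_exp_def\<close>)
  next
    case neg: False
    have "((\<lambda>s. 0) has_real_derivative 0) (at s)" by simp
    then have "(flat_exp m has_real_derivative 0) (at s)"
      by (rule has_field_derivative_transform_within_open[of _ _ _ "{..<0}"])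
         (use neg False in \<open>auto simp: flat_exp_def\<close>)
    then show ?thesis using neg by (simp add: flat_exp_def)
  qed
qed

lemma times_differentiable_flat_exp: "times_differentiable n (flat_exp m)"
proof (induction n arbitrary: m)
  case (Suc n)
  have "times_differentiable n (\<lambda>s. - real m * flat_exp (Suc m) s + flat_exp (m + 2) s)"
    by (intro smooth_real_intros Suc)
  with flat_exp_DERIV[of m] show ?case
    unfolding times_differentiable.simps(2)
    by (intro exI[of _ "\<lambda>s. - real m * flat_exp (Suc m) s + flat_exp (m + 2) s"]) auto
qed simp

text \<open>The two terms of the denominator cannot vanish together, because 1 + s and 1 - s add up
  to 2. The whole transition from 0 to 1 takes place in [-1, 1].\<close>

definition smooth_step :: "real \<Rightarrow> real" where
  "smooth_step s = flat_exp 0 (1 + s) * inverse (flat_exp 0 (1 + s) + flat_exp 0 (1 - s))"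

lemma flat_exp_nonneg: "0 \<le> flat_exp m s" by (simp add: flat_exp_def)

lemma smooth_step_denominator_pos: "0 < flat_exp 0 (1 + s) + flat_exp 0 (1 - s)"
  by (cases "s < 1") (auto simp: flat_exp_def intro: add_nonneg_pos add_pos_nonneg)

lemma smooth_real_smooth_step: "smooth_real smooth_step"
  unfolding smooth_real_def
proof
  fix n
  have "times_differentiable n (\<lambda>s. flat_exp 0 (1 * s + 1) *
      inverse (flat_exp 0 (1 * s + 1) + flat_exp 0 (-1 * s + 1)))"
    using smooth_step_denominator_pos
    by (intro smooth_real_intros times_differentiable_flat_exp) (simp add: algebra_simps less_imp_neq[symmetric])
  then show "times_differentiable n smooth_step"
    by (simp add: smooth_step_def[abs_def] add.commute)
qed

lemma smooth_step_eq_0: "s \<le> -1 \<Longrightarrow> smooth_step s = 0"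
  by (simp add: smooth_step_def flat_exp_def)

lemma smooth_step_eq_1: "1 \<le> s \<Longrightarrow> smooth_step s = 1"
  by (simp add: smooth_step_def flat_exp_def)

lemma smooth_step_bounds: "0 \<le> smooth_step s" "smooth_step s \<le> 1"
  using smooth_step_denominator_pos[of s] flat_exp_nonneg[of 0 "1 + s"] flat_exp_nonneg[of 0 "1 - s"]
  by (auto simp: smooth_step_def field_simps)

lemma flat_exp_mono: "s \<le> t \<Longrightarrow> flat_exp 0 s \<le> flat_exp 0 t"
  by (auto simp: flat_exp_def)

lemma smooth_step_mono:
  assumes "s \<le> t" shows "smooth_step s \<le> smooth_step t"
proof -
  have cross: "a / (a + b) \<le> c / (c + d)" if "0 < a + b" "0 < c + d" "a * d \<le> c * b"
    for a b c d :: real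
    using that by (simp add: field_simps)
  from assms have "flat_exp 0 (1 + s) \<le> flat_exp 0 (1 + t)" "flat_exp 0 (1 - t) \<le> flat_exp 0 (1 - s)"
    by (auto intro: flat_exp_mono)
  then have "flat_exp 0 (1 + s) * flat_exp 0 (1 - t) \<le> flat_exp 0 (1 + t) * flat_exp 0 (1 - s)"
    by (intro mult_mono flat_exp_nonneg)
  from cross[OF smooth_step_denominator_pos smooth_step_denominator_pos this] show ?thesis
    unfolding smooth_step_def divide_inverse .
qed

text \<open>Taking the derivative of a step gives a difference of two rescaled bumps an explicit
  primitive, and that primitive has compact support because both steps rise by the same
  amount.\<close>

definition bump :: "real \<Rightarrow> real" where "bump = deriv smooth_step"

lemma smooth_real_bump: "smooth_real bump"
  unfolding bump_def by (intro smooth_real_deriv smooth_real_smooth_step)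

lemma smooth_step_DERIV: "(smooth_step has_real_derivative bump s) (at s)"
  unfolding bump_def by (intro smooth_real_DERIV smooth_real_smooth_step)

lemma bump_nonneg: "0 \<le> bump s"
  by (rule mono_on_imp_deriv_nonneg[OF _ smooth_step_DERIV, of UNIV])
     (auto simp: mono_on_def smooth_step_mono)

lemma bump_eq_0: assumes "1 \<le> \<bar>s\<bar>" shows "bump s = 0"
proof -
  have *: "bump s = 0" if "1 < \<bar>s\<bar>" for s
  proof (cases "s > 0")
    case True
    have "((\<lambda>s. 1) has_real_derivative 0) (at s)" by simp
    then have "(smooth_step has_real_derivative 0) (at s)"
      by (rule has_field_derivative_transform_within_open[of _ _ _ "{1<..}"])
         (use True that in \<open>auto simp: smooth_step_eq_1\<close>)
    then show ?thesis using smooth_step_DERIV DERIV_unique by blast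
  next
    case False
    have "((\<lambda>s. 0) has_real_derivative 0) (at s)" by simp
    then have "(smooth_step has_real_derivative 0) (at s)"
      by (rule has_field_derivative_transform_within_open[of _ _ _ "{..<-1}"])
         (use False that in \<open>auto simp: smooth_step_eq_0\<close>)
    then show ?thesis using smooth_step_DERIV DERIV_unique by blast
  qed
  \<comment> \<open>Comparison with a locally constant function settles only 1 < |s|. The endpoints
    are limits of such points, and the zero set is closed.\<close>
  have "closed {s. bump s = 0}"
    using continuous_closed_preimage_constant[OF smooth_real_continuous[OF smooth_real_bump] closed_UNIV, of 0] by simp
  moreover have "{s. 1 < \<bar>s\<bar>} \<subseteq> {s. bump s = 0}" using * by auto
  ultimately have cl: "closure {s. 1 < \<bar>s\<bar>} \<subseteq> {s. bump s = 0}" by (rule closure_minimal[rotated])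
  have "s \<in> closure {s. 1 < \<bar>s\<bar>}"
  proof (cases "\<bar>s\<bar> = 1")
    case True
    have "(\<lambda>n. s * (1 + inverse (real (Suc n)))) \<longlonglongrightarrow> s * (1 + 0)"
      by (intro tendsto_intros LIMSEQ_inverse_real_of_nat)
    moreover have "\<bar>s * (1 + inverse (real (Suc n)))\<bar> > 1" for n
      using True by (simp add: abs_mult)
    ultimately show ?thesis unfolding closure_sequential
      by (intro exI[of _ "\<lambda>n. s * (1 + inverse (real (Suc n)))"]) auto
  next
    case False then show ?thesis using assms closure_subset by fastforce
  qed
  with cl show ?thesis by auto
qed

text \<open>The step rises by 1 over an interval of length 2, so the mean value theorem yields a
  point of slope 1 / 2. This makes the mass of the mollifier positive.\<close>

lemma bump_pos_somewhere: "\<exists>s. 0 < bump s"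
proof -
  have "\<exists>z. z > -1 \<and> z < (1::real) \<and> smooth_step 1 - smooth_step (-1) = (1 - (-1)) * bump z"
    by (rule MVT2) (auto intro: smooth_step_DERIV)
  then obtain z where "2 * bump z = 1" by (auto simp: smooth_step_eq_0 smooth_step_eq_1)
  then show ?thesis by (intro exI[of _ z]) linarith
qed

lemma bump_bounded: "\<exists>M>0. \<forall>s. bump s \<le> M"
proof -
  have "bounded (bump ` {-1..1})"
    by (intro compact_imp_bounded compact_continuous_image smooth_real_continuous smooth_real_bump compact_Icc)
  then obtain M where M: "\<And>s. s \<in> {-1..1} \<Longrightarrow> \<bar>bump s\<bar> \<le> M" "M > 0"
    unfolding bounded_pos by (auto simp only: ball_simps real_norm_def)
  have "bump s \<le> M" for s
    using M(1)[of s] M(2) bump_eq_0[of s] by (cases "s \<in> {-1..1}") auto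
  with M show ?thesis by blast
qed

lemma smooth_real_affine:
  assumes "smooth_real f" shows "smooth_real (\<lambda>x. f (m * x + c))"
  using assms by (simp add: smooth_real_def times_differentiable_affine)

lemma smooth_real_mult:
  assumes "smooth_real f" "smooth_real g" shows "smooth_real (\<lambda>x. f x * g x)"
  using assms by (simp add: smooth_real_def times_differentiable_mult)

lemma smooth_real_add:
  assumes "smooth_real f" "smooth_real g" shows "smooth_real (\<lambda>x. f x + g x)"
  using assms by (simp add: smooth_real_def times_differentiable_add)

lemma smooth_real_const: "smooth_real (\<lambda>x. c)"
  by (simp add: smooth_real_def times_differentiable_const)

text \<open>\<open>smooth\<close> speaks of all iterated partial derivatives. Functions of this
  shape keep it under each of them, one factor being replaced by its derivative, so that only
  smoothness on the line has to be checked.\<close>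

definition coord_prod :: "('a::euclidean_space \<Rightarrow> real \<Rightarrow> real) \<Rightarrow> 'a \<Rightarrow> real" where
  "coord_prod f x = (\<Prod>i\<in>Basis. f i (x \<bullet> i))"

lemma coord_prod_has_derivative:
  fixes f :: "'a::euclidean_space \<Rightarrow> real \<Rightarrow> real"
  assumes "\<And>i. i \<in> Basis \<Longrightarrow> smooth_real (f i)"
  shows "(coord_prod f has_derivative
    (\<lambda>h. \<Sum>i\<in>Basis. (h \<bullet> i * deriv (f i) (x \<bullet> i)) * (\<Prod>j\<in>Basis - {i}. f j (x \<bullet> j)))) (at x)"
  unfolding coord_prod_def[abs_def]
proof (rule has_derivative_prod)
  fix i :: 'a assume "i \<in> Basis"
  show "((\<lambda>x::'a. f i (x \<bullet> i)) has_derivative (\<lambda>h. h \<bullet> i * deriv (f i) (x \<bullet> i))) (at x)"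
    by (rule DERIV_compose_FDERIV[OF smooth_real_DERIV[OF assms[OF \<open>i \<in> Basis\<close>]]])
       (rule bounded_linear_imp_has_derivative[OF bounded_linear_inner_left])
qed

lemma partial_deriv_coord_prod:
  assumes "\<And>i. i \<in> Basis \<Longrightarrow> smooth_real (f i)" and e: "e \<in> Basis"
  shows "partial_deriv e (coord_prod f) = coord_prod (f(e := deriv (f e)))"
proof
  fix x
  have "partial_deriv e (coord_prod f) x =
      (\<Sum>i\<in>Basis. (e \<bullet> i * deriv (f i) (x \<bullet> i)) * (\<Prod>j\<in>Basis - {i}. f j (x \<bullet> j)))"
    unfolding partial_deriv_def
    by (subst frechet_derivative_at[OF coord_prod_has_derivative[OF assms(1)], symmetric]) auto
  also have "\<dots> = (\<Sum>i\<in>Basis. if i = e then deriv (f e) (x \<bullet> e) * (\<Prod>j\<in>Basis - {e}. f j (x \<bullet> j)) else 0)"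
    by (intro sum.cong) (auto simp: inner_Basis e)
  also have "\<dots> = deriv (f e) (x \<bullet> e) * (\<Prod>j\<in>Basis - {e}. f j (x \<bullet> j))"
    using e by simp
  also have "\<dots> = coord_prod (f(e := deriv (f e))) x"
    unfolding coord_prod_def using e by (subst (2) prod.remove[of _ e]) auto
  finally show "partial_deriv e (coord_prod f) x = coord_prod (f(e := deriv (f e))) x" .
qed

lemma smooth_coord_prod:
  assumes "\<And>i. i \<in> Basis \<Longrightarrow> smooth_real (f i)"
  shows "smooth (coord_prod f)"
proof -
  have "\<exists>g. (\<forall>i\<in>Basis. smooth_real (g i)) \<and> foldr partial_deriv es (coord_prod f) = coord_prod g"
    if "set es \<subseteq> Basis" for es using that
  proof (induction es)
    case Nil then show ?case using assms by auto
  next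
    case (Cons e es)
    then obtain g where g: "\<forall>i\<in>Basis. smooth_real (g i)"
      "foldr partial_deriv es (coord_prod f) = coord_prod g" by auto
    have "foldr partial_deriv (e # es) (coord_prod f) = coord_prod (g(e := deriv (g e)))"
      using Cons.prems g by (simp add: partial_deriv_coord_prod)
    moreover have "\<forall>i\<in>Basis. smooth_real ((g(e := deriv (g e))) i)"
      using g(1) Cons.prems by (auto intro: smooth_real_deriv)
    ultimately show ?case by blast
  qed
  then show ?thesis unfolding smooth_def
    using coord_prod_has_derivative differentiable_def by fastforce
qed

lemma coord_prod_eq_0:
  assumes "x \<notin> cbox a b" "\<And>i s. i \<in> Basis \<Longrightarrow> s \<notin> {a \<bullet> i..b \<bullet> i} \<Longrightarrow> f i s = 0"
  shows "coord_prod f x = 0"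
  using assms by (auto simp: coord_prod_def mem_box)

lemma test_function_coord_prod:
  assumes "\<And>i. i \<in> Basis \<Longrightarrow> smooth_real (f i)"
    and "\<And>i s. i \<in> Basis \<Longrightarrow> s \<notin> {a \<bullet> i..b \<bullet> i} \<Longrightarrow> f i s = 0"
  shows "coord_prod f \<in> test_functions"
proof -
  have "{x. coord_prod f x \<noteq> 0} \<subseteq> cbox a b"
    using coord_prod_eq_0[of _ a b f] assms(2) by blast
  then have "closure {x. coord_prod f x \<noteq> 0} \<subseteq> cbox a b"
    by (rule closure_minimal) (rule closed_cbox)
  then have "compact (closure {x. coord_prod f x \<noteq> 0})"
    by (metis bounded_cbox bounded_subset closed_closure compact_eq_bounded_closed)
  then show ?thesis using smooth_coord_prod[OF assms(1)] by (simp add: test_functions_def)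
qed

section \<open>The fundamental lemma of the calculus of variations and uniqueness of the weak
  gradient\<close>

section \<open>Weak gradients\<close>

text \<open>Boxes are an intersection-stable generator of the Borel sets, so the vanishing spreads
  to all Borel sets by a Dynkin argument, and a density with zero integrals is zero almost
  everywhere. As \<open>f\<close> is only locally integrable, this is done on each of a sequence of
  growing boxes.\<close>

lemma AE_zero_if_box_integrals_zero:
  fixes f :: "'a::euclidean_space \<Rightarrow> real"
  assumes loc: "locally_integrable f"
    and box: "\<And>a b. (\<integral>x. indicator (box a b) x * f x \<partial>lebesgue) = 0"
  shows "AE x in lebesgue. f x = 0"
proof -
  have "AE x in lebesgue. x \<in> box (- (real n *\<^sub>R One)) (real n *\<^sub>R One) \<longrightarrow> f x = 0" for n
  proof -
    define B :: "'a set" where "B = box (- (real n *\<^sub>R One)) (real n *\<^sub>R One)"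
    define g where "g x = indicator B x * f x" for x
    have int: "integrable lebesgue g"
    proof -
      have "set_integrable lebesgue (cbox (- (real n *\<^sub>R One)) (real n *\<^sub>R One)) f"
        using loc by (simp add: locally_integrable_def compact_cbox)
      then have "set_integrable lebesgue B f"
        by (rule set_integrable_subset) (auto simp: B_def box_subset_cbox)
      then show ?thesis by (simp add: set_integrable_def g_def[abs_def])
    qed
    \<comment> \<open>Boxes generate only the Borel sets, so the Dynkin argument is run for a Borel
      representative over \<open>lborel\<close>.\<close>
    then obtain g' where g': "g' \<in> borel_measurable lborel" "AE x in lborel. g x = g' x"
      using completion_ex_borel_measurable_real[of g lborel] by (auto simp: integrable_iff_bounded)
    have gg': "AE x in lebesgue. g x = g' x" by (rule AE_completion[OF g'(2)])
    have g'm: "g' \<in> borel_measurable lebesgue" using g'(1) by (rule measurable_completion)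
    have intl: "integrable lebesgue g'"
      using int g'm gg' by (subst integrable_cong_AE[OF _ _ AE_symmetric]) auto
    then have int': "integrable lborel g'" using g'(1) by (simp add: integrable_completion)
    have zero: "(\<integral>x. indicator A x * g' x \<partial>lborel) = 0" if "A \<in> sets borel" for A
    proof -
      have IS: "Int_stable (range (\<lambda>(a, b). box a b :: 'a set))"
        by (auto simp: Int_stable_def box_Int_box)
      have sub: "range (\<lambda>(a, b). box a b :: 'a set) \<subseteq> Pow UNIV" by simp
      have As: "A \<in> sigma_sets UNIV (range (\<lambda>(a, b). box a b))"
        using that by (simp add: borel_eq_box)
      define P where "P A \<longleftrightarrow> (\<integral>x. indicator A x * g' x \<partial>lborel) = 0" for A
      have sb: "A \<in> sets lborel" if "A \<in> sigma_sets UNIV (range (\<lambda>(a, b). box a b))" for A :: "'a set"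
        using that by (simp add: borel_eq_box)
      have ind: "integrable lborel (\<lambda>x. indicator A x * g' x)" if "A \<in> sets lborel" for A
        using integrable_real_mult_indicator[OF that int'] by (simp add: mult.commute)
      have basic: "P A" if "A \<in> range (\<lambda>(a, b). box a b)" for A
      proof -
        from that obtain a b where A: "A = box a b" by auto
        have "(\<integral>x. indicator A x * g' x \<partial>lborel) = (\<integral>x. indicator A x * g' x \<partial>lebesgue)"
          using g'(1) A by (subst integral_completion) auto
        also have "\<dots> = (\<integral>x. indicator A x * g x \<partial>lebesgue)"
          using gg' g'm int A by (intro integral_cong_AE borel_measurable_times borel_measurable_indicator) auto
        also have "\<dots> = (\<integral>x. indicator (A \<inter> B) x * f x \<partial>lebesgue)"
          by (intro Bochner_Integration.integral_cong) (auto simp: g_def indicator_def)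
        also have "\<dots> = 0" unfolding A B_def box_Int_box by (rule box)
        finally show ?thesis by (simp add: P_def)
      qed
      have empty: "P {}" by (simp add: P_def)
      have compl: "P (UNIV - A)"
        if "A \<in> sigma_sets UNIV (range (\<lambda>(a, b). box a b))" "P A" for A
      proof -
        \<comment> \<open>The integral over the whole space is itself a box integral, because
          \<open>g'\<close> vanishes almost everywhere outside \<open>B\<close>. This starts the
          complement step.\<close>
        have "(\<integral>x. indicator B x * g' x \<partial>lborel) = 0" using basic[of B] by (auto simp: B_def P_def)
        moreover have "AE x in lborel. indicator B x * g' x = g' x"
          using g'(2) by eventually_elim (auto simp: g_def indicator_def)
        then have "(\<integral>x. indicator B x * g' x \<partial>lborel) = (\<integral>x. g' x \<partial>lborel)"
          using g'(1) by (intro integral_cong_AE) (auto simp: B_def)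
        moreover have "(\<integral>x. indicator (UNIV - A) x * g' x \<partial>lborel) =
            (\<integral>x. g' x - indicator A x * g' x \<partial>lborel)"
          by (intro Bochner_Integration.integral_cong) (auto simp: indicator_def)
        ultimately show ?thesis using that int' ind[OF sb[OF that(1)]] by (simp add: P_def)
      qed
      have union: "P (\<Union> (range A))"
        if "disjoint_family A" "range A \<subseteq> sigma_sets UNIV (range (\<lambda>(a, b). box a b))"
          "\<And>i. P (A i)" for A :: "nat \<Rightarrow> 'a set"
      proof -
        have Am: "A i \<in> sets lborel" for i using that(2) by (intro sb) auto
        have "\<Union> (range A) \<in> sets lborel"
          using Am by (intro sets.countable_nat_UN image_subsetI) auto
        from ind[OF this] have "set_integrable lborel (\<Union> (range A)) g'"
          by (simp add: set_integrable_def)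
        then have "(LINT x:(\<Union> (range A))|lborel. g' x) = (\<Sum>i. (LINT x:A i|lborel. g' x))"
          using that(1) Am by (intro lebesgue_integral_countable_add) (auto simp: disjoint_family_on_def)
        then show ?thesis using that(3) by (simp add: set_lebesgue_integral_def P_def)
      qed
      have "P A"
        by (rule sigma_sets_induct_disjoint[OF IS sub As, where P = P])
           (fact basic empty compl union)+
      then show ?thesis by (simp add: P_def)
    qed
    have "AE x in lborel. g' x = 0"
      by (rule sigma_finite_measure.density_zero[OF sigma_finite_lborel int']) (simp add: set_lebesgue_integral_def zero)
    then have "AE x in lebesgue. g' x = 0" by (rule AE_completion)
    with gg' show ?thesis by eventually_elim (auto simp: g_def B_def)
  qed
  then have "AE x in lebesgue. \<forall>n. x \<in> box (- (real n *\<^sub>R One)) (real n *\<^sub>R One) \<longrightarrow> f x = 0"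
    by (simp only: AE_all_countable) simp
  then show ?thesis
  proof eventually_elim
    case (elim x)
    have "x \<in> (\<Union>n::nat. box (- (real n *\<^sub>R One)) (real n *\<^sub>R One))" 
      by (subst UN_box_eq_UNIV) simp
    with elim show ?case by blast
  qed
qed

lemma borel_measurable_lebesgue_id [measurable]: "(\<lambda>x. x) \<in> borel_measurable lebesgue"
  by (rule measurable_completion) simp

lemma borel_measurable_lebesgueI: "f \<in> borel_measurable borel \<Longrightarrow> f \<in> borel_measurable lebesgue"
  by (rule measurable_completion) simp

text \<open>The definition speaks of measurability only after cutting off to compact sets; the
  cut-offs to growing balls converge pointwise.\<close>

lemma locally_integrable_measurable:
  fixes f :: "'a::euclidean_space \<Rightarrow> 'b::euclidean_space"
  assumes "locally_integrable f"
  shows "f \<in> borel_measurable lebesgue"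
proof (rule borel_measurable_LIMSEQ_metric)
  fix n :: nat
  have "set_integrable lebesgue (cball 0 (real n)) f"
    using assms by (simp add: locally_integrable_def)
  then show "(\<lambda>x. indicator (cball 0 (real n)) x *\<^sub>R f x) \<in> borel_measurable lebesgue"
    by (simp add: set_integrable_def integrable_iff_bounded)
next
  fix x :: 'a
  obtain m :: nat where m: "norm x \<le> real m" using real_arch_simple by blast
  have "\<forall>\<^sub>F n in sequentially. indicator (cball 0 (real n)) x *\<^sub>R f x = f x"
    using eventually_ge_at_top[of m] by eventually_elim (use m in \<open>auto simp: indicator_def\<close>)
  then show "(\<lambda>n. indicator (cball 0 (real n)) x *\<^sub>R f x) \<longlonglongrightarrow> f x"
    by (rule tendsto_eventually)
qed

lemma locally_integrable_add:
  fixes f g :: "'a::euclidean_space \<Rightarrow> 'b::euclidean_space"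
  shows "locally_integrable f \<Longrightarrow> locally_integrable g \<Longrightarrow> locally_integrable (\<lambda>x. f x + g x)"
  unfolding locally_integrable_def by (auto intro: set_integral_add)

lemma locally_integrable_scaleR:
  fixes f :: "'a::euclidean_space \<Rightarrow> 'b::euclidean_space"
  shows "locally_integrable f \<Longrightarrow> locally_integrable (\<lambda>x. c *\<^sub>R f x)"
  unfolding locally_integrable_def by auto

lemma locally_integrable_inner:
  fixes f :: "'a::euclidean_space \<Rightarrow> 'b::euclidean_space"
  assumes "locally_integrable f" shows "locally_integrable (\<lambda>x. f x \<bullet> e)"
  unfolding locally_integrable_def
proof (intro allI impI)
  fix K :: "'a set" assume "compact K"
  then have "integrable lebesgue (\<lambda>x. (indicator K x *\<^sub>R f x) \<bullet> e)"
    using assms by (intro integrable_inner_left) (simp add: locally_integrable_def set_integrable_def)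
  then show "set_integrable lebesgue K (\<lambda>x. f x \<bullet> e)" by (simp add: set_integrable_def)
qed

lemma integrable_locally_integrable_mult:
  fixes u \<psi> :: "'a::euclidean_space \<Rightarrow> real"
  assumes u: "locally_integrable u" and c: "continuous_on UNIV \<psi>"
    and K: "compact K" and z: "\<And>x. x \<notin> K \<Longrightarrow> \<psi> x = 0"
  shows "integrable lebesgue (\<lambda>x. u x * \<psi> x)"
proof -
  have "bounded (\<psi> ` K)"
    by (intro compact_imp_bounded compact_continuous_image continuous_on_subset[OF c] K) auto
  then obtain M where M: "\<And>x. x \<in> K \<Longrightarrow> \<bar>\<psi> x\<bar> \<le> M" by (auto simp: bounded_iff)
  have i: "integrable lebesgue (\<lambda>x. M * (indicator K x *\<^sub>R u x))"
    using u K by (auto simp: locally_integrable_def set_integrable_def)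
  have m: "\<psi> \<in> borel_measurable lebesgue"
    using c by (intro borel_measurable_lebesgueI borel_measurable_continuous_onI)
  show ?thesis
  proof (rule Bochner_Integration.integrable_bound[OF i])
    show "(\<lambda>x. u x * \<psi> x) \<in> borel_measurable lebesgue"
      using m locally_integrable_measurable[OF u] by auto
    show "AE x in lebesgue. norm (u x * \<psi> x) \<le> norm (M * (indicator K x *\<^sub>R u x))"
    proof (intro AE_I2)
      fix x
      show "norm (u x * \<psi> x) \<le> norm (M * (indicator K x *\<^sub>R u x))"
      proof (cases "x \<in> K")
        case True
        then have "\<bar>\<psi> x\<bar> \<le> \<bar>M\<bar>" using M[of x] by linarith
        then have "\<bar>u x\<bar> * \<bar>\<psi> x\<bar> \<le> \<bar>u x\<bar> * \<bar>M\<bar>" by (intro mult_left_mono) auto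
        then show ?thesis using True by (simp add: abs_mult mult.commute)
      qed (simp add: z)
    qed
  qed
qed

lemma test_function_derivative:
  assumes "\<phi> \<in> test_functions"
  shows "(\<phi> has_derivative frechet_derivative \<phi> (at x)) (at x)"
  using assms by (auto simp: test_functions_def smooth_def frechet_derivative_works dest!: spec[of _ "[]"])

lemma test_function_continuous: "\<phi> \<in> test_functions \<Longrightarrow> continuous_on UNIV \<phi>"
  using test_function_derivative has_derivative_continuous
  by (metis continuous_at_imp_continuous_on)

lemma test_function_partial_deriv_continuous:
  assumes "\<phi> \<in> test_functions" "e \<in> Basis"
  shows "continuous_on UNIV (partial_deriv e \<phi>)"
proof -
  have "(partial_deriv e \<phi>) differentiable (at x)" for x
    using assms by (auto simp: test_functions_def smooth_def dest!: spec[of _ "[e]"])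
  then show ?thesis
    by (simp add: continuous_at_imp_continuous_on differentiable_imp_continuous_within)
qed

lemma test_function_eq_0: "x \<notin> closure {x. \<phi> x \<noteq> 0} \<Longrightarrow> \<phi> x = 0"
  using closure_subset[of "{x. \<phi> x \<noteq> 0}"] by blast

lemma partial_deriv_eq_0:
  assumes x: "x \<notin> closure {x. \<phi> x \<noteq> 0}"
  shows "partial_deriv e \<phi> x = 0"
proof -
  have "((\<lambda>x. 0) has_derivative (\<lambda>h. 0)) (at x)" by simp
  then have "(\<phi> has_derivative (\<lambda>h. 0)) (at x)"
    by (rule has_derivative_transform_within_open[of _ _ _ _ "- closure {x. \<phi> x \<noteq> 0}"])
       (use x test_function_eq_0 in \<open>auto simp: open_Compl\<close>)
  then show ?thesis unfolding partial_deriv_def by (metis frechet_derivative_at)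
qed

lemma weak_gradient_integrable:
  assumes "has_weak_gradient u g" "\<phi> \<in> test_functions" "e \<in> Basis"
  shows "integrable lebesgue (\<lambda>x. u x * partial_deriv e \<phi> x)"
    and "integrable lebesgue (\<lambda>x. (g x \<bullet> e) * \<phi> x)"
proof -
  from assms have K: "compact (closure {x. \<phi> x \<noteq> 0})" by (simp add: test_functions_def)
  show "integrable lebesgue (\<lambda>x. u x * partial_deriv e \<phi> x)"
    using assms(1) by (intro integrable_locally_integrable_mult[OF _ _ K]
        test_function_partial_deriv_continuous assms partial_deriv_eq_0) (simp_all add: has_weak_gradient_def)
  show "integrable lebesgue (\<lambda>x. (g x \<bullet> e) * \<phi> x)"
    using assms(1) by (intro integrable_locally_integrable_mult[OF _ _ K]
        test_function_continuous assms test_function_eq_0 locally_integrable_inner)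
      (simp_all add: has_weak_gradient_def)
qed

lemma has_weak_gradient_add:
  assumes "has_weak_gradient u g" "has_weak_gradient v h"
  shows "has_weak_gradient (\<lambda>x. u x + v x) (\<lambda>x. g x + h x)"
  using assms weak_gradient_integrable[OF assms(1)] weak_gradient_integrable[OF assms(2)]
  by (simp add: has_weak_gradient_def locally_integrable_add distrib_right inner_add_left)

lemma has_weak_gradient_scale:
  assumes "has_weak_gradient u g"
  shows "has_weak_gradient (\<lambda>x. c * u x) (\<lambda>x. c *\<^sub>R g x)"
  using assms locally_integrable_scaleR[of u c]
  by (simp add: has_weak_gradient_def locally_integrable_scaleR mult.assoc)

text \<open>Indicators of open boxes are bounded pointwise limits of products of steep smooth steps
  supported in the closed box, so dominated convergence reduces the claim to integrals over
  boxes.\<close>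

lemma AE_zero_if_test_integrals_zero:
  fixes f :: "'a::euclidean_space \<Rightarrow> real"
  assumes loc: "locally_integrable f"
    and test: "\<And>\<phi>. \<phi> \<in> test_functions \<Longrightarrow> (\<integral>x. f x * \<phi> x \<partial>lebesgue) = 0"
  shows "AE x in lebesgue. f x = 0"
proof (rule AE_zero_if_box_integrals_zero[OF loc])
  fix a b :: 'a
  \<comment> \<open>The shift by -1 moves the transition inside the interval: each factor vanishes
    up to the endpoint and equals 1 from distance 2 / n on.\<close>
  define F where "F n i s = smooth_step (real n * (s - a \<bullet> i) - 1) * smooth_step (real n * (b \<bullet> i - s) - 1)"
    for n i s
  have nonneg_arg: "smooth_step (real n * t - 1) = 0" if "t \<le> 0" for n t
    using that by (intro smooth_step_eq_0) (simp add: mult_nonneg_nonpos)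
  have sm: "smooth_real (F n i)" for n i
  proof -
    have "smooth_real (\<lambda>s. smooth_step (real n * s + (- real n * (a \<bullet> i) - 1)) *
       smooth_step ((- real n) * s + (real n * (b \<bullet> i) - 1)))"
      by (intro smooth_real_mult smooth_real_affine smooth_real_smooth_step)
    then show ?thesis by (simp add: F_def[abs_def] algebra_simps)
  qed
  have z: "F n i s = 0" if "s \<notin> {a \<bullet> i..b \<bullet> i}" for n i s
    using that by (auto simp: F_def nonneg_arg)
  have tf: "coord_prod (F n) \<in> test_functions" for n
    by (rule test_function_coord_prod[of _ a b]) (use sm z in auto)
  have lim: "(\<lambda>n. coord_prod (F n) x) \<longlonglongrightarrow> indicator (box a b) x" for x
  proof (cases "x \<in> box a b")
    case True
    have "\<forall>\<^sub>F n in sequentially. F n i (x \<bullet> i) = 1" if i: "i \<in> Basis" for i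
    proof -
      have one: "\<forall>\<^sub>F n in sequentially. smooth_step (real n * t - 1) = 1" if "t > 0" for t
      proof -
        obtain m :: nat where m: "2 / t \<le> real m" using real_arch_simple by blast
        show ?thesis using eventually_ge_at_top[of m]
        proof eventually_elim
          case (elim n)
          then have "2 / t \<le> real n" using m by simp
          then have "2 \<le> real n * t" using that by (simp add: field_simps)
          then show ?case by (intro smooth_step_eq_1) simp
        qed
      qed
      have "0 < x \<bullet> i - a \<bullet> i" "0 < b \<bullet> i - x \<bullet> i" using True i by (auto simp: mem_box)
      from one[OF this(1)] one[OF this(2)]
      show ?thesis by eventually_elim (simp add: F_def)
    qed
    then have "\<forall>\<^sub>F n in sequentially. \<forall>i\<in>Basis. F n i (x \<bullet> i) = 1"
      by (intro eventually_ball_finite) auto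
    then have "\<forall>\<^sub>F n in sequentially. coord_prod (F n) x = indicator (box a b) x"
      by eventually_elim (use True in \<open>simp add: coord_prod_def\<close>)
    then show ?thesis by (rule tendsto_eventually)
  next
    case False
    then obtain i where i: "i \<in> Basis" "x \<bullet> i \<le> a \<bullet> i \<or> b \<bullet> i \<le> x \<bullet> i"
      by (auto simp: mem_box not_less)
    then have "F n i (x \<bullet> i) = 0" for n by (auto simp: F_def nonneg_arg)
    with i(1) have "coord_prod (F n) x = 0" for n by (auto simp: coord_prod_def)
    then show ?thesis using False by simp
  qed
  have F01: "0 \<le> F n i s" "F n i s \<le> 1" for n i s
    by (auto simp: F_def smooth_step_bounds mult_le_one)
  have bd: "\<bar>coord_prod (F n) x\<bar> \<le> indicator (cbox a b) x" for n x
  proof (cases "x \<in> cbox a b")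
    case True
    then show ?thesis using F01 by (auto simp: coord_prod_def prod_le_1 prod_nonneg)
  next
    case False
    then show ?thesis using coord_prod_eq_0[of x a b "F n"] z by auto
  qed
  have m: "f \<in> borel_measurable lebesgue" by (rule locally_integrable_measurable[OF loc])
  have "(\<lambda>n. \<integral>x. f x * coord_prod (F n) x \<partial>lebesgue) \<longlonglongrightarrow> (\<integral>x. f x * indicator (box a b) x \<partial>lebesgue)"
  proof (rule integral_dominated_convergence[where w = "\<lambda>x. \<bar>indicator (cbox a b) x * f x\<bar>"])
    show "(\<lambda>x. f x * indicator (box a b) x) \<in> borel_measurable lebesgue" using m by auto
    show "(\<lambda>x. f x * coord_prod (F n) x) \<in> borel_measurable lebesgue" for n
      by (rule borel_measurable_times[OF m borel_measurable_lebesgueI])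
         (intro borel_measurable_continuous_onI test_function_continuous tf)
    show "integrable lebesgue (\<lambda>x. \<bar>indicator (cbox a b) x * f x\<bar>)"
      using loc by (auto simp: locally_integrable_def set_integrable_def)
    show "AE x in lebesgue. (\<lambda>n. f x * coord_prod (F n) x) \<longlonglongrightarrow> f x * indicator (box a b) x"
      by (intro AE_I2 tendsto_mult_left lim)
    show "AE x in lebesgue. norm (f x * coord_prod (F n) x) \<le> \<bar>indicator (cbox a b) x * f x\<bar>" for n
    proof (intro AE_I2)
      fix x
      have "\<bar>f x\<bar> * \<bar>coord_prod (F n) x\<bar> \<le> \<bar>f x\<bar> * indicator (cbox a b) x"
        by (intro mult_left_mono bd) auto
      then show "norm (f x * coord_prod (F n) x) \<le> \<bar>indicator (cbox a b) x * f x\<bar>"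
        by (simp add: abs_mult mult.commute)
    qed
  qed
  then have "(\<integral>x. f x * indicator (box a b) x \<partial>lebesgue) = 0"
    by (simp add: test[OF tf] LIMSEQ_const_iff)
  then show "(\<integral>x. indicator (box a b) x * f x \<partial>lebesgue) = 0" by (simp add: mult.commute)
qed

text \<open>Makes the choice in \<open>weak_gradient\<close> harmless: the chosen function agrees
  almost everywhere with any weak gradient at hand, and is therefore additive and homogeneous up to
  null sets.\<close>

lemma weak_gradient_unique:
  fixes u :: "'a::euclidean_space \<Rightarrow> real"
  assumes "has_weak_gradient u g" "has_weak_gradient u h"
  shows "AE x in lebesgue. g x = h x"
proof -
  have "AE x in lebesgue. g x \<bullet> e + (-1) * (h x \<bullet> e) = 0" if e: "e \<in> Basis" for e
  proof (rule AE_zero_if_test_integrals_zero)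
    show "locally_integrable (\<lambda>x. g x \<bullet> e + - 1 * (h x \<bullet> e))"
      using assms locally_integrable_scaleR[OF locally_integrable_inner, of h "-1" e] unfolding has_weak_gradient_def
      by (intro locally_integrable_add locally_integrable_inner) auto
    fix \<phi> :: "'a \<Rightarrow> real" assume \<phi>: "\<phi> \<in> test_functions"
    have "(\<integral>x. (g x \<bullet> e + - 1 * (h x \<bullet> e)) * \<phi> x \<partial>lebesgue) =
      (\<integral>x. (g x \<bullet> e) * \<phi> x - (h x \<bullet> e) * \<phi> x \<partial>lebesgue)" by (simp add: algebra_simps)
    also have "\<dots> = (\<integral>x. (g x \<bullet> e) * \<phi> x \<partial>lebesgue) - (\<integral>x. (h x \<bullet> e) * \<phi> x \<partial>lebesgue)"
      using weak_gradient_integrable[OF _ \<phi> e] assms by (intro Bochner_Integration.integral_diff) auto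
    also have "\<dots> = 0" using assms \<phi> e by (simp add: has_weak_gradient_def)
    finally show "(\<integral>x. (g x \<bullet> e + - 1 * (h x \<bullet> e)) * \<phi> x \<partial>lebesgue) = 0" .
  qed
  then have "AE x in lebesgue. \<forall>e\<in>Basis. g x \<bullet> e + (-1) * (h x \<bullet> e) = 0"
    by (intro AE_finite_allI) auto
  then show ?thesis by eventually_elim (auto intro: euclidean_eqI)
qed

section \<open>Hilbert structure of H1 and boundedness of weakly convergent sequences\<close>

section \<open>The space H1\<close>

lemma powr_two: "0 \<le> x \<Longrightarrow> x powr 2 = x\<^sup>2" for x :: real
  by (cases "x = 0") (auto simp: powr_numeral)

lemma mem_Lp_2:
  "f \<in> Lp 2 \<longleftrightarrow> f \<in> borel_measurable lebesgue \<and> integrable lebesgue (\<lambda>x. (norm (f x))\<^sup>2)"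
  by (simp add: Lp_def powr_two)

lemma Lp_2_AE_cong:
  assumes "f \<in> Lp 2" "g \<in> borel_measurable lebesgue" "AE x in lebesgue. f x = g x"
  shows "g \<in> Lp 2"
  using assms unfolding mem_Lp_2
  by (auto intro!: integrable_cong_AE_imp[where g = "\<lambda>x. (norm (f x))\<^sup>2"])

lemma Lp_2_inner_integrable:
  fixes f g :: "'a::euclidean_space \<Rightarrow> 'b::euclidean_space"
  assumes "f \<in> Lp 2" "g \<in> Lp 2"
  shows "integrable lebesgue (\<lambda>x. f x \<bullet> g x)"
proof (rule Bochner_Integration.integrable_bound)
  show "integrable lebesgue (\<lambda>x. (norm (f x))\<^sup>2 + (norm (g x))\<^sup>2)"
    using assms by (auto simp: mem_Lp_2)
  show "(\<lambda>x. f x \<bullet> g x) \<in> borel_measurable lebesgue"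
    using assms by (auto simp: mem_Lp_2)
  have "\<bar>f x \<bullet> g x\<bar> \<le> (norm (f x))\<^sup>2 + (norm (g x))\<^sup>2" for x
    using Cauchy_Schwarz_ineq2[of "f x" "g x"] sum_squares_bound[of "norm (f x)" "norm (g x)"]
      mult_nonneg_nonneg[OF norm_ge_zero[of "f x"] norm_ge_zero[of "g x"]] by linarith
  then show "AE x in lebesgue. norm (f x \<bullet> g x) \<le> norm ((norm (f x))\<^sup>2 + (norm (g x))\<^sup>2)"
    by (auto intro!: AE_I2)
qed

lemma Lp_2_add:
  fixes f g :: "'a::euclidean_space \<Rightarrow> 'b::euclidean_space"
  assumes "f \<in> Lp 2" "g \<in> Lp 2"
  shows "(\<lambda>x. f x + g x) \<in> Lp 2"
proof -
  have "integrable lebesgue (\<lambda>x. (norm (f x))\<^sup>2 + 2 * (f x \<bullet> g x) + (norm (g x))\<^sup>2)"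
    using assms Lp_2_inner_integrable[OF assms] by (auto simp: mem_Lp_2)
  moreover have "(norm (f x + g x))\<^sup>2 = (norm (f x))\<^sup>2 + 2 * (f x \<bullet> g x) + (norm (g x))\<^sup>2" for x
    by (simp add: power2_norm_eq_inner inner_add_left inner_add_right inner_commute)
  ultimately show ?thesis using assms by (simp add: mem_Lp_2 borel_measurable_add)
qed

lemma Lp_2_scaleR:
  fixes f :: "'a::euclidean_space \<Rightarrow> 'b::euclidean_space"
  assumes "f \<in> Lp 2"
  shows "(\<lambda>x. c *\<^sub>R f x) \<in> Lp 2"
  using assms by (simp add: mem_Lp_2 power_mult_distrib borel_measurable_scaleR)

text \<open>The function chosen in \<open>weak_gradient\<close> is not asked to be square
  integrable; this property is carried over from the witness in \<open>H1\<close> by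
  uniqueness.\<close>

lemma H1_weak_gradient:
  assumes "u \<in> H1"
  shows "has_weak_gradient u (weak_gradient u)" "weak_gradient u \<in> Lp 2" "u \<in> Lp 2"
proof -
  from assms obtain g where g: "g \<in> Lp 2" "has_weak_gradient u g" by (auto simp: H1_def)
  then show w: "has_weak_gradient u (weak_gradient u)"
    unfolding weak_gradient_def by (metis someI_ex)
  show "weak_gradient u \<in> Lp 2"
    using weak_gradient_unique[OF g(2) w] w
    by (intro Lp_2_AE_cong[OF g(1)] locally_integrable_measurable) (auto simp: has_weak_gradient_def)
  show "u \<in> Lp 2" using assms by (simp add: H1_def)
qed

lemma H1_add:
  assumes "u \<in> H1" "v \<in> H1"
  shows "(\<lambda>x. u x + v x) \<in> H1"
    and "AE x in lebesgue. weak_gradient (\<lambda>x. u x + v x) x = weak_gradient u x + weak_gradient v x"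
proof -
  have g: "has_weak_gradient (\<lambda>x. u x + v x) (\<lambda>x. weak_gradient u x + weak_gradient v x)"
    by (intro has_weak_gradient_add H1_weak_gradient assms)
  then show h: "(\<lambda>x. u x + v x) \<in> H1" unfolding H1_def
    using Lp_2_add[OF H1_weak_gradient(2)[OF assms(1)] H1_weak_gradient(2)[OF assms(2)]]
      Lp_2_add[OF H1_weak_gradient(3)[OF assms(1)] H1_weak_gradient(3)[OF assms(2)]] by blast
  show "AE x in lebesgue. weak_gradient (\<lambda>x. u x + v x) x = weak_gradient u x + weak_gradient v x"
    by (rule weak_gradient_unique[OF H1_weak_gradient(1)[OF h] g])
qed

lemma H1_scale:
  assumes "u \<in> H1"
  shows "(\<lambda>x. c * u x) \<in> H1"
    and "AE x in lebesgue. weak_gradient (\<lambda>x. c * u x) x = c *\<^sub>R weak_gradient u x"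
proof -
  have g: "has_weak_gradient (\<lambda>x. c * u x) (\<lambda>x. c *\<^sub>R weak_gradient u x)"
    by (intro has_weak_gradient_scale H1_weak_gradient assms)
  then show h: "(\<lambda>x. c * u x) \<in> H1" unfolding H1_def
    using Lp_2_scaleR[OF H1_weak_gradient(2)[OF assms]]
      Lp_2_scaleR[OF H1_weak_gradient(3)[OF assms], of c] by auto
  show "AE x in lebesgue. weak_gradient (\<lambda>x. c * u x) x = c *\<^sub>R weak_gradient u x"
    by (rule weak_gradient_unique[OF H1_weak_gradient(1)[OF h] g])
qed

text \<open>Common core of the Cauchy-Schwarz inequalities for the L2 product and for
  \<open>inner_H1\<close>. For C > 0 the minimum at t = - B / C decides; C = 0 occurs for functions
  that vanish almost everywhere.\<close>

lemma discriminant_bound: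
  fixes A B C :: real
  assumes q: "\<And>t. 0 \<le> A + 2 * t * B + t\<^sup>2 * C" and C: "0 \<le> C"
  shows "B\<^sup>2 \<le> A * C"
proof (cases "C = 0")
  case True
  have "B = 0"
  proof (rule ccontr)
    assume "B \<noteq> 0"
    \<comment> \<open>This t makes 2 t B equal to -(|A| + 1), so the expression, affine in t for C =
      0, becomes negative.\<close>
    then have "0 \<le> A + (- (2 * \<bar>A\<bar>) - 2) / 2"
      using q[of "- (\<bar>A\<bar> + 1) / (2 * B)"] True by simp
    then show False using abs_ge_self[of A] by (simp add: field_simps)
  qed
  with True show ?thesis by simp
next
  case False
  with C have "0 < C" by simp
  with q[of "- B / C"] show ?thesis by (simp add: field_simps power2_eq_square)
qed

lemma Lp_2_Cauchy_Schwarz: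
  fixes f g :: "'a::euclidean_space \<Rightarrow> 'b::euclidean_space"
  assumes f: "f \<in> Lp 2" and g: "g \<in> Lp 2"
  shows "(\<integral>x. f x \<bullet> g x \<partial>lebesgue)\<^sup>2 \<le>
    (\<integral>x. (norm (f x))\<^sup>2 \<partial>lebesgue) * (\<integral>x. (norm (g x))\<^sup>2 \<partial>lebesgue)"
proof (rule discriminant_bound)
  fix t
  have "0 \<le> (\<integral>x. (norm (f x + t *\<^sub>R g x))\<^sup>2 \<partial>lebesgue)" by simp
  also have "\<dots> = (\<integral>x. (norm (f x))\<^sup>2 + 2 * t * (f x \<bullet> g x) + t\<^sup>2 * (norm (g x))\<^sup>2 \<partial>lebesgue)"
    unfolding power2_norm_eq_inner
    by (intro Bochner_Integration.integral_cong)
       (auto simp: inner_add_left inner_add_right inner_commute algebra_simps power2_eq_square)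
  also have "\<dots> = (\<integral>x. (norm (f x))\<^sup>2 \<partial>lebesgue) + 2 * t * (\<integral>x. f x \<bullet> g x \<partial>lebesgue)
      + t\<^sup>2 * (\<integral>x. (norm (g x))\<^sup>2 \<partial>lebesgue)"
    using f g Lp_2_inner_integrable[OF f g] by (simp add: mem_Lp_2)
  finally show "0 \<le> (\<integral>x. (norm (f x))\<^sup>2 \<partial>lebesgue) + 2 * t * (\<integral>x. f x \<bullet> g x \<partial>lebesgue)
      + t\<^sup>2 * (\<integral>x. (norm (g x))\<^sup>2 \<partial>lebesgue)" .
qed simp

text \<open>Sokal's form of the gliding hump: the sign of the \<open>j\<close>-th term is chosen so that the partial sum
  is large at \<open>x j\<close>, and the tail of the series is too small to spoil this.\<close>

lemma gliding_hump:
  fixes e :: "nat \<Rightarrow> 'v \<Rightarrow> real" and x :: "nat \<Rightarrow> 'v" and nrm :: "'v \<Rightarrow> real"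
  assumes bd: "\<And>i j. \<bar>e i (x j)\<bar> \<le> nrm (x j)"
    and eq: "\<And>j. e j (x j) = nrm (x j)"
    and big: "\<And>j. 4 ^ j \<le> nrm (x j)"
  obtains \<epsilon> :: "nat \<Rightarrow> real" where "\<And>j. \<bar>\<epsilon> j\<bar> = 1"
    "\<And>j. (4 / 3) ^ j / 2 \<le> \<bar>\<Sum>i. \<epsilon> i * (1 / 3) ^ i * e i (x j)\<bar>"
proof -
  define sg where "sg P j = (if (1 / 3) ^ j * nrm (x j) \<le> \<bar>P (x j) + (1 / 3) ^ j * nrm (x j)\<bar> then 1 else -1 :: real)"
    for P :: "'v \<Rightarrow> real" and j
  define P where "P = rec_nat (\<lambda>v. 0) (\<lambda>j P v. P v + sg P j * (1 / 3) ^ j * e j v)"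
  define \<epsilon> where "\<epsilon> j = sg (P j) j" for j
  have P0: "P 0 v = 0" and PS: "P (Suc j) v = P j v + \<epsilon> j * (1 / 3) ^ j * e j v" for j v
    by (simp_all add: P_def \<epsilon>_def)
  have P: "P n v = (\<Sum>i<n. \<epsilon> i * (1 / 3) ^ i * e i v)" for n v
    by (induction n) (auto simp: P0 PS)
  have e1: "\<bar>\<epsilon> j\<bar> = 1" for j by (simp add: \<epsilon>_def sg_def)
  have "(4 / 3) ^ j / 2 \<le> \<bar>\<Sum>i. \<epsilon> i * (1 / 3) ^ i * e i (x j)\<bar>" for j
  proof -
    define n where "n = nrm (x j)"
    have n0: "0 \<le> n" using bd[of 0 j] by (simp add: n_def)
    \<comment> \<open>With h the size of the j-th term, P + h or P - h has absolute value at least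
      h, and the sign was chosen accordingly.\<close>
    have head: "(1 / 3) ^ j * n \<le> \<bar>P (Suc j) (x j)\<bar>"
    proof -
      have "0 \<le> (1 / 3) ^ j * n" using n0 by simp
      then show ?thesis
        by (auto simp: PS \<epsilon>_def sg_def eq n_def[symmetric])
    qed
    have b: "\<bar>\<epsilon> i * (1 / 3) ^ i * e i (x j)\<bar> \<le> (1 / 3) ^ i * n" for i
      using bd[of i j] by (simp add: abs_mult e1 n_def)
    have sm: "summable (\<lambda>i. (1 / 3) ^ i * n)"
      by (intro summable_mult2 summable_geometric) simp
    have sn: "summable (\<lambda>i. \<bar>\<epsilon> i * (1 / 3) ^ i * e i (x j)\<bar>)"
      by (rule summable_comparison_test'[OF sm, of 0]) (use b in auto)
    then have s: "summable (\<lambda>i. \<epsilon> i * (1 / 3) ^ i * e i (x j))" by (rule summable_rabs_cancel)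
    have split: "(\<Sum>i. \<epsilon> i * (1 / 3) ^ i * e i (x j)) =
       (\<Sum>i. \<epsilon> (i + Suc j) * (1 / 3) ^ (i + Suc j) * e (i + Suc j) (x j)) + P (Suc j) (x j)"
      unfolding P by (rule suminf_split_initial_segment[OF s])
    have "\<bar>\<Sum>i. \<epsilon> (i + Suc j) * (1 / 3) ^ (i + Suc j) * e (i + Suc j) (x j)\<bar> \<le>
        (\<Sum>i. \<bar>\<epsilon> (i + Suc j) * (1 / 3) ^ (i + Suc j) * e (i + Suc j) (x j)\<bar>)"
      using sn by (intro summable_rabs) (subst summable_iff_shift[of "\<lambda>i. \<bar>\<epsilon> i * (1 / 3) ^ i * e i (x j)\<bar>"])
    also have "\<dots> \<le> (\<Sum>i. (1 / 3) ^ (i + Suc j) * n)"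
    proof (rule suminf_le)
      show "\<bar>\<epsilon> (i + Suc j) * (1 / 3) ^ (i + Suc j) * e (i + Suc j) (x j)\<bar> \<le> (1 / 3) ^ (i + Suc j) * n" for i
        by (rule b)
      show "summable (\<lambda>i. \<bar>\<epsilon> (i + Suc j) * (1 / 3) ^ (i + Suc j) * e (i + Suc j) (x j)\<bar>)"
        using sn by (subst summable_iff_shift[of "\<lambda>i. \<bar>\<epsilon> i * (1 / 3) ^ i * e i (x j)\<bar>"])
      show "summable (\<lambda>i. (1 / 3) ^ (i + Suc j) * n)"
        using sm by (subst summable_iff_shift[of "\<lambda>i. (1 / 3) ^ i * n"])
    qed
    also have "\<dots> = (\<Sum>i. (1 / 3) ^ i * ((1 / 3) ^ Suc j * n))"
      by (simp add: power_add mult_ac)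
    \<comment> \<open>With ratio 1 / 3 the tail is at most half of the head, so half of it survives;
      against it 4 ^ j still grows like (4 / 3) ^ j.\<close>
    also have "\<dots> = (3 / 2) * ((1 / 3) ^ Suc j * n)"
      by (subst suminf_mult2[symmetric]) (simp_all add: suminf_geometric summable_geometric)
    also have "\<dots> = (1 / 3) ^ j * n / 2" by simp
    finally have "(1 / 3) ^ j * n / 2 \<le> \<bar>\<Sum>i. \<epsilon> i * (1 / 3) ^ i * e i (x j)\<bar>"
      using head unfolding split by linarith
    moreover have "(4 / 3) ^ j / 2 \<le> (1 / 3) ^ j * n / 2"
      using mult_left_mono[OF big[of j], of "(1 / 3) ^ j"]
      by (simp add: n_def power_mult_distrib[symmetric])
    ultimately show ?thesis by linarith
  qed
  with e1 show thesis by (rule that)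
qed

locale H1_potential =
  fixes V :: "'a::euclidean_space \<Rightarrow> real" and V0 Vm :: real
  assumes V_measurable: "V \<in> borel_measurable lebesgue"
    and V0_pos: "0 < V0" and V_lower: "\<And>x. V0 \<le> V x" and V_upper: "\<And>x. V x \<le> Vm"
begin

definition inner_H1 :: "('a \<Rightarrow> real) \<Rightarrow> ('a \<Rightarrow> real) \<Rightarrow> real" where
  "inner_H1 u v = (\<integral>x. weak_gradient u x \<bullet> weak_gradient v x + V x * (u x * v x) \<partial>lebesgue)"

lemma integrable_V_mult:
  assumes "f \<in> Lp 2" "g \<in> Lp 2"
  shows "integrable lebesgue (\<lambda>x. V x * (f x * g x))"
proof (rule Bochner_Integration.integrable_bound)
  show "integrable lebesgue (\<lambda>x. Vm * (f x * g x))"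
    using Lp_2_inner_integrable[OF assms] by simp
  show "(\<lambda>x. V x * (f x * g x)) \<in> borel_measurable lebesgue"
    using assms V_measurable by (auto simp: mem_Lp_2)
  have "\<bar>V x\<bar> \<le> \<bar>Vm\<bar>" for x using V0_pos V_lower[of x] V_upper[of x] by linarith
  then show "AE x in lebesgue. norm (V x * (f x * g x)) \<le> norm (Vm * (f x * g x))"
    by (intro AE_I2) (simp add: abs_mult mult_right_mono)
qed

lemma inner_H1_integrable:
  assumes "u \<in> H1" "v \<in> H1"
  shows "integrable lebesgue (\<lambda>x. weak_gradient u x \<bullet> weak_gradient v x + V x * (u x * v x))"
  by (intro Bochner_Integration.integrable_add Lp_2_inner_integrable integrable_V_mult H1_weak_gradient assms)

lemma inner_H1_commute: "inner_H1 u v = inner_H1 v u"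
  unfolding inner_H1_def by (simp add: inner_commute mult.commute)

lemma gradient_inner_measurable:
  assumes "u \<in> H1" "v \<in> H1"
  shows "(\<lambda>x. weak_gradient u x \<bullet> weak_gradient v x + V x * (u x * v x)) \<in> borel_measurable lebesgue"
  using inner_H1_integrable[OF assms] by (rule borel_measurable_integrable)

lemma inner_H1_add:
  assumes "u \<in> H1" "v \<in> H1" "w \<in> H1"
  shows "inner_H1 w (\<lambda>x. u x + v x) = inner_H1 w u + inner_H1 w v"
proof -
  have "inner_H1 w (\<lambda>x. u x + v x) = (\<integral>x. (weak_gradient w x \<bullet> weak_gradient u x + V x * (w x * u x)) +
      (weak_gradient w x \<bullet> weak_gradient v x + V x * (w x * v x)) \<partial>lebesgue)"
    unfolding inner_H1_def
  proof (rule integral_cong_AE)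
    show "AE x in lebesgue. weak_gradient w x \<bullet> weak_gradient (\<lambda>x. u x + v x) x + V x * (w x * (u x + v x)) =
       (weak_gradient w x \<bullet> weak_gradient u x + V x * (w x * u x)) +
      (weak_gradient w x \<bullet> weak_gradient v x + V x * (w x * v x))"
      using H1_add(2)[OF assms(1,2)] by eventually_elim (simp add: inner_add_right algebra_simps)
  qed (intro gradient_inner_measurable borel_measurable_add H1_add assms)+
  also have "\<dots> = inner_H1 w u + inner_H1 w v"
    unfolding inner_H1_def by (intro Bochner_Integration.integral_add inner_H1_integrable assms)
  finally show ?thesis .
qed

lemma inner_H1_scale:
  assumes "u \<in> H1" "w \<in> H1"
  shows "inner_H1 w (\<lambda>x. c * u x) = c * inner_H1 w u"
proof -
  have "inner_H1 w (\<lambda>x. c * u x) = (\<integral>x. c * (weak_gradient w x \<bullet> weak_gradient u x + V x * (w x * u x)) \<partial>lebesgue)"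
    unfolding inner_H1_def
  proof (rule integral_cong_AE)
    show "AE x in lebesgue. weak_gradient w x \<bullet> weak_gradient (\<lambda>x. c * u x) x + V x * (w x * (c * u x)) =
       c * (weak_gradient w x \<bullet> weak_gradient u x + V x * (w x * u x))"
      using H1_scale(2)[OF assms(1), of c] by eventually_elim (simp add: algebra_simps)
    show "(\<lambda>x. weak_gradient w x \<bullet> weak_gradient (\<lambda>x. c * u x) x + V x * (w x * (c * u x))) \<in> borel_measurable lebesgue"
      by (intro gradient_inner_measurable H1_scale assms)
    show "(\<lambda>x. c * (weak_gradient w x \<bullet> weak_gradient u x + V x * (w x * u x))) \<in> borel_measurable lebesgue"
      using gradient_inner_measurable[OF assms(2,1)] by (rule borel_measurable_times[OF borel_measurable_const])
  qed
  then show ?thesis unfolding inner_H1_def by simp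
qed

lemma inner_H1_self:
  assumes "u \<in> H1"
  shows "0 \<le> inner_H1 u u" "H1_norm V u = sqrt (inner_H1 u u)"
proof -
  have "0 \<le> V x" for x using V_lower[of x] V0_pos by simp
  then show "0 \<le> inner_H1 u u" unfolding inner_H1_def by (intro integral_nonneg_AE AE_I2) auto
  show "H1_norm V u = sqrt (inner_H1 u u)"
    unfolding H1_norm_def inner_H1_def by (simp add: power2_norm_eq_inner power2_eq_square[of "u _"])
qed

lemma inner_H1_Cauchy_Schwarz:
  assumes "u \<in> H1" "v \<in> H1"
  shows "\<bar>inner_H1 u v\<bar> \<le> H1_norm V u * H1_norm V v"
proof -
  have "(inner_H1 u v)\<^sup>2 \<le> inner_H1 u u * inner_H1 v v"
  proof (rule discriminant_bound)
    fix t
    have h: "(\<lambda>x. t * v x) \<in> H1" and h2: "(\<lambda>x. u x + t * v x) \<in> H1"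
      using assms H1_scale H1_add(1)[OF assms(1) H1_scale(1)[OF assms(2)]] by auto
    have "0 \<le> inner_H1 (\<lambda>x. u x + t * v x) (\<lambda>x. u x + t * v x)" by (rule inner_H1_self[OF h2])
    also have "\<dots> = inner_H1 u (\<lambda>x. u x + t * v x) + t * inner_H1 v (\<lambda>x. u x + t * v x)"
      using inner_H1_add[OF assms(1) h h2] inner_H1_scale[OF assms(2) h2]
      by (simp add: inner_H1_commute)
    also have "\<dots> = inner_H1 u u + 2 * t * inner_H1 u v + t\<^sup>2 * inner_H1 v v"
      using inner_H1_add[OF assms(1) h] inner_H1_scale[OF assms(2)] assms
      by (simp add: inner_H1_commute[of v u] power2_eq_square algebra_simps)
    finally show "0 \<le> inner_H1 u u + 2 * t * inner_H1 u v + t\<^sup>2 * inner_H1 v v" .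
  qed (rule inner_H1_self[OF assms(2)])
  then have "sqrt ((inner_H1 u v)\<^sup>2) \<le> sqrt (inner_H1 u u * inner_H1 v v)" by (rule real_sqrt_le_mono)
  then show ?thesis by (simp add: real_sqrt_mult inner_H1_self assms)
qed

lemma L2_norms_le_H1_norm:
  assumes "u \<in> H1"
  shows "V0 * (\<integral>x. (u x)\<^sup>2 \<partial>lebesgue) \<le> (H1_norm V u)\<^sup>2"
    and "(\<integral>x. (norm (weak_gradient u x))\<^sup>2 \<partial>lebesgue) \<le> (H1_norm V u)\<^sup>2"
proof -
  have i1: "integrable lebesgue (\<lambda>x. (norm (weak_gradient u x))\<^sup>2)"
    and i2: "integrable lebesgue (\<lambda>x. (u x)\<^sup>2)"
    using H1_weak_gradient[OF assms] by (simp_all add: mem_Lp_2)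
  have i3: "integrable lebesgue (\<lambda>x. V x * (u x)\<^sup>2)"
    using integrable_V_mult[OF H1_weak_gradient(3)[OF assms] H1_weak_gradient(3)[OF assms]]
    by (simp add: power2_eq_square)
  have eq: "(H1_norm V u)\<^sup>2 = (\<integral>x. (norm (weak_gradient u x))\<^sup>2 \<partial>lebesgue) + (\<integral>x. V x * (u x)\<^sup>2 \<partial>lebesgue)"
    using inner_H1_self[OF assms] i1 i3
    by (simp add: inner_H1_def power2_norm_eq_inner power2_eq_square[of "u _"])
  have "V0 * (\<integral>x. (u x)\<^sup>2 \<partial>lebesgue) = (\<integral>x. V0 * (u x)\<^sup>2 \<partial>lebesgue)" by simp
  also have "\<dots> \<le> (\<integral>x. V x * (u x)\<^sup>2 \<partial>lebesgue)"
    using i2 i3 by (intro integral_mono mult_right_mono V_lower) auto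
  finally have "V0 * (\<integral>x. (u x)\<^sup>2 \<partial>lebesgue) \<le> (\<integral>x. V x * (u x)\<^sup>2 \<partial>lebesgue)" .
  moreover have "0 \<le> (\<integral>x. (norm (weak_gradient u x))\<^sup>2 \<partial>lebesgue)" by simp
  moreover have "0 \<le> V0 * (\<integral>x. (u x)\<^sup>2 \<partial>lebesgue)" using V0_pos by simp
  ultimately show "V0 * (\<integral>x. (u x)\<^sup>2 \<partial>lebesgue) \<le> (H1_norm V u)\<^sup>2"
    "(\<integral>x. (norm (weak_gradient u x))\<^sup>2 \<partial>lebesgue) \<le> (H1_norm V u)\<^sup>2"
    unfolding eq by linarith+
qed

text \<open>The lower bound on V controls the L2 norm by \<open>H1_norm\<close>. These functionals
  are the ones evaluated later, since the value of a mollification at a point is an L2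
  pairing.\<close>

lemma L2_functional_in_H1_dual:
  assumes f: "f \<in> Lp 2"
  shows "(\<lambda>v. \<integral>x. f x * v x \<partial>lebesgue) \<in> H1_dual V"
proof -
  define A where "A = (\<integral>x. (f x)\<^sup>2 \<partial>lebesgue)"
  have int: "integrable lebesgue (\<lambda>x. f x * v x)" if "v \<in> H1" for v
    using Lp_2_inner_integrable[OF f H1_weak_gradient(3)[OF that]] by simp
  have "\<bar>\<integral>x. f x * v x \<partial>lebesgue\<bar> \<le> sqrt (A / V0) * H1_norm V v" if v: "v \<in> H1" for v
  proof -
    have "(\<integral>x. f x * v x \<partial>lebesgue)\<^sup>2 \<le> A * (\<integral>x. (v x)\<^sup>2 \<partial>lebesgue)"
      using Lp_2_Cauchy_Schwarz[OF f H1_weak_gradient(3)[OF v]] by (simp add: A_def)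
    also have "\<dots> \<le> A * ((H1_norm V v)\<^sup>2 / V0)"
      using L2_norms_le_H1_norm(1)[OF v] V0_pos
      by (intro mult_left_mono) (auto simp: A_def field_simps)
    finally have "sqrt ((\<integral>x. f x * v x \<partial>lebesgue)\<^sup>2) \<le> sqrt ((A / V0) * (H1_norm V v)\<^sup>2)"
      by (intro real_sqrt_le_mono) simp
    moreover have "0 \<le> H1_norm V v" using inner_H1_self[OF v] by simp
    ultimately show ?thesis by (simp add: real_sqrt_mult real_sqrt_divide)
  qed
  then show ?thesis unfolding H1_dual_def
    by (auto simp: distrib_left int mult.left_commute[of "f _"] intro!: exI[of _ "sqrt (A / V0)"])
qed

text \<open>If the norms exceed 4 ^ j along some indices, the pairings with the normalised elements
  are functionals of norm at most 1 that attain the norm there. The gliding hump adds them up with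
  geometric weights and signs to one bounded functional that is unbounded along the
  sequence.\<close>

lemma weakly_convergent_bounded:
  assumes "weakly_converges_H1 V w u"
  shows "\<exists>C. \<forall>k. H1_norm V (w k) \<le> C"
proof (rule ccontr)
  assume "\<not> ?thesis"
  then have "\<forall>j. \<exists>k. 4 ^ j < H1_norm V (w k)" by (metis not_le)
  \<comment> \<open>These indices are not arranged increasingly: unbounded values of L along them
    already contradict the convergence of L (w k).\<close>
  then obtain \<kappa> where \<kappa>: "\<And>j. 4 ^ j < H1_norm V (w (\<kappa> j))" by metis
  define x where "x j = w (\<kappa> j)" for j
  define e where "e j v = inner_H1 (x j) v / H1_norm V (x j)" for j v
  have w: "w k \<in> H1" for k using assms by (simp add: weakly_converges_H1_def)
  then have x: "x j \<in> H1" for j by (simp add: x_def)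
  have big: "4 ^ j < H1_norm V (x j)" for j by (simp add: x_def \<kappa>)
  have pos: "0 < H1_norm V (x j)" for j using big[of j] zero_less_power[of "4::real" j] by linarith
  have e_bd: "\<bar>e j v\<bar> \<le> H1_norm V v" if "v \<in> H1" for j v
    using inner_H1_Cauchy_Schwarz[OF x[of j] that] pos[of j] by (simp add: e_def field_simps)
  have e_eq: "e j (x j) = H1_norm V (x j)" for j
  proof -
    have "inner_H1 (x j) (x j) = H1_norm V (x j) * H1_norm V (x j)"
      using inner_H1_self[OF x[of j]] by simp
    then show ?thesis using pos[of j] by (simp add: e_def)
  qed
  obtain \<epsilon> :: "nat \<Rightarrow> real" where \<epsilon>: "\<And>j. \<bar>\<epsilon> j\<bar> = 1"
    "\<And>j. (4 / 3) ^ j / 2 \<le> \<bar>\<Sum>i. \<epsilon> i * (1 / 3) ^ i * e i (x j)\<bar>"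
    using gliding_hump[of e x "H1_norm V", OF e_bd[OF x] e_eq less_imp_le[OF big]] by blast
  define L where "L v = (\<Sum>i. \<epsilon> i * (1 / 3) ^ i * e i v)" for v
  have b: "\<bar>\<epsilon> i * (1 / 3) ^ i * e i v\<bar> \<le> (1 / 3) ^ i * H1_norm V v" if "v \<in> H1" for i v
    using e_bd[OF that, of i] by (simp add: abs_mult \<epsilon>)
  have sm: "summable (\<lambda>i. (1 / 3) ^ i * H1_norm V v)" for v
    by (intro summable_mult2 summable_geometric) simp
  have sn: "summable (\<lambda>i. \<bar>\<epsilon> i * (1 / 3) ^ i * e i v\<bar>)" if "v \<in> H1" for v
    by (rule summable_comparison_test'[OF sm, of 0]) (use b[OF that] in auto)
  have s: "summable (\<lambda>i. \<epsilon> i * (1 / 3) ^ i * e i v)" if "v \<in> H1" for v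
    using sn[OF that] by (rule summable_rabs_cancel)
  have "L \<in> H1_dual V"
    unfolding H1_dual_def
  proof (intro CollectI conjI ballI allI exI)
    fix u v :: "'a \<Rightarrow> real" assume uv: "u \<in> H1" "v \<in> H1"
    have "L (\<lambda>x. u x + v x) = (\<Sum>i. \<epsilon> i * (1 / 3) ^ i * e i u + \<epsilon> i * (1 / 3) ^ i * e i v)"
      unfolding L_def e_def by (simp add: inner_H1_add uv x add_divide_distrib distrib_left)
    also have "\<dots> = L u + L v"
      unfolding L_def by (intro suminf_add[symmetric] s uv)
    finally show "L (\<lambda>x. u x + v x) = L u + L v" .
  next
    fix c :: real and u :: "'a \<Rightarrow> real" assume u: "u \<in> H1"
    have "L (\<lambda>x. c * u x) = (\<Sum>i. c * (\<epsilon> i * (1 / 3) ^ i * e i u))"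
      unfolding L_def e_def by (simp add: inner_H1_scale u x mult_ac)
    also have "\<dots> = c * L u" unfolding L_def by (intro suminf_mult s u)
    finally show "L (\<lambda>x. c * u x) = c * L u" .
  next
    fix u :: "'a \<Rightarrow> real" assume u: "u \<in> H1"
    have "\<bar>L u\<bar> \<le> (\<Sum>i. \<bar>\<epsilon> i * (1 / 3) ^ i * e i u\<bar>)"
      unfolding L_def by (intro summable_rabs sn u)
    also have "\<dots> \<le> (\<Sum>i. (1 / 3) ^ i * H1_norm V u)"
      by (intro suminf_le b u sn sm)
    also have "\<dots> = (3 / 2) * H1_norm V u"
      by (subst suminf_mult2[symmetric]) (simp_all add: suminf_geometric summable_geometric)
    finally show "\<bar>L u\<bar> \<le> (3 / 2) * H1_norm V u" .
  qed
  then have "(\<lambda>k. L (w k)) \<longlonglongrightarrow> L u" using assms by (simp add: weakly_converges_H1_def)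
  then have "Bseq (\<lambda>k. L (w k))" by (intro convergent_imp_Bseq) (auto simp: convergent_def)
  then obtain K where K: "\<And>k. \<bar>L (w k)\<bar> \<le> K" by (auto simp: Bseq_def)
  have "(4 / 3) ^ j \<le> 2 * K" for j
    using \<epsilon>(2)[of j] K[of "\<kappa> j"] by (simp add: L_def x_def)
  moreover obtain j where "2 * K < (4 / 3 :: real) ^ j" using real_arch_pow[of "4 / 3" "2 * K"] by auto
  ultimately show False using not_le by blast
qed

text \<open>Collects what the later estimates use of weak convergence: two bounds and the pairings
  with L2 functions, all for the difference to the limit.\<close>

lemma weakly_convergent_difference:
  assumes "weakly_converges_H1 V w u"
  obtains C where "0 < C" "\<And>k. (\<lambda>x. w k x - u x) \<in> H1"
    "\<And>k. (\<integral>x. (w k x - u x)\<^sup>2 \<partial>lebesgue) \<le> C"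
    "\<And>k. (\<integral>x. (norm (weak_gradient (\<lambda>x. w k x - u x) x))\<^sup>2 \<partial>lebesgue) \<le> C"
    "\<And>f. f \<in> Lp 2 \<Longrightarrow> (\<lambda>k. \<integral>x. f x * (w k x - u x) \<partial>lebesgue) \<longlonglongrightarrow> 0"
proof -
  define z where "z k = (\<lambda>x. w k x - u x)" for k
  have z_alt: "z k = (\<lambda>x. w k x + (-1) * u x)" for k by (simp add: z_def)
  from assms have w: "w k \<in> H1" and u: "u \<in> H1" for k by (auto simp: weakly_converges_H1_def)
  have z: "z k \<in> H1" for k unfolding z_alt by (intro H1_add H1_scale w u)
  have z0: "weakly_converges_H1 V z (\<lambda>x. 0)"
    unfolding weakly_converges_H1_def
  proof (intro conjI allI ballI z)
    show zero: "(\<lambda>x::'a. 0) \<in> H1" using H1_scale(1)[OF u, of 0] by simp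
    fix L assume L: "L \<in> H1_dual V"
    have add: "\<And>v v'. v \<in> H1 \<Longrightarrow> v' \<in> H1 \<Longrightarrow> L (\<lambda>x. v x + v' x) = L v + L v'"
      and scale: "\<And>c v. v \<in> H1 \<Longrightarrow> L (\<lambda>x. c * v x) = c * L v"
      using L by (auto simp: H1_dual_def)
    have "L (z k) = L (w k) + (-1) * L u" for k
      unfolding z_alt add[OF w H1_scale(1)[OF u]] scale[OF u] ..
    moreover have "L (\<lambda>x. 0) = 0" using L u by (auto simp: H1_dual_def dest!: spec[of _ "0::real"])
    moreover have "(\<lambda>k. L (w k)) \<longlonglongrightarrow> L u" using assms L by (simp add: weakly_converges_H1_def)
    ultimately show "(\<lambda>k. L (z k)) \<longlonglongrightarrow> L (\<lambda>x. 0)"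
      using tendsto_diff[of "\<lambda>k. L (w k)" "L u" sequentially "\<lambda>k. L u" "L u"] by simp
  qed
  from weakly_convergent_bounded[OF this] obtain C where C: "\<And>k. H1_norm V (z k) \<le> C" by blast
  have C2: "(H1_norm V (z k))\<^sup>2 \<le> C\<^sup>2" for k
    using C inner_H1_self[OF z] by (intro power_mono) auto
  show thesis
  proof (rule that)
    \<comment> \<open>One constant for both bounds: the first summand serves the function, the
      second its gradient, and 1 makes it positive.\<close>
    show "0 < C\<^sup>2 / V0 + C\<^sup>2 + 1" using V0_pos by (simp add: add_nonneg_pos)
    show "(\<lambda>x. w k x - u x) \<in> H1" for k using z by (simp add: z_def)
    have "(\<integral>x. (z k x)\<^sup>2 \<partial>lebesgue) \<le> C\<^sup>2 / V0" for k
      using L2_norms_le_H1_norm(1)[OF z[of k]] C2[of k] V0_pos by (simp add: field_simps)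
    moreover have "C\<^sup>2 / V0 \<le> C\<^sup>2 / V0 + C\<^sup>2 + 1" by simp
    ultimately show "(\<integral>x. (w k x - u x)\<^sup>2 \<partial>lebesgue) \<le> C\<^sup>2 / V0 + C\<^sup>2 + 1" for k
      unfolding z_def by (rule order_trans)
    have "C\<^sup>2 \<le> C\<^sup>2 / V0 + C\<^sup>2 + 1" using V0_pos by simp
    then show "(\<integral>x. (norm (weak_gradient (\<lambda>x. w k x - u x) x))\<^sup>2 \<partial>lebesgue) \<le> C\<^sup>2 / V0 + C\<^sup>2 + 1" for k
      using order_trans[OF order_trans[OF L2_norms_le_H1_norm(2)[OF z[of k]] C2[of k]]]
      by (simp add: z_def)
    show "(\<lambda>k. \<integral>x. f x * (w k x - u x) \<partial>lebesgue) \<longlonglongrightarrow> 0" if "f \<in> Lp 2" for f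
      using z0 L2_functional_in_H1_dual[OF that] by (auto simp: weakly_converges_H1_def z_def)
  qed
qed

end

section \<open>L2 and supremum bounds for averages over cubes, and the change of a mollification
  between dyadic scales\<close>

section \<open>Cube averages and mollification\<close>

lemma sigma_finite_lebesgue: "sigma_finite_measure (lebesgue :: 'a::euclidean_space measure)"
proof
  obtain A :: "'a set set" where "countable A" "A \<subseteq> sets lborel" "\<Union> A = space lborel"
    "\<forall>a\<in>A. emeasure lborel a \<noteq> \<infinity>"
    using sigma_finite_measure.sigma_finite_countable[OF sigma_finite_lborel] by blast
  then show "\<exists>A::'a set set. countable A \<and> A \<subseteq> sets lebesgue \<and> \<Union> A = space lebesgue \<and>
      (\<forall>a\<in>A. emeasure lebesgue a \<noteq> \<infinity>)"
    by (intro exI[of _ A]) (auto simp: subset_iff)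
qed

interpretation lebesgue: sigma_finite_measure "lebesgue :: 'a::euclidean_space measure"
  by (rule sigma_finite_lebesgue)

interpretation lebesgue_pair: pair_sigma_finite "lebesgue :: 'a::euclidean_space measure" "lebesgue :: 'a measure"
  ..

lemma borel_measurable_lebesgue_pair_diff [measurable]:
  "(\<lambda>z::'a::euclidean_space \<times> 'a. fst z - snd z) \<in> borel_measurable (lebesgue \<Otimes>\<^sub>M lebesgue)"
proof -
  have "fst \<in> borel_measurable (lebesgue \<Otimes>\<^sub>M lebesgue :: ('a \<times> 'a) measure)"
    "snd \<in> borel_measurable (lebesgue \<Otimes>\<^sub>M lebesgue :: ('a \<times> 'a) measure)"
    using measurable_compose[OF measurable_fst borel_measurable_lebesgue_id]
      measurable_compose[OF measurable_snd borel_measurable_lebesgue_id] by auto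
  then show ?thesis by (rule borel_measurable_diff)
qed

text \<open>Cubes instead of balls, because the support of a product kernel is a cube.\<close>

definition cube :: "real \<Rightarrow> 'a::euclidean_space \<Rightarrow> 'a set" where
  "cube \<tau> x = cbox (x - \<tau> *\<^sub>R One) (x + \<tau> *\<^sub>R One)"

lemma mem_cube: "y \<in> cube \<tau> x \<longleftrightarrow> (\<forall>i\<in>Basis. \<bar>x \<bullet> i - y \<bullet> i\<bar> \<le> \<tau>)"
  unfolding cube_def mem_box
  by (intro ball_cong) (auto simp: inner_diff_left inner_add_left abs_le_iff inner_sum_left_Basis)

lemma mem_cube_commute: "y \<in> cube \<tau> x \<longleftrightarrow> x \<in> cube \<tau> y"
  by (auto simp: mem_cube abs_minus_commute)

lemma cube_measurable [measurable]: "cube \<tau> x \<in> sets lebesgue" "cube \<tau> x \<in> sets borel"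
  by (auto simp: cube_def)

lemma emeasure_cube:
  fixes x :: "'a::euclidean_space"
  assumes "0 \<le> \<tau>"
  shows "emeasure lborel (cube \<tau> x) = ennreal ((2 * \<tau>) ^ DIM('a))"
proof -
  have "emeasure lborel (cube \<tau> x) = ennreal (\<Prod>b\<in>Basis. ((x + \<tau> *\<^sub>R One) - (x - \<tau> *\<^sub>R One)) \<bullet> b)"
    unfolding cube_def
    by (rule emeasure_lborel_cbox) (use assms in \<open>auto simp: inner_diff_left inner_add_left inner_sum_left_Basis\<close>)
  also have "(\<Prod>b\<in>Basis. ((x + \<tau> *\<^sub>R One) - (x - \<tau> *\<^sub>R One)) \<bullet> b) = (\<Prod>b\<in>(Basis::'a set). 2 * \<tau>)"
    by (intro prod.cong) (auto simp: inner_diff_left inner_add_left inner_sum_left_Basis)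
  finally show ?thesis by simp
qed

lemma cube_pair_measurable [measurable]:
  "Measurable.pred (lebesgue \<Otimes>\<^sub>M lebesgue) (\<lambda>z::'a::euclidean_space \<times> 'a. snd z \<in> cube \<tau> (fst z))"
proof -
  have "closed (cube \<tau> (0::'a))" unfolding cube_def by (rule closed_cbox)
  then have "cube \<tau> (0::'a) \<in> sets borel" by (rule borel_closed)
  from measurable_sets[OF borel_measurable_lebesgue_pair_diff this]
  have "(\<lambda>z::'a \<times> 'a. fst z - snd z) -` cube \<tau> 0 \<inter> space (lebesgue \<Otimes>\<^sub>M lebesgue)
    \<in> sets (lebesgue \<Otimes>\<^sub>M lebesgue)" .
  moreover have "(\<lambda>z::'a \<times> 'a. fst z - snd z) -` cube \<tau> 0 \<inter> space (lebesgue \<Otimes>\<^sub>M lebesgue) =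
     {z \<in> space (lebesgue \<Otimes>\<^sub>M lebesgue). snd z \<in> cube \<tau> (fst z)}"
    by (auto simp: mem_cube inner_diff_left abs_minus_commute)
  ultimately show ?thesis by (simp add: pred_def)
qed

text \<open>Taken in \<open>ennreal\<close>, so that Cauchy-Schwarz and Fubini apply to every
  measurable function.\<close>

definition cube_integral :: "real \<Rightarrow> ('a::euclidean_space \<Rightarrow> 'b::euclidean_space) \<Rightarrow> 'a \<Rightarrow> ennreal" where
  "cube_integral \<tau> f x = (\<integral>\<^sup>+y. indicator (cube \<tau> x) y * ennreal (norm (f y)) \<partial>lebesgue)"

lemma indicator_cube_measurable [measurable]:
  "(\<lambda>z::'a::euclidean_space \<times> 'a. indicator (cube \<tau> (fst z)) (snd z) :: ennreal)
    \<in> borel_measurable (lebesgue \<Otimes>\<^sub>M lebesgue)"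
  using cube_pair_measurable[of \<tau>] by (intro borel_measurable_indicator') (simp add: pred_def)

lemma lebesgue_pair_measurable_comp:
  "f \<in> borel_measurable lebesgue \<Longrightarrow> (\<lambda>z::'a::euclidean_space \<times> 'a. f (snd z)) \<in> borel_measurable (lebesgue \<Otimes>\<^sub>M lebesgue)"
  "f \<in> borel_measurable lebesgue \<Longrightarrow> (\<lambda>z::'a::euclidean_space \<times> 'a. f (fst z)) \<in> borel_measurable (lebesgue \<Otimes>\<^sub>M lebesgue)"
  by (auto intro: measurable_compose[OF measurable_snd] measurable_compose[OF measurable_fst])

lemma cube_integral_measurable [measurable]:
  fixes f :: "'a::euclidean_space \<Rightarrow> 'b::euclidean_space"
  assumes [measurable]: "f \<in> borel_measurable lebesgue"
  shows "cube_integral \<tau> f \<in> borel_measurable lebesgue"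
proof -
  have "(\<lambda>z::'a \<times> 'a. ennreal (norm (f (snd z)))) \<in> borel_measurable (lebesgue \<Otimes>\<^sub>M lebesgue)"
    by (rule lebesgue_pair_measurable_comp(1)[where f = "\<lambda>y. ennreal (norm (f y))"]) measurable
  then have "(\<lambda>z. indicator (cube \<tau> (fst z)) (snd z) * ennreal (norm (f (snd z))))
     \<in> borel_measurable (lebesgue \<Otimes>\<^sub>M lebesgue)"
    by (rule borel_measurable_times_ennreal[OF indicator_cube_measurable])
  from lebesgue.borel_measurable_nn_integral_fst[OF this] show ?thesis
    by (simp add: cube_integral_def[abs_def])
qed

lemma cube_integral_square_le:
  fixes f :: "'a::euclidean_space \<Rightarrow> 'b::euclidean_space"
  assumes [measurable]: "f \<in> borel_measurable lebesgue" and "0 \<le> \<tau>"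
  shows "(cube_integral \<tau> f x)\<^sup>2 \<le> ennreal ((2 * \<tau>) ^ DIM('a)) *
    (\<integral>\<^sup>+y. indicator (cube \<tau> x) y * ennreal ((norm (f y))\<^sup>2) \<partial>lebesgue)"
proof -
  \<comment> \<open>The indicator is written twice: one copy is the second factor of Cauchy-Schwarz
    and yields the volume, the other keeps the square of f restricted to the cube.\<close>
  have "(\<integral>\<^sup>+y. indicator (cube \<tau> x) y * (indicator (cube \<tau> x) y * ennreal (norm (f y))) \<partial>lebesgue)\<^sup>2 \<le>
      (\<integral>\<^sup>+y. (indicator (cube \<tau> x) y)\<^sup>2 \<partial>lebesgue) *
      (\<integral>\<^sup>+y. (indicator (cube \<tau> x) y * ennreal (norm (f y)))\<^sup>2 \<partial>lebesgue)"
    by (rule Cauchy_Schwarz_nn_integral) auto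
  moreover have "(\<integral>\<^sup>+y. (indicator (cube \<tau> x) y)\<^sup>2 \<partial>lebesgue) = ennreal ((2 * \<tau>) ^ DIM('a))"
  proof -
    have "(\<integral>\<^sup>+y. (indicator (cube \<tau> x) y)\<^sup>2 \<partial>lebesgue) = (\<integral>\<^sup>+y. indicator (cube \<tau> x) y \<partial>lebesgue)"
      by (intro nn_integral_cong) (auto simp: indicator_def)
    then show ?thesis using assms(2) by (simp add: emeasure_cube)
  qed
  moreover have "(\<integral>\<^sup>+y. indicator (cube \<tau> x) y * (indicator (cube \<tau> x) y * ennreal (norm (f y))) \<partial>lebesgue) =
      cube_integral \<tau> f x"
    unfolding cube_integral_def by (intro nn_integral_cong) (auto simp: indicator_def)
  moreover have "(\<integral>\<^sup>+y. (indicator (cube \<tau> x) y * ennreal (norm (f y)))\<^sup>2 \<partial>lebesgue) =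
      (\<integral>\<^sup>+y. indicator (cube \<tau> x) y * ennreal ((norm (f y))\<^sup>2) \<partial>lebesgue)"
    by (intro nn_integral_cong) (auto simp: indicator_def ennreal_power)
  ultimately show ?thesis by simp
qed

lemma cube_integral_sup_bound:
  fixes f :: "'a::euclidean_space \<Rightarrow> 'b::euclidean_space"
  assumes [measurable]: "f \<in> borel_measurable lebesgue" and "0 \<le> \<tau>"
  shows "(cube_integral \<tau> f x)\<^sup>2 \<le> ennreal ((2 * \<tau>) ^ DIM('a)) * (\<integral>\<^sup>+y. ennreal ((norm (f y))\<^sup>2) \<partial>lebesgue)"
  by (rule order_trans[OF cube_integral_square_le[OF assms]])
     (intro mult_left_mono nn_integral_mono, auto simp: indicator_def)

text \<open>After Cauchy-Schwarz, Fubini integrates over the centres instead. Membership in a cube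
  is symmetric, so the centres whose cube contains y again form a cube, which gives the second
  factor of volume.\<close>

lemma cube_integral_L2_bound:
  fixes f :: "'a::euclidean_space \<Rightarrow> 'b::euclidean_space"
  assumes [measurable]: "f \<in> borel_measurable lebesgue" and "0 \<le> \<tau>"
  shows "(\<integral>\<^sup>+x. (cube_integral \<tau> f x)\<^sup>2 \<partial>lebesgue) \<le>
    (ennreal ((2 * \<tau>) ^ DIM('a)))\<^sup>2 * (\<integral>\<^sup>+y. ennreal ((norm (f y))\<^sup>2) \<partial>lebesgue)"
proof -
  define c where "c = ennreal ((2 * \<tau>) ^ DIM('a))"
  have m: "(\<lambda>z::'a \<times> 'a. ennreal ((norm (f (snd z)))\<^sup>2)) \<in> borel_measurable (lebesgue \<Otimes>\<^sub>M lebesgue)"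
    by (rule lebesgue_pair_measurable_comp(1)[where f = "\<lambda>y. ennreal ((norm (f y))\<^sup>2)"]) measurable
  have m2: "(\<lambda>z. indicator (cube \<tau> (fst z)) (snd z) * ennreal ((norm (f (snd z)))\<^sup>2))
     \<in> borel_measurable (lebesgue \<Otimes>\<^sub>M lebesgue)"
    by (rule borel_measurable_times_ennreal[OF indicator_cube_measurable m])
  have "(\<integral>\<^sup>+x. (cube_integral \<tau> f x)\<^sup>2 \<partial>lebesgue) \<le>
     (\<integral>\<^sup>+x. c * (\<integral>\<^sup>+y. indicator (cube \<tau> x) y * ennreal ((norm (f y))\<^sup>2) \<partial>lebesgue) \<partial>lebesgue)"
    unfolding c_def by (intro nn_integral_mono cube_integral_square_le assms)
  also have "\<dots> = c * (\<integral>\<^sup>+x. (\<integral>\<^sup>+y. indicator (cube \<tau> x) y * ennreal ((norm (f y))\<^sup>2) \<partial>lebesgue) \<partial>lebesgue)"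
    using lebesgue.borel_measurable_nn_integral_fst[OF m2] by (intro nn_integral_cmult) simp
  also have "(\<integral>\<^sup>+x. (\<integral>\<^sup>+y. indicator (cube \<tau> x) y * ennreal ((norm (f y))\<^sup>2) \<partial>lebesgue) \<partial>lebesgue) =
      (\<integral>\<^sup>+y. (\<integral>\<^sup>+x. indicator (cube \<tau> x) y * ennreal ((norm (f y))\<^sup>2) \<partial>lebesgue) \<partial>lebesgue)"
    using lebesgue_pair.Fubini[OF m2] by simp
  also have "\<dots> = (\<integral>\<^sup>+y. c * ennreal ((norm (f y))\<^sup>2) \<partial>lebesgue)"
  proof (intro nn_integral_cong)
    fix y
    have "(\<integral>\<^sup>+x. indicator (cube \<tau> x) y * ennreal ((norm (f y))\<^sup>2) \<partial>lebesgue) =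
       (\<integral>\<^sup>+x. indicator (cube \<tau> y) x * ennreal ((norm (f y))\<^sup>2) \<partial>lebesgue)"
      using mem_cube_commute[of y \<tau>] by (intro nn_integral_cong) (auto simp: indicator_def)
    also have "\<dots> = c * ennreal ((norm (f y))\<^sup>2)"
      using assms(2) by (subst nn_integral_multc) (auto simp: emeasure_cube c_def)
    finally show "(\<integral>\<^sup>+x. indicator (cube \<tau> x) y * ennreal ((norm (f y))\<^sup>2) \<partial>lebesgue) =
       c * ennreal ((norm (f y))\<^sup>2)" .
  qed
  also have "\<dots> = c * (\<integral>\<^sup>+y. ennreal ((norm (f y))\<^sup>2) \<partial>lebesgue)"
    by (intro nn_integral_cmult) measurable
  finally show ?thesis by (simp add: c_def power2_eq_square mult.assoc)
qed

lemma cube_integral_real: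
  fixes f :: "'a::euclidean_space \<Rightarrow> 'b::euclidean_space"
  assumes "locally_integrable f"
  shows "cube_integral \<tau> f x = ennreal (\<integral>y. indicator (cube \<tau> x) y * norm (f y) \<partial>lebesgue)"
proof -
  have "set_integrable lebesgue (cube \<tau> x) f"
    using assms by (simp add: locally_integrable_def cube_def)
  then have "integrable lebesgue (\<lambda>y. norm (indicator (cube \<tau> x) y *\<^sub>R f y))"
    unfolding set_integrable_def by (rule integrable_norm)
  then have "integrable lebesgue (\<lambda>y. indicator (cube \<tau> x) y * norm (f y))" by simp
  then have "(\<integral>\<^sup>+y. ennreal (indicator (cube \<tau> x) y * norm (f y)) \<partial>lebesgue) =
      ennreal (\<integral>y. indicator (cube \<tau> x) y * norm (f y) \<partial>lebesgue)"
    by (rule nn_integral_eq_integral) auto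
  then show ?thesis unfolding cube_integral_def
    by (simp add: ennreal_mult' ennreal_indicator)
qed

lemma integral_mult_le_cube_integral:
  fixes f :: "'a::euclidean_space \<Rightarrow> 'b::euclidean_space" and \<psi> :: "'a \<Rightarrow> real"
  assumes f: "locally_integrable f" and K0: "0 \<le> K" and K: "\<And>y. \<bar>\<psi> y\<bar> \<le> K * indicator (cube \<tau> x) y"
    and le: "\<And>y. \<bar>v y\<bar> \<le> norm (f y) * \<bar>\<psi> y\<bar>"
  shows "ennreal \<bar>\<integral>y. v y \<partial>lebesgue\<bar> \<le> ennreal K * cube_integral \<tau> f x"
proof (cases "integrable lebesgue v")
  case True
  have "set_integrable lebesgue (cube \<tau> x) f"
    using f by (simp add: locally_integrable_def cube_def)
  then have "integrable lebesgue (\<lambda>y. norm (indicator (cube \<tau> x) y *\<^sub>R f y))"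
    unfolding set_integrable_def by (rule integrable_norm)
  then have i: "integrable lebesgue (\<lambda>y. K * (indicator (cube \<tau> x) y * norm (f y)))" by simp
  have "\<bar>\<integral>y. v y \<partial>lebesgue\<bar> \<le> (\<integral>y. \<bar>v y\<bar> \<partial>lebesgue)" by (rule integral_abs_bound)
  also have "\<dots> \<le> (\<integral>y. K * (indicator (cube \<tau> x) y * norm (f y)) \<partial>lebesgue)"
  proof (rule integral_mono[OF integrable_abs[OF True] i])
    fix y
    have "\<bar>v y\<bar> \<le> norm (f y) * (K * indicator (cube \<tau> x) y)"
      by (rule order_trans[OF le mult_left_mono[OF K]]) simp
    then show "\<bar>v y\<bar> \<le> K * (indicator (cube \<tau> x) y * norm (f y))" by (simp add: mult_ac)
  qed
  finally have "ennreal \<bar>\<integral>y. v y \<partial>lebesgue\<bar> \<le> ennreal (K * (\<integral>y. indicator (cube \<tau> x) y * norm (f y) \<partial>lebesgue))"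
    by (intro ennreal_leI) simp
  then show ?thesis using K0 by (simp add: ennreal_mult' cube_integral_real[OF f])
\<comment> \<open>A function that is not integrable has Bochner integral 0, and the estimate is
  trivial.\<close>
qed (simp add: not_integrable_integral_eq)

text \<open>Normalisation is left to \<open>smoothing\<close>, so that each factor here is exactly
  the derivative of the step rescaled by \<tau>.\<close>

definition mollifier :: "real \<Rightarrow> 'a::euclidean_space \<Rightarrow> real" where
  "mollifier \<tau> = coord_prod (\<lambda>i s. bump (s / \<tau>) / \<tau>)"

definition mollify :: "real \<Rightarrow> ('a::euclidean_space \<Rightarrow> real) \<Rightarrow> 'a \<Rightarrow> real" where
  "mollify \<tau> w x = (\<integral>y. w y * mollifier \<tau> (x - y) \<partial>lebesgue)"

definition bump_bound :: real where "bump_bound = (SOME M. 0 < M \<and> (\<forall>s. bump s \<le> M))"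

lemma bump_bound: "0 < bump_bound" "bump s \<le> bump_bound"
  using someI_ex[of "\<lambda>M. 0 < M \<and> (\<forall>s. bump s \<le> M)"] bump_bounded by (auto simp: bump_bound_def)

lemma coord_prod_bound:
  assumes "x \<in> cbox a b \<Longrightarrow> \<forall>i\<in>Basis. \<bar>f i (x \<bullet> i)\<bar> \<le> K i"
    and "\<And>i s. i \<in> Basis \<Longrightarrow> s \<notin> {a \<bullet> i..b \<bullet> i} \<Longrightarrow> f i s = 0"
  shows "\<bar>coord_prod f x\<bar> \<le> (\<Prod>i\<in>Basis. K i) * indicator (cbox a b) x"
proof (cases "x \<in> cbox a b")
  case True
  have "\<bar>coord_prod f x\<bar> = (\<Prod>i\<in>Basis. \<bar>f i (x \<bullet> i)\<bar>)" by (simp add: coord_prod_def abs_prod)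
  also have "\<dots> \<le> (\<Prod>i\<in>Basis. K i)" using assms(1)[OF True] by (intro prod_mono) auto
  finally show ?thesis using True by simp
next
  case False
  with coord_prod_eq_0[OF False assms(2)] show ?thesis by simp
qed

lemma coord_prod_continuous:
  assumes "\<And>i. i \<in> Basis \<Longrightarrow> smooth_real (f i)"
  shows "continuous_on UNIV (coord_prod f)"
  by (meson assms coord_prod_has_derivative continuous_at_imp_continuous_on has_derivative_continuous)

lemma smooth_real_bump_scaled: "smooth_real (\<lambda>s. bump ((c - s) / \<tau>) / \<tau>)"
proof -
  have "smooth_real (\<lambda>s. bump ((- 1 / \<tau>) * s + c / \<tau>) * (1 / \<tau>))"
    by (rule smooth_real_mult[OF smooth_real_affine[OF smooth_real_bump] smooth_real_const])
  moreover have "(c - s) / \<tau> = (- 1 / \<tau>) * s + c / \<tau>" for s by (simp add: diff_divide_distrib)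
  ultimately show ?thesis by simp
qed

lemma bump_scaled_eq_0: "0 < \<tau> \<Longrightarrow> \<tau> \<le> \<bar>t\<bar> \<Longrightarrow> bump (t / \<tau>) / \<tau> = 0"
  by (simp add: bump_eq_0)

lemma bump_scaled_bound: "0 < \<tau> \<Longrightarrow> \<bar>bump (t / \<tau>) / \<tau>\<bar> \<le> bump_bound / \<tau>"
  by (simp add: bump_nonneg bump_bound divide_right_mono)

lemma mollifier_diff_eq:
  "mollifier \<tau> (x - y) = coord_prod (\<lambda>i s. bump ((x \<bullet> i - s) / \<tau>) / \<tau>) y"
  by (simp add: mollifier_def coord_prod_def inner_diff_left)

lemma mollifier_nonneg: "0 < \<tau> \<Longrightarrow> 0 \<le> mollifier \<tau> z"
  by (auto simp: mollifier_def coord_prod_def bump_nonneg intro!: prod_nonneg)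

lemma mollifier_continuous: "continuous_on UNIV (mollifier \<tau>)"
proof -
  have "smooth_real (\<lambda>s. bump (s / \<tau>) / \<tau>)"
  proof -
    have "smooth_real (\<lambda>s. bump ((1 / \<tau>) * s + 0) * (1 / \<tau>))"
      by (rule smooth_real_mult[OF smooth_real_affine[OF smooth_real_bump] smooth_real_const])
    then show ?thesis by simp
  qed
  then show ?thesis unfolding mollifier_def by (intro coord_prod_continuous)
qed

lemma mollifier_measurable [measurable]: "mollifier \<tau> \<in> borel_measurable borel"
  by (rule borel_measurable_continuous_onI[OF mollifier_continuous])

lemma mollifier_bound:
  fixes x y :: "'a::euclidean_space"
  assumes "0 < \<tau>"
  shows "\<bar>mollifier \<tau> (x - y)\<bar> \<le> (bump_bound / \<tau>) ^ DIM('a) * indicator (cube \<tau> x) y"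
proof -
  have "\<bar>coord_prod (\<lambda>i s. bump ((x \<bullet> i - s) / \<tau>) / \<tau>) y\<bar> \<le>
    (\<Prod>i\<in>(Basis::'a set). bump_bound / \<tau>) * indicator (cbox (x - \<tau> *\<^sub>R One) (x + \<tau> *\<^sub>R One)) y"
  proof (rule coord_prod_bound)
    show "\<forall>i\<in>Basis. \<bar>bump ((x \<bullet> i - y \<bullet> i) / \<tau>) / \<tau>\<bar> \<le> bump_bound / \<tau>"
      using bump_scaled_bound[OF assms] by blast
    fix i :: 'a and s assume "i \<in> Basis" "s \<notin> {(x - \<tau> *\<^sub>R One) \<bullet> i..(x + \<tau> *\<^sub>R One) \<bullet> i}"
    then have "\<tau> \<le> \<bar>x \<bullet> i - s\<bar>" by (auto simp: inner_diff_left inner_add_left inner_sum_left_Basis)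
    then show "bump ((x \<bullet> i - s) / \<tau>) / \<tau> = 0" by (rule bump_scaled_eq_0[OF assms])
  qed
  then show ?thesis by (simp add: mollifier_diff_eq cube_def)
qed

lemma mollifier_translate_continuous: "continuous_on UNIV (\<lambda>y. mollifier \<tau> (x - y))"
  by (intro continuous_on_compose2[OF mollifier_continuous] continuous_intros) auto

lemma integrable_mollify:
  assumes "locally_integrable w" "0 < \<tau>"
  shows "integrable lebesgue (\<lambda>y. w y * mollifier \<tau> (x - y))"
proof (rule integrable_locally_integrable_mult[OF assms(1) mollifier_translate_continuous])
  show "compact (cube \<tau> x)" unfolding cube_def by (rule compact_cbox)
  fix y assume "y \<notin> cube \<tau> x"
  then show "mollifier \<tau> (x - y) = 0" using mollifier_bound[OF assms(2), of x y] by simp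
qed

lemma mollify_bound:
  fixes w :: "'a::euclidean_space \<Rightarrow> real"
  assumes "locally_integrable w" "0 < \<tau>"
  shows "ennreal \<bar>mollify \<tau> w x\<bar> \<le> ennreal ((bump_bound / \<tau>) ^ DIM('a)) * cube_integral \<tau> w x"
  unfolding mollify_def
  by (rule integral_mult_le_cube_integral[OF assms(1) _ mollifier_bound[OF assms(2)]])
     (use assms bump_bound in \<open>auto simp: abs_mult\<close>)

lemma mollify_measurable [measurable]:
  fixes w :: "'a::euclidean_space \<Rightarrow> real"
  assumes w: "w \<in> borel_measurable lebesgue"
  shows "mollify \<tau> w \<in> borel_measurable lebesgue"
proof -
  have "(\<lambda>z::'a \<times> 'a. w (snd z)) \<in> borel_measurable (lebesgue \<Otimes>\<^sub>M lebesgue)"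
    by (rule lebesgue_pair_measurable_comp(1)[OF w])
  moreover have "(\<lambda>z::'a \<times> 'a. mollifier \<tau> (fst z - snd z)) \<in> borel_measurable (lebesgue \<Otimes>\<^sub>M lebesgue)"
    by (rule measurable_compose[OF borel_measurable_lebesgue_pair_diff mollifier_measurable])
  ultimately have "(\<lambda>z::'a \<times> 'a. w (snd z) * mollifier \<tau> (fst z - snd z)) \<in> borel_measurable (lebesgue \<Otimes>\<^sub>M lebesgue)"
    by (rule borel_measurable_times)
  then have "(\<lambda>(x, y). w y * mollifier \<tau> (x - y)) \<in> borel_measurable (lebesgue \<Otimes>\<^sub>M lebesgue)"
    by (simp add: case_prod_beta)
  from lebesgue.borel_measurable_lebesgue_integral[OF this]
  show ?thesis by (simp add: mollify_def[abs_def])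
qed

text \<open>The two mollifiers are compared one coordinate at a time: replacing the factor in the \<open>j\<close>-th
  coordinate changes the product by the \<open>j\<close>-th partial derivative of a test function.\<close>

lemma mollify_diff_partial:
  fixes w :: "'a::euclidean_space \<Rightarrow> real" and x :: 'a
  assumes wg: "has_weak_gradient w g" and \<tau>: "0 < \<tau>" and "S \<subseteq> Basis"
  defines "a i s \<equiv> bump ((x \<bullet> i - s) / \<tau>) / \<tau>"
    and "b i s \<equiv> bump ((x \<bullet> i - s) / (\<tau> / 2)) / (\<tau> / 2)"
  shows "ennreal \<bar>(\<integral>y. w y * coord_prod a y \<partial>lebesgue) -
      (\<integral>y. w y * coord_prod (\<lambda>i. if i \<in> S then b i else a i) y \<partial>lebesgue)\<bar> \<le>
    ennreal (real (card S) * (2 * bump_bound / \<tau>) ^ (DIM('a) - 1)) * cube_integral \<tau> g x"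
proof -
  from \<open>S \<subseteq> Basis\<close> have "finite S" by (rule finite_subset) simp
  then show ?thesis using \<open>S \<subseteq> Basis\<close>
  proof (induction S)
    case empty
    then show ?case by simp
  next
    case (insert j S)
    define K where "K = (2 * bump_bound / \<tau>) ^ (DIM('a) - 1)"
    have K0: "0 \<le> K" using bump_bound \<tau> by (simp add: K_def)
    define f where "f i = (if i \<in> S then b i else a i)" for i
    define f' where "f' i = (if i \<in> insert j S then b i else a i)" for i
    \<comment> \<open>A primitive of \<open>a j\<close> - \<open>b j\<close> on the line. It has
      compact support: at distance \<tau> from the centre both steps are 0 or both are 1, the finer
      one having settled earlier.\<close>
    define c where "c s = smooth_step ((x \<bullet> j - s) / (\<tau> / 2)) - smooth_step ((x \<bullet> j - s) / \<tau>)" for s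
    define P where "P = f(j := c)"
    have j: "j \<in> Basis" "j \<notin> S" using insert by auto
    have sa: "smooth_real (a i)" and sb: "smooth_real (b i)" for i
      unfolding a_def b_def by (rule smooth_real_bump_scaled)+
    have sc: "smooth_real c"
    proof -
      have "smooth_real (\<lambda>s. smooth_step ((- 2 / \<tau>) * s + 2 * (x \<bullet> j) / \<tau>) +
          (-1) * smooth_step ((- 1 / \<tau>) * s + (x \<bullet> j) / \<tau>))"
        by (rule smooth_real_add[OF smooth_real_affine[OF smooth_real_smooth_step]
            smooth_real_mult[OF smooth_real_const smooth_real_affine[OF smooth_real_smooth_step]]])
      moreover have "(x \<bullet> j - s) / (\<tau> / 2) = (- 2 / \<tau>) * s + 2 * (x \<bullet> j) / \<tau>"
        "(x \<bullet> j - s) / \<tau> = (- 1 / \<tau>) * s + (x \<bullet> j) / \<tau>" for s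
        using \<tau> by (auto simp: field_simps)
      ultimately show ?thesis by (simp add: c_def[abs_def])
    qed
    have dc: "deriv c s = a j s - b j s" for s
    proof (rule DERIV_imp_deriv)
      have 1: "((\<lambda>s. smooth_step ((x \<bullet> j - s) / (\<tau> / 2))) has_real_derivative
          bump ((x \<bullet> j - s) / (\<tau> / 2)) * (- 1 / (\<tau> / 2))) (at s)"
        by (rule DERIV_chain2[OF smooth_step_DERIV]) (use \<tau> in \<open>auto intro!: derivative_eq_intros\<close>)
      have 2: "((\<lambda>s. smooth_step ((x \<bullet> j - s) / \<tau>)) has_real_derivative
          bump ((x \<bullet> j - s) / \<tau>) * (- 1 / \<tau>)) (at s)"
        by (rule DERIV_chain2[OF smooth_step_DERIV]) (use \<tau> in \<open>auto intro!: derivative_eq_intros\<close>)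
      show "(c has_real_derivative a j s - b j s) (at s)"
        using DERIV_diff[OF 1 2] by (simp add: c_def[abs_def] a_def b_def)
    qed
    have sP: "smooth_real (P i)" for i using sa sb sc by (auto simp: P_def f_def)
    have sf: "smooth_real (f i)" "smooth_real (f' i)" for i using sa sb by (auto simp: f_def f'_def)
    have za: "a i s = 0" and zb: "b i s = 0" and zc: "c s = 0 \<or> i \<noteq> j"
      if "i \<in> Basis" "s \<notin> {(x - \<tau> *\<^sub>R One) \<bullet> i..(x + \<tau> *\<^sub>R One) \<bullet> i}" for i s
    proof -
      have *: "\<tau> \<le> \<bar>x \<bullet> i - s\<bar>"
        using that by (auto simp: inner_diff_left inner_add_left inner_sum_left_Basis)
      show "a i s = 0" unfolding a_def by (rule bump_scaled_eq_0[OF \<tau> *])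
      show "b i s = 0" unfolding b_def by (rule bump_scaled_eq_0) (use \<tau> * in auto)
      show "c s = 0 \<or> i \<noteq> j"
      proof (cases "i = j")
        case True
        with * have "1 \<le> (x \<bullet> j - s) / \<tau> \<and> 1 \<le> (x \<bullet> j - s) / (\<tau> / 2) \<or>
            (x \<bullet> j - s) / \<tau> \<le> -1 \<and> (x \<bullet> j - s) / (\<tau> / 2) \<le> -1"
          using \<tau> by (auto simp: field_simps abs_real_def split: if_splits)
        then show ?thesis by (auto simp: c_def smooth_step_eq_0 smooth_step_eq_1)
      qed simp
    qed
    have zP: "P i s = 0" and zf: "f i s = 0" "f' i s = 0"
      if "i \<in> Basis" "s \<notin> {(x - \<tau> *\<^sub>R One) \<bullet> i..(x + \<tau> *\<^sub>R One) \<bullet> i}" for i s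
      using za[OF that] zb[OF that] zc[OF that] by (auto simp: P_def f_def f'_def)
    have tP: "coord_prod P \<in> test_functions"
      by (rule test_function_coord_prod[OF sP zP])
    have Pd: "partial_deriv j (coord_prod P) y = coord_prod f y - coord_prod f' y" for y
    proof -
      have "partial_deriv j (coord_prod P) y = coord_prod (P(j := deriv (P j))) y"
        by (simp only: partial_deriv_coord_prod[OF sP j(1)])
      also have "\<dots> = (a j (y \<bullet> j) - b j (y \<bullet> j)) * (\<Prod>i\<in>Basis - {j}. f i (y \<bullet> i))"
        unfolding coord_prod_def
        by (subst prod.remove[OF finite_Basis j(1)]) (simp add: P_def dc cong: prod.cong_simp)
      also have "\<dots> = a j (y \<bullet> j) * (\<Prod>i\<in>Basis - {j}. f i (y \<bullet> i)) - b j (y \<bullet> j) * (\<Prod>i\<in>Basis - {j}. f' i (y \<bullet> i))"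
        by (simp add: left_diff_distrib f_def f'_def cong: prod.cong_simp)
      also have "\<dots> = coord_prod f y - coord_prod f' y"
        unfolding coord_prod_def using j
        by (simp add: prod.remove[OF finite_Basis j(1)] f_def f'_def)
      finally show ?thesis .
    qed
    have loc: "locally_integrable w" "locally_integrable g" using wg by (auto simp: has_weak_gradient_def)
    have int: "integrable lebesgue (\<lambda>y. w y * coord_prod f y)" "integrable lebesgue (\<lambda>y. w y * coord_prod f' y)"
      by (rule integrable_locally_integrable_mult[OF loc(1) coord_prod_continuous compact_cbox coord_prod_eq_0, OF sf(1) _ zf(1)]
          integrable_locally_integrable_mult[OF loc(1) coord_prod_continuous compact_cbox coord_prod_eq_0, OF sf(2) _ zf(2)]; assumption)+
    have eq: "(\<integral>y. w y * coord_prod f y \<partial>lebesgue) - (\<integral>y. w y * coord_prod f' y \<partial>lebesgue) =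
        - (\<integral>y. (g y \<bullet> j) * coord_prod P y \<partial>lebesgue)"
    proof -
      have "(\<integral>y. w y * coord_prod f y \<partial>lebesgue) - (\<integral>y. w y * coord_prod f' y \<partial>lebesgue) =
         (\<integral>y. w y * partial_deriv j (coord_prod P) y \<partial>lebesgue)"
        unfolding Pd right_diff_distrib by (rule Bochner_Integration.integral_diff[OF int, symmetric])
      also have "\<dots> = - (\<integral>y. (g y \<bullet> j) * coord_prod P y \<partial>lebesgue)"
        using wg tP j by (simp add: has_weak_gradient_def)
      finally show ?thesis .
    qed
    have bP: "\<bar>coord_prod P y\<bar> \<le> K * indicator (cube \<tau> x) y" for y
    proof -
      \<comment> \<open>The factor in direction j is a difference of steps and bounded by 1, while
        every other factor costs 2 * \<open>bump_bound\<close> / \<tau>, the bound at scale \<tau> /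
        2. The missing power is the gain from the gradient.\<close>
      have "\<bar>coord_prod P y\<bar> \<le> (\<Prod>i\<in>Basis. if i = j then 1 else 2 * bump_bound / \<tau>) *
          indicator (cbox (x - \<tau> *\<^sub>R One) (x + \<tau> *\<^sub>R One)) y"
      proof (rule coord_prod_bound[OF _ zP])
        have "\<bar>c s\<bar> \<le> 1" for s
          using smooth_step_bounds[of "(x \<bullet> j - s) / (\<tau> / 2)"] smooth_step_bounds[of "(x \<bullet> j - s) / \<tau>"]
          by (simp add: c_def)
        moreover have "\<bar>a i s\<bar> \<le> 2 * bump_bound / \<tau>" for i s
          using bump_scaled_bound[OF \<tau>, of "x \<bullet> i - s"] bump_bound(1) \<tau>
          by (auto simp: a_def field_simps)
        moreover have "\<bar>b i s\<bar> \<le> 2 * bump_bound / \<tau>" for i s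
          using bump_scaled_bound[of "\<tau> / 2" "x \<bullet> i - s"] \<tau> by (simp add: b_def mult.commute)
        ultimately show "\<forall>i\<in>Basis. \<bar>P i (y \<bullet> i)\<bar> \<le> (if i = j then 1 else 2 * bump_bound / \<tau>)"
          by (auto simp: P_def f_def)
      qed
      also have "(\<Prod>i\<in>Basis. if i = j then 1 else 2 * bump_bound / \<tau>) = K"
        by (subst prod.remove[OF finite_Basis j(1)]) (simp add: K_def j(1) cong: prod.cong_simp)
      finally show ?thesis by (simp add: cube_def)
    qed
    have "ennreal \<bar>\<integral>y. (g y \<bullet> j) * coord_prod P y \<partial>lebesgue\<bar> \<le> ennreal K * cube_integral \<tau> g x"
      by (rule integral_mult_le_cube_integral[OF loc(2) K0 bP])
         (auto simp: abs_mult intro!: mult_right_mono Basis_le_norm j)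
    then have step: "ennreal \<bar>(\<integral>y. w y * coord_prod f y \<partial>lebesgue) - (\<integral>y. w y * coord_prod f' y \<partial>lebesgue)\<bar>
       \<le> ennreal K * cube_integral \<tau> g x" unfolding eq by simp
    have IH: "ennreal \<bar>(\<integral>y. w y * coord_prod a y \<partial>lebesgue) - (\<integral>y. w y * coord_prod f y \<partial>lebesgue)\<bar>
       \<le> ennreal (real (card S) * K) * cube_integral \<tau> g x"
      using insert unfolding f_def[abs_def] K_def by simp
    have "ennreal \<bar>(\<integral>y. w y * coord_prod a y \<partial>lebesgue) - (\<integral>y. w y * coord_prod f' y \<partial>lebesgue)\<bar> \<le>
      ennreal (\<bar>(\<integral>y. w y * coord_prod a y \<partial>lebesgue) - (\<integral>y. w y * coord_prod f y \<partial>lebesgue)\<bar> +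
       \<bar>(\<integral>y. w y * coord_prod f y \<partial>lebesgue) - (\<integral>y. w y * coord_prod f' y \<partial>lebesgue)\<bar>)"
      by (intro ennreal_leI) linarith
    also have "\<dots> \<le> ennreal (real (card S) * K) * cube_integral \<tau> g x + ennreal K * cube_integral \<tau> g x"
      using add_mono[OF IH step] by simp
    also have "\<dots> = ennreal (real (card (insert j S)) * K) * cube_integral \<tau> g x"
      using insert j K0 by (simp add: distrib_right[symmetric] ennreal_plus[symmetric] del: ennreal_plus)
        (simp add: algebra_simps)
    finally show ?case unfolding f'_def[abs_def] K_def .
  qed
qed

lemma mollify_diff_bound:
  fixes w :: "'a::euclidean_space \<Rightarrow> real"
  assumes "has_weak_gradient w g" and "0 < \<tau>"
  shows "ennreal \<bar>mollify \<tau> w x - mollify (\<tau> / 2) w x\<bar> \<le>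
    ennreal (real (DIM('a)) * (2 * bump_bound / \<tau>) ^ (DIM('a) - 1)) * cube_integral \<tau> g x"
proof -
  have "coord_prod (\<lambda>i. if i \<in> (Basis::'a set) then f i else h i) = coord_prod f" for f h
    by (auto simp: coord_prod_def fun_eq_iff)
  with mollify_diff_partial[OF assms subset_refl, of x] show ?thesis
    unfolding mollify_def mollifier_diff_eq by simp
qed

definition mollifier_mass :: "'a::euclidean_space itself \<Rightarrow> real" where
  "mollifier_mass _ = (\<integral>z. mollifier 1 (z::'a) \<partial>lebesgue)"

lemma locally_integrable_const: "locally_integrable (\<lambda>x::'a::euclidean_space. c::real)"
  unfolding locally_integrable_def set_integrable_def
proof (intro allI impI)
  fix A :: "'a set" assume A: "compact A"
  then have "A \<in> lmeasurable" by (rule lmeasurable_compact)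
  then show "integrable lebesgue (\<lambda>x. indicat_real A x *\<^sub>R c)"
    by (auto simp: fmeasurable_def intro!: integrable_scaleR_left integrable_real_indicator)
qed

lemma mollifier_outside_cube: "0 < \<tau> \<Longrightarrow> y \<notin> cube \<tau> x \<Longrightarrow> mollifier \<tau> (x - y) = 0"
  using mollifier_bound[of \<tau> x y] by simp

lemma mollifier_integrable:
  fixes \<tau> :: real
  assumes "0 < \<tau>" shows "integrable lebesgue (mollifier \<tau> :: 'a::euclidean_space \<Rightarrow> real)"
proof -
  have "mollifier \<tau> z = 0" if "z \<notin> cube \<tau> 0" for z :: 'a
    using mollifier_outside_cube[OF assms, of 0 z] that mem_cube_commute[of 0 \<tau> z] by simp
  then have "integrable lebesgue (\<lambda>z::'a. 1 * mollifier \<tau> z)"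
    by (intro integrable_locally_integrable_mult[OF locally_integrable_const mollifier_continuous, of "cube \<tau> 0"])
       (auto simp: cube_def compact_cbox)
  then show ?thesis by simp
qed

text \<open>The continuous nonnegative kernel is positive at the point with all coordinates equal to
  some s where the bump is positive, hence on a nonempty open set, which is not a null set.\<close>

lemma mollifier_mass_pos: "0 < mollifier_mass TYPE('a::euclidean_space)"
proof -
  obtain s where s: "0 < bump s" using bump_pos_somewhere by blast
  define z where "z = (\<Sum>i\<in>Basis. s *\<^sub>R i :: 'a)"
  have zi: "z \<bullet> i = s" if "i \<in> Basis" for i using that by (simp add: z_def)
  have pos: "0 < mollifier 1 z"
    unfolding mollifier_def coord_prod_def by (intro prod_pos) (simp add: zi s)
  have "open {x. 0 < mollifier 1 (x::'a)}"
    by (intro open_Collect_less continuous_on_const mollifier_continuous)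
  then have "\<not> negligible {x. 0 < mollifier 1 (x::'a)}" using pos open_not_negligible by blast
  moreover have "negligible {x. 0 < mollifier 1 (x::'a)}" if "mollifier_mass TYPE('a) = 0"
  proof -
    have "AE x in lebesgue. mollifier 1 (x::'a) = 0"
      using that mollifier_integrable[of 1, where 'a = 'a]
      by (simp add: mollifier_mass_def integral_nonneg_eq_0_iff_AE mollifier_nonneg)
    then have "AE x in lebesgue. (x::'a) \<notin> {x. 0 < mollifier 1 x}" by eventually_elim simp
    moreover have "{x. 0 < mollifier 1 (x::'a)} \<in> sets lebesgue"
      using \<open>open _\<close> by simp
    ultimately show ?thesis unfolding negligible_iff_null_sets by (rule AE_iff_null_sets[THEN iffD2, rotated])
  qed
  moreover have "0 \<le> mollifier_mass TYPE('a)"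
    unfolding mollifier_mass_def by (intro integral_nonneg_AE AE_I2) (simp add: mollifier_nonneg)
  ultimately show ?thesis by fastforce
qed

text \<open>Substituting v = (x - y) / \<tau> gives the same mass at every scale, so a single
  constant normalises all of \<open>smoothing\<close>.\<close>

lemma integral_mollifier:
  fixes y :: "'a::euclidean_space"
  assumes \<tau>: "0 < \<tau>"
  shows "(\<integral>x. mollifier \<tau> (x - y) \<partial>lebesgue) = mollifier_mass TYPE('a)"
proof -
  have meas: "(\<lambda>x::'a. mollifier \<tau> (x - y)) \<in> borel_measurable borel"
    by (rule measurable_compose[OF _ mollifier_measurable]) simp
  have "(\<integral>x. mollifier \<tau> (x - y) \<partial>lebesgue) = (\<integral>x. mollifier \<tau> (x - y) \<partial>lborel)"
    by (rule integral_completion) (simp add: meas)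
  also have "\<dots> = (\<integral>x. mollifier \<tau> (x - y) \<partial>density (distr lborel borel (\<lambda>v. y + \<tau> *\<^sub>R v)) (\<lambda>_. ennreal (\<bar>\<tau>\<bar> ^ DIM('a))))"
    using lborel_affine[of \<tau> y] \<tau> by simp
  also have "\<dots> = (\<integral>x. \<tau> ^ DIM('a) * mollifier \<tau> (x - y) \<partial>distr lborel borel (\<lambda>v. y + \<tau> *\<^sub>R v))"
    using \<tau> meas by (subst integral_density) auto
  also have "\<dots> = (\<integral>v. \<tau> ^ DIM('a) * mollifier \<tau> (y + \<tau> *\<^sub>R v - y) \<partial>lborel)"
    using meas by (subst integral_distr) auto
  also have "\<dots> = (\<integral>v. mollifier 1 (v::'a) \<partial>lborel)"
  proof (intro Bochner_Integration.integral_cong refl)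
    fix v :: 'a
    have "mollifier \<tau> (\<tau> *\<^sub>R v) = (\<Prod>i\<in>(Basis::'a set). bump (v \<bullet> i) / \<tau>)"
      using \<tau> by (simp add: mollifier_def coord_prod_def)
    also have "\<dots> = mollifier 1 v / \<tau> ^ DIM('a)" by (simp add: mollifier_def coord_prod_def prod_dividef)
    finally show "\<tau> ^ DIM('a) * mollifier \<tau> (y + \<tau> *\<^sub>R v - y) = mollifier 1 v" using \<tau> by simp
  qed
  also have "\<dots> = mollifier_mass TYPE('a)"
    unfolding mollifier_mass_def by (subst integral_completion) (simp_all add: mollifier_measurable)
  finally show ?thesis .
qed

definition smoothing :: "nat \<Rightarrow> ('a::euclidean_space \<Rightarrow> real) \<Rightarrow> 'a \<Rightarrow> real" where
  "smoothing n w x = mollify ((1 / 2) ^ n) w x / mollifier_mass TYPE('a)"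

lemma smoothing_measurable [measurable]:
  "w \<in> borel_measurable lebesgue \<Longrightarrow> smoothing n w \<in> borel_measurable lebesgue"
  unfolding smoothing_def[abs_def] by (intro borel_measurable_divide mollify_measurable borel_measurable_const)

lemma smoothing_eq_integral:
  "smoothing n w x = (\<integral>y. mollifier ((1 / 2) ^ n) (x - y) / mollifier_mass TYPE('a) * w y \<partial>lebesgue)"
  for w :: "'a::euclidean_space \<Rightarrow> real"
  by (simp add: smoothing_def mollify_def mult.commute)

text \<open>Together with \<open>smoothing_eq_integral\<close> this makes the value of a smoothing
  at a fixed point an L2 pairing, which is how weak convergence becomes pointwise
  convergence.\<close>

lemma smoothing_kernel_Lp_2:
  "(\<lambda>y. mollifier ((1 / 2) ^ n) (x - y) / mollifier_mass TYPE('a)) \<in> Lp 2"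
  for x :: "'a::euclidean_space"
proof -
  define k where "k y = mollifier ((1 / 2) ^ n) (x - y) / mollifier_mass TYPE('a)" for y
  have c: "continuous_on UNIV k"
    unfolding k_def divide_inverse by (intro continuous_intros mollifier_translate_continuous)
  have "integrable lebesgue (\<lambda>y. 1 * (k y)\<^sup>2)"
    by (intro integrable_locally_integrable_mult[OF locally_integrable_const, of _ "cube ((1 / 2) ^ n) x"]
        continuous_intros c)
       (auto simp: cube_def[symmetric] k_def mollifier_outside_cube, auto simp: cube_def compact_cbox)
  moreover have "k \<in> borel_measurable lebesgue"
    by (rule borel_measurable_lebesgueI[OF borel_measurable_continuous_onI[OF c]])
  ultimately have "k \<in> Lp 2" by (simp add: mem_Lp_2)
  then show ?thesis by (simp add: k_def[abs_def])
qed

text \<open>Interpolation: |d|^s is |d|^(s - 2) times d^2, with the supremum bound for the first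
  factor and the L2 bound for the second. It is applied with f the gradient for the change between
  scales, and with f the function itself for one smoothing.\<close>

lemma cube_average_powr_bound:
  fixes f :: "'a::euclidean_space \<Rightarrow> 'b::euclidean_space"
  assumes [measurable]: "f \<in> borel_measurable lebesgue" and \<tau>: "0 \<le> \<tau>" and s: "2 \<le> s"
    and E: "(\<integral>\<^sup>+y. ennreal ((norm (f y))\<^sup>2) \<partial>lebesgue) \<le> ennreal E" "0 \<le> E"
    and K: "0 \<le> K" and d: "\<And>x. ennreal \<bar>d x\<bar> \<le> ennreal K * cube_integral \<tau> f x"
    and [measurable]: "d \<in> borel_measurable lebesgue"
  shows "\<And>x. (d x)\<^sup>2 \<le> K\<^sup>2 * (2 * \<tau>) ^ DIM('a) * E"
    and "(\<integral>\<^sup>+x. ennreal ((d x)\<^sup>2) \<partial>lebesgue) \<le> ennreal ((K * (2 * \<tau>) ^ DIM('a))\<^sup>2 * E)"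
    and "(\<integral>\<^sup>+x. ennreal (\<bar>d x\<bar> powr s) \<partial>lebesgue) \<le>
      ennreal ((K\<^sup>2 * (2 * \<tau>) ^ DIM('a) * E) powr ((s - 2) / 2) * ((K * (2 * \<tau>) ^ DIM('a))\<^sup>2 * E))"
proof -
  define Q where "Q = (2 * \<tau>) ^ DIM('a)"
  have Q0: "0 \<le> Q" using \<tau> by (simp add: Q_def)
  have sq: "ennreal ((d x)\<^sup>2) \<le> ennreal (K\<^sup>2) * (cube_integral \<tau> f x)\<^sup>2" for x
  proof -
    have "ennreal ((d x)\<^sup>2) = (ennreal \<bar>d x\<bar>)\<^sup>2" by (simp add: ennreal_power)
    also have "\<dots> \<le> (ennreal K * cube_integral \<tau> f x)\<^sup>2" by (intro power_mono d) simp
    also have "\<dots> = ennreal (K\<^sup>2) * (cube_integral \<tau> f x)\<^sup>2" using K by (simp add: power_mult_distrib ennreal_power)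
    finally show ?thesis .
  qed
  show sup: "(d x)\<^sup>2 \<le> K\<^sup>2 * (2 * \<tau>) ^ DIM('a) * E" for x
  proof -
    have "ennreal ((d x)\<^sup>2) \<le> ennreal (K\<^sup>2) * (ennreal Q * ennreal E)"
      by (rule order_trans[OF sq]) (intro mult_left_mono order_trans[OF cube_integral_sup_bound[OF _ \<tau>]],
        auto simp: Q_def intro!: mult_left_mono E)
    also have "\<dots> = ennreal (K\<^sup>2 * Q * E)" using Q0 E K by (simp add: ennreal_mult' mult.assoc)
    finally show ?thesis using Q0 E K by (simp add: Q_def ennreal_le_iff)
  qed
  show L2: "(\<integral>\<^sup>+x. ennreal ((d x)\<^sup>2) \<partial>lebesgue) \<le> ennreal ((K * (2 * \<tau>) ^ DIM('a))\<^sup>2 * E)"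
  proof -
    have "(\<integral>\<^sup>+x. ennreal ((d x)\<^sup>2) \<partial>lebesgue) \<le> (\<integral>\<^sup>+x. ennreal (K\<^sup>2) * (cube_integral \<tau> f x)\<^sup>2 \<partial>lebesgue)"
      by (intro nn_integral_mono sq)
    also have "\<dots> = ennreal (K\<^sup>2) * (\<integral>\<^sup>+x. (cube_integral \<tau> f x)\<^sup>2 \<partial>lebesgue)"
      using cube_integral_measurable[of f \<tau>] by (intro nn_integral_cmult) auto
    also have "\<dots> \<le> ennreal (K\<^sup>2) * ((ennreal Q)\<^sup>2 * ennreal E)"
      by (intro mult_left_mono order_trans[OF cube_integral_L2_bound[OF _ \<tau>]])
         (auto simp: Q_def intro!: mult_left_mono E)
    also have "\<dots> = ennreal ((K * Q)\<^sup>2 * E)"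
      using Q0 E K by (simp add: ennreal_mult' ennreal_power power_mult_distrib mult.assoc)
    finally show ?thesis by (simp add: Q_def)
  qed
  define B where "B = K\<^sup>2 * Q * E"
  have "ennreal (\<bar>d x\<bar> powr s) \<le> ennreal (B powr ((s - 2) / 2)) * ennreal ((d x)\<^sup>2)" for x
  proof -
    have "\<bar>d x\<bar> powr s = \<bar>d x\<bar> powr (s - 2) * (d x)\<^sup>2"
    proof (cases "d x = 0")
      case False
      have "\<bar>d x\<bar> powr s = \<bar>d x\<bar> powr ((s - 2) + 2)" by simp
      also have "\<dots> = \<bar>d x\<bar> powr (s - 2) * \<bar>d x\<bar> powr 2" by (rule powr_add)
      finally show ?thesis using False by (simp add: powr_numeral)
    qed simp
    also have "\<bar>d x\<bar> powr (s - 2) = ((d x)\<^sup>2) powr ((s - 2) / 2)"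
    proof (cases "d x = 0")
      case False
      have "((d x)\<^sup>2) powr ((s - 2) / 2) = (\<bar>d x\<bar> powr 2) powr ((s - 2) / 2)"
        using False by (simp add: powr_numeral)
      also have "\<dots> = \<bar>d x\<bar> powr (s - 2)"
        unfolding powr_powr nonzero_mult_div_cancel_left[OF zero_neq_numeral[symmetric]] times_divide_eq_right ..
      finally show ?thesis ..
    qed simp
    also have "\<dots> * (d x)\<^sup>2 \<le> B powr ((s - 2) / 2) * (d x)\<^sup>2"
      using sup[of x] s by (intro mult_right_mono powr_mono2) (auto simp: B_def Q_def)
    finally show ?thesis by (simp add: ennreal_mult'[symmetric] ennreal_leI)
  qed
  then have "(\<integral>\<^sup>+x. ennreal (\<bar>d x\<bar> powr s) \<partial>lebesgue) \<le>
      (\<integral>\<^sup>+x. ennreal (B powr ((s - 2) / 2)) * ennreal ((d x)\<^sup>2) \<partial>lebesgue)"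
    by (intro nn_integral_mono)
  also have "\<dots> = ennreal (B powr ((s - 2) / 2)) * (\<integral>\<^sup>+x. ennreal ((d x)\<^sup>2) \<partial>lebesgue)"
    by (intro nn_integral_cmult) auto
  also have "\<dots> \<le> ennreal (B powr ((s - 2) / 2)) * ennreal ((K * Q)\<^sup>2 * E)"
    using L2 by (intro mult_left_mono) (simp_all add: Q_def)
  also have "\<dots> = ennreal (B powr ((s - 2) / 2) * ((K * Q)\<^sup>2 * E))"
    by (simp add: ennreal_mult'[symmetric])
  finally show "(\<integral>\<^sup>+x. ennreal (\<bar>d x\<bar> powr s) \<partial>lebesgue) \<le>
      ennreal ((K\<^sup>2 * (2 * \<tau>) ^ DIM('a) * E) powr ((s - 2) / 2) * ((K * (2 * \<tau>) ^ DIM('a))\<^sup>2 * E))"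
    by (simp add: B_def Q_def)
qed

text \<open>A single term of the weighted sum is at most \<open>t\<close>, so the j-th increment is
  at most \<rho>^j times t^(1/s), and the increments form a geometric series. The weighted sum of
  s-th powers is the quantity that can be integrated term by term over x.\<close>

lemma telescoping_powr:
  fixes a :: "nat \<Rightarrow> real"
  assumes s: "0 < s" and \<rho>: "0 < \<rho>" "\<rho> < 1" and t: "0 \<le> t"
    and T: "(\<Sum>j. ennreal ((\<bar>a j - a (Suc j)\<bar> / \<rho> ^ j) powr s)) \<le> ennreal t"
  shows "\<bar>a n - a 0\<bar> \<le> t powr (1 / s) / (1 - \<rho>)" and "convergent a"
proof -
  define c where "c = t powr (1 / s)"
  have c0: "0 \<le> c" by (simp add: c_def)
  have d: "\<bar>a j - a (Suc j)\<bar> \<le> \<rho> ^ j * c" for j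
  proof -
    define D where "D j = ennreal ((\<bar>a j - a (Suc j)\<bar> / \<rho> ^ j) powr s)" for j
    have "D j \<le> (\<Sum>j. D j)" using sum_le_suminf[of D "{j}"] by simp
    also have "\<dots> \<le> ennreal t" using T by (simp only: D_def)
    finally have "ennreal ((\<bar>a j - a (Suc j)\<bar> / \<rho> ^ j) powr s) \<le> ennreal t" by (simp only: D_def)
    then have "(\<bar>a j - a (Suc j)\<bar> / \<rho> ^ j) powr s \<le> t" using t by (simp add: ennreal_le_iff)
    then have "((\<bar>a j - a (Suc j)\<bar> / \<rho> ^ j) powr s) powr (1 / s) \<le> c"
      unfolding c_def using s by (intro powr_mono2) auto
    then have "\<bar>a j - a (Suc j)\<bar> / \<rho> ^ j \<le> c" using s \<rho> by (simp add: powr_powr)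
    then show ?thesis using \<rho> by (simp add: field_simps)
  qed
  have sm: "summable (\<lambda>j. \<rho> ^ j * c)" using \<rho> by (intro summable_mult2 summable_geometric) auto
  have tel: "a n - a 0 = (\<Sum>j<n. a (Suc j) - a j)" for n by (simp add: sum_lessThan_telescope)
  have d': "\<bar>a (Suc j) - a j\<bar> \<le> \<rho> ^ j * c" for j using d[of j] by (simp add: abs_minus_commute)
  have "\<bar>a n - a 0\<bar> \<le> (\<Sum>j<n. \<bar>a (Suc j) - a j\<bar>)" unfolding tel by (rule sum_abs)
  also have "\<dots> \<le> (\<Sum>j<n. \<rho> ^ j * c)" by (intro sum_mono d')
  also have "\<dots> \<le> (\<Sum>j. \<rho> ^ j * c)" by (intro sum_le_suminf sm) (use \<rho> c0 in auto)
  also have "\<dots> = c / (1 - \<rho>)" using \<rho>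
    by (subst suminf_mult2[symmetric]) (simp_all add: suminf_geometric summable_geometric)
  finally show "\<bar>a n - a 0\<bar> \<le> t powr (1 / s) / (1 - \<rho>)" by (simp add: c_def)
  have "summable (\<lambda>j. a (Suc j) - a j)"
    by (rule summable_comparison_test'[OF sm, of 0]) (use d' in auto)
  then have "(\<lambda>n. a n - a 0) \<longlonglongrightarrow> (\<Sum>j. a (Suc j) - a j)" unfolding tel by (rule summable_LIMSEQ)
  then have "(\<lambda>n. (a n - a 0) + a 0) \<longlonglongrightarrow> (\<Sum>j. a (Suc j) - a j) + a 0"
    by (intro tendsto_add tendsto_const)
  then show "convergent a" by (auto simp: convergent_def)
qed

text \<open>With K of order \<tau>^(1 - N), the squared supremum K^2 \<tau>^N has order \<tau>^(2 -
  N) and enters with the power (s - 2) / 2, while the squared L2 norm (K \<tau>^N)^2 has order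
  \<tau>^2. The constant is the same for all scales.\<close>

lemma smoothing_step_bound:
  fixes E s :: real
  assumes s: "2 \<le> s" and E: "0 \<le> E"
  obtains C where "0 \<le> C"
    "\<And>(w::'a::euclidean_space \<Rightarrow> real) j. w \<in> H1 \<Longrightarrow>
       (\<integral>\<^sup>+y. ennreal ((norm (weak_gradient w y))\<^sup>2) \<partial>lebesgue) \<le> ennreal E \<Longrightarrow>
       (\<integral>\<^sup>+x. ennreal (\<bar>smoothing j w x - smoothing (Suc j) w x\<bar> powr s) \<partial>lebesgue) \<le>
         ennreal (C * ((1 / 2) ^ j) powr (2 - (real DIM('a) - 2) * (s - 2) / 2))"
proof -
  define N where "N = DIM('a)"
  define m where "m = mollifier_mass TYPE('a)"
  have m: "0 < m" unfolding m_def by (rule mollifier_mass_pos)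
  have N: "1 \<le> N" by (simp add: N_def DIM_positive Suc_leI)
  define A where "A = real N * (2 * bump_bound) ^ (N - 1) / m"
  have A: "0 \<le> A" using bump_bound m by (simp add: A_def)
  define C where "C = (A\<^sup>2 * 2 ^ N * E) powr ((s - 2) / 2) * ((A * 2 ^ N)\<^sup>2 * E)"
  show thesis
  proof (rule that)
    show "0 \<le> C" using E by (simp add: C_def)
    fix w :: "'a \<Rightarrow> real" and j
    assume w: "w \<in> H1" and gE: "(\<integral>\<^sup>+y. ennreal ((norm (weak_gradient w y))\<^sup>2) \<partial>lebesgue) \<le> ennreal E"
    define \<tau> :: real where "\<tau> = (1 / 2) ^ j"
    have \<tau>: "0 < \<tau>" by (simp add: \<tau>_def)
    define K where "K = real N * (2 * bump_bound / \<tau>) ^ (N - 1) / m"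
    have K: "0 \<le> K" using bump_bound m \<tau> by (simp add: K_def)
    \<comment> \<open>The exponent N - 1 in \<open>K\<close> leaves one factor \<tau> over the
      volume of the cube. The truncated subtraction is harmless because N is at least 1.\<close>
    have Kt: "K * \<tau> ^ N = A * \<tau>"
    proof -
      have "\<tau> ^ N = \<tau> ^ (N - 1) * \<tau>" using N by (cases N) auto
      then show ?thesis using \<tau> by (simp add: K_def A_def power_divide field_simps)
    qed
    have gm: "weak_gradient w \<in> borel_measurable lebesgue" and wm: "w \<in> borel_measurable lebesgue"
      using H1_weak_gradient[OF w] by (auto simp: mem_Lp_2)
    have bd: "ennreal \<bar>smoothing j w x - smoothing (Suc j) w x\<bar> \<le> ennreal K * cube_integral \<tau> (weak_gradient w) x" for x
    proof -
      have "smoothing j w x - smoothing (Suc j) w x = (mollify \<tau> w x - mollify (\<tau> / 2) w x) / m"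
        by (simp add: smoothing_def \<tau>_def m_def diff_divide_distrib)
      then have "ennreal \<bar>smoothing j w x - smoothing (Suc j) w x\<bar> =
          ennreal (1 / m) * ennreal \<bar>mollify \<tau> w x - mollify (\<tau> / 2) w x\<bar>"
        using m by (simp add: ennreal_mult'[symmetric] abs_divide)
      also have "\<dots> \<le> ennreal (1 / m) * (ennreal (real N * (2 * bump_bound / \<tau>) ^ (N - 1)) * cube_integral \<tau> (weak_gradient w) x)"
        using mollify_diff_bound[OF H1_weak_gradient(1)[OF w] \<tau>, of x] by (intro mult_left_mono) (auto simp: N_def)
      also have "\<dots> = ennreal K * cube_integral \<tau> (weak_gradient w) x"
        using m by (simp add: K_def ennreal_mult'[symmetric] mult.assoc[symmetric])
      finally show ?thesis .
    qed
    have dm: "(\<lambda>x. smoothing j w x - smoothing (Suc j) w x) \<in> borel_measurable lebesgue"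
      by (intro borel_measurable_diff smoothing_measurable wm)
    have "(\<integral>\<^sup>+x. ennreal (\<bar>smoothing j w x - smoothing (Suc j) w x\<bar> powr s) \<partial>lebesgue) \<le>
      ennreal ((K\<^sup>2 * (2 * \<tau>) ^ N * E) powr ((s - 2) / 2) * ((K * (2 * \<tau>) ^ N)\<^sup>2 * E))"
      unfolding N_def by (rule cube_average_powr_bound(3)[OF gm less_imp_le[OF \<tau>] s gE E K bd dm])
    also have "(K * (2 * \<tau>) ^ N)\<^sup>2 * E = (A * 2 ^ N)\<^sup>2 * E * \<tau> powr 2"
    proof -
      have "K * (2 * \<tau>) ^ N = A * 2 ^ N * \<tau>" using Kt by (simp add: power_mult_distrib mult_ac)
      then have "(K * (2 * \<tau>) ^ N)\<^sup>2 * E = (A * 2 ^ N * \<tau>)\<^sup>2 * E" by (simp only:)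
      also have "\<dots> = (A * 2 ^ N)\<^sup>2 * E * \<tau> powr 2"
        using \<tau> by (simp add: power_mult_distrib powr_numeral mult_ac)
      finally show ?thesis .
    qed
    also have "(K\<^sup>2 * (2 * \<tau>) ^ N * E) powr ((s - 2) / 2) =
       (A\<^sup>2 * 2 ^ N * E) powr ((s - 2) / 2) * \<tau> powr (- ((real N - 2) * (s - 2) / 2))"
    proof -
      have "K\<^sup>2 * (2 * \<tau>) ^ N * \<tau> powr (real N - 2) = A\<^sup>2 * 2 ^ N"
      proof -
        have "K\<^sup>2 * (2 * \<tau>) ^ N * \<tau> powr (real N - 2) * \<tau>\<^sup>2 = K\<^sup>2 * (2 * \<tau>) ^ N * (\<tau> powr (real N - 2) * \<tau> powr 2)"
          using \<tau> by (simp add: powr_numeral mult_ac)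
        also have "\<tau> powr (real N - 2) * \<tau> powr 2 = \<tau> ^ N"
          using \<tau> by (subst powr_add[symmetric]) (simp add: powr_realpow)
        also have "K\<^sup>2 * (2 * \<tau>) ^ N * \<tau> ^ N = (K * \<tau> ^ N)\<^sup>2 * 2 ^ N"
          by (simp add: power_mult_distrib power2_eq_square mult_ac)
        also have "\<dots> = A\<^sup>2 * 2 ^ N * \<tau>\<^sup>2" unfolding Kt by (simp add: power_mult_distrib mult_ac)
        finally show ?thesis using \<tau> by simp
      qed
      moreover have "x * e = (y * e) * inverse z" if "x * z = y" "z \<noteq> 0" for x y z e :: real
        using that by (auto simp: field_simps)
      ultimately have "K\<^sup>2 * (2 * \<tau>) ^ N * E = (A\<^sup>2 * 2 ^ N * E) * \<tau> powr (- (real N - 2))"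
        using \<tau> unfolding powr_minus by simp
      then have "(K\<^sup>2 * (2 * \<tau>) ^ N * E) powr ((s - 2) / 2) =
          (A\<^sup>2 * 2 ^ N * E) powr ((s - 2) / 2) * (\<tau> powr (- (real N - 2))) powr ((s - 2) / 2)"
        by (simp only: powr_mult)
      moreover have "- (real N - 2) * ((s - 2) / 2) = - ((real N - 2) * (s - 2) / 2)" by (simp add: field_simps)
      ultimately show ?thesis by (simp only: powr_powr)
    qed
    also have "(A\<^sup>2 * 2 ^ N * E) powr ((s - 2) / 2) * \<tau> powr (- ((real N - 2) * (s - 2) / 2)) *
        ((A * 2 ^ N)\<^sup>2 * E * \<tau> powr 2) = C * \<tau> powr (2 - (real N - 2) * (s - 2) / 2)"
    proof -
      have "\<tau> powr (2 - (real N - 2) * (s - 2) / 2) = \<tau> powr (- ((real N - 2) * (s - 2) / 2)) * \<tau> powr 2"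
        by (subst powr_add[symmetric]) simp
      then show ?thesis by (simp add: C_def mult_ac)
    qed
    finally show "(\<integral>\<^sup>+x. ennreal (\<bar>smoothing j w x - smoothing (Suc j) w x\<bar> powr s) \<partial>lebesgue) \<le>
         ennreal (C * ((1 / 2) ^ j) powr (2 - (real DIM('a) - 2) * (s - 2) / 2))"
      by (simp add: N_def \<tau>_def)
  qed
qed

text \<open>The constant depends on the scale and degenerates as n grows; it serves for one fixed
  scale, where it is uniform over all functions with bounded L2 norm.\<close>

lemma smoothing_bound:
  fixes E s :: real
  assumes s: "2 \<le> s" and E: "0 \<le> E"
  obtains C where "0 \<le> C"
    "\<And>(w::'a::euclidean_space \<Rightarrow> real) x. locally_integrable w \<Longrightarrow> (\<integral>\<^sup>+y. ennreal ((w y)\<^sup>2) \<partial>lebesgue) \<le> ennreal E \<Longrightarrow>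
       \<bar>smoothing n w x\<bar> \<le> C"
    "\<And>w::'a::euclidean_space \<Rightarrow> real. locally_integrable w \<Longrightarrow> (\<integral>\<^sup>+y. ennreal ((w y)\<^sup>2) \<partial>lebesgue) \<le> ennreal E \<Longrightarrow>
       (\<integral>\<^sup>+x. ennreal (\<bar>smoothing n w x\<bar> powr s) \<partial>lebesgue) \<le> ennreal C"
proof -
  define m where "m = mollifier_mass TYPE('a)"
  have m: "0 < m" unfolding m_def by (rule mollifier_mass_pos)
  define \<tau> :: real where "\<tau> = (1 / 2) ^ n"
  have \<tau>: "0 < \<tau>" by (simp add: \<tau>_def)
  define K where "K = (bump_bound / \<tau>) ^ DIM('a) / m"
  have K: "0 \<le> K" using bump_bound m \<tau> by (simp add: K_def)
  define C1 where "C1 = sqrt (K\<^sup>2 * (2 * \<tau>) ^ DIM('a) * E)"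
  define C2 where "C2 = (K\<^sup>2 * (2 * \<tau>) ^ DIM('a) * E) powr ((s - 2) / 2) * ((K * (2 * \<tau>) ^ DIM('a))\<^sup>2 * E)"
  have C: "0 \<le> C1" "0 \<le> C2" using E K \<tau> by (auto simp: C1_def C2_def)
  have bd: "ennreal \<bar>smoothing n w x\<bar> \<le> ennreal K * cube_integral \<tau> w x" if "locally_integrable w" for w :: "'a \<Rightarrow> real" and x
  proof -
    have "ennreal \<bar>smoothing n w x\<bar> = ennreal (1 / m) * ennreal \<bar>mollify \<tau> w x\<bar>"
      using m by (simp add: smoothing_def \<tau>_def m_def ennreal_mult'[symmetric] abs_divide)
    also have "\<dots> \<le> ennreal (1 / m) * (ennreal ((bump_bound / \<tau>) ^ DIM('a)) * cube_integral \<tau> w x)"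
      by (intro mult_left_mono mollify_bound that \<tau>) simp
    also have "\<dots> = ennreal K * cube_integral \<tau> w x"
      using m by (simp add: K_def ennreal_mult'[symmetric] mult.assoc[symmetric])
    finally show ?thesis .
  qed
  show thesis
  proof (rule that[of "C1 + C2"])
    show "0 \<le> C1 + C2" using C by simp
    fix w :: "'a \<Rightarrow> real" assume w: "locally_integrable w" "(\<integral>\<^sup>+y. ennreal ((w y)\<^sup>2) \<partial>lebesgue) \<le> ennreal E"
    have wm: "w \<in> borel_measurable lebesgue" by (rule locally_integrable_measurable[OF w(1)])
    have wE: "(\<integral>\<^sup>+y. ennreal ((norm (w y))\<^sup>2) \<partial>lebesgue) \<le> ennreal E" using w(2) by simp
    note b = cube_average_powr_bound[OF wm less_imp_le[OF \<tau>] s wE E K bd[OF w(1)] smoothing_measurable[OF wm]]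
    show "\<bar>smoothing n w x\<bar> \<le> C1 + C2" for x
    proof -
      have "sqrt ((smoothing n w x)\<^sup>2) \<le> C1" unfolding C1_def by (intro real_sqrt_le_mono b)
      then show ?thesis using C by simp
    qed
    have "(\<integral>\<^sup>+x. ennreal (\<bar>smoothing n w x\<bar> powr s) \<partial>lebesgue) \<le> ennreal C2"
      unfolding C2_def by (rule b(3))
    also have "\<dots> \<le> ennreal (C1 + C2)" using C by (intro ennreal_leI) simp
    finally show "(\<integral>\<^sup>+x. ennreal (\<bar>smoothing n w x\<bar> powr s) \<partial>lebesgue) \<le> ennreal (C1 + C2)" .
  qed
qed

section \<open>Almost everywhere convergence of the smoothings, and a subcritical error bound
  uniform over bounded gradients\<close>

section \<open>Approximation by smoothing\<close>

lemma mollifier_shift_integrable: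
  fixes y :: "'a::euclidean_space"
  assumes "0 < \<tau>" shows "integrable lebesgue (\<lambda>x. mollifier \<tau> (x - y))"
proof -
  have "continuous_on UNIV (\<lambda>x. mollifier \<tau> (x - y))"
    by (intro continuous_on_compose2[OF mollifier_continuous] continuous_intros) auto
  then have "integrable lebesgue (\<lambda>x. 1 * mollifier \<tau> (x - y))"
    by (rule integrable_locally_integrable_mult[OF locally_integrable_const, of _ "cube \<tau> y"])
       (auto simp: mem_cube_commute[of _ \<tau> y] mollifier_outside_cube[OF assms], simp add: cube_def compact_cbox)
  then show ?thesis by simp
qed

lemma small_cube_in_open:
  fixes x :: "'a::euclidean_space"
  assumes "open U" "x \<in> U"
  shows "\<forall>\<^sub>F n in sequentially. cube ((1 / 2) ^ n) x \<subseteq> U"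
proof -
  obtain e where e: "0 < e" "ball x e \<subseteq> U" using assms open_contains_ball by blast
  have "(\<lambda>n. real DIM('a) * (1 / 2) ^ n) \<longlonglongrightarrow> real DIM('a) * 0"
    by (intro tendsto_mult_left LIMSEQ_realpow_zero) auto
  then have "\<forall>\<^sub>F n in sequentially. real DIM('a) * (1 / 2) ^ n < e"
    by (rule order_tendstoD(2)) (use e(1) in simp)
  then show ?thesis
  proof eventually_elim
    case (elim n)
    show ?case
    proof
      fix y assume "y \<in> cube ((1 / 2) ^ n) x"
      then have "\<And>i. i \<in> Basis \<Longrightarrow> \<bar>(x - y) \<bullet> i\<bar> \<le> (1 / 2) ^ n" by (auto simp: mem_cube inner_diff_left)
      then have "(\<Sum>i\<in>Basis. \<bar>(x - y) \<bullet> i\<bar>) \<le> real DIM('a) * (1 / 2) ^ n"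
        by (rule sum_bounded_above)
      with norm_le_l1[of "x - y"] elim have "dist x y < e" by (simp add: dist_norm)
      then show "y \<in> U" using e by auto
    qed
  qed
qed

text \<open>Fubini moves the mollification from w to the indicator of the box, where it converges
  pointwise off the boundary. This later identifies the almost everywhere limit of the smoothings
  with w.\<close>

lemma box_integral_smoothing_tendsto:
  fixes w :: "'a::euclidean_space \<Rightarrow> real"
  assumes loc: "locally_integrable w" and w2: "w \<in> Lp 2"
  shows "(\<lambda>n. \<integral>x. indicator (box a b) x * smoothing n w x \<partial>lebesgue) \<longlonglongrightarrow>
    (\<integral>x. indicator (box a b) x * w x \<partial>lebesgue)"
proof -
  define m where "m = mollifier_mass TYPE('a)"
  have m: "0 < m" unfolding m_def by (rule mollifier_mass_pos)
  define k where "k n z = mollifier ((1 / 2) ^ n) (z :: 'a) / m" for n z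
  have k0: "0 \<le> k n z" for n z using m by (simp add: k_def mollifier_nonneg)
  have kz: "k n (x - y) = 0" if "x \<notin> cube ((1 / 2) ^ n) y" for n x y
    using that by (simp add: k_def mollifier_outside_cube mem_cube_commute)
  have ki: "integrable lebesgue (\<lambda>x. k n (x - y))" for n y
    unfolding k_def by (intro integrable_divide_zero mollifier_shift_integrable) simp
  have k1: "(\<integral>x. k n (x - y) \<partial>lebesgue) = 1" for n y
    using m by (simp add: k_def integral_mollifier m_def)
  have wm: "w \<in> borel_measurable lebesgue" by (rule locally_integrable_measurable[OF loc])
  define \<psi> where "\<psi> n y = (\<integral>x. indicator (box a b) x * k n (x - y) \<partial>lebesgue)" for n y
  have qi: "integrable lebesgue (\<lambda>x. indicator (box a b) x * k n (x - y))" for n y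
    using integrable_real_mult_indicator[OF _ ki, of "box a b" n y] by (simp add: mult.commute)
  have \<psi>0: "0 \<le> \<psi> n y" for n y unfolding \<psi>_def by (intro integral_nonneg_AE AE_I2) (simp add: k0)
  have \<psi>1: "\<psi> n y \<le> 1" for n y
    unfolding \<psi>_def k1[of n y, symmetric]
    by (intro integral_mono qi ki) (auto simp: indicator_def k0)
  have sm: "smoothing n v x = (\<integral>y. v y * k n (x - y) \<partial>lebesgue)" for n x and v :: "'a \<Rightarrow> real"
    by (simp add: smoothing_eq_integral k_def m_def mult.commute)
  have eq: "(\<integral>x. indicator (box a b) x * smoothing n w x \<partial>lebesgue) = (\<integral>y. w y * \<psi> n y \<partial>lebesgue)" for n
  proof -
    define F where "F x y = indicator (box a b) x * (w y * k n (x - y))" for x y :: 'a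
    have Fm: "case_prod F \<in> borel_measurable (lebesgue \<Otimes>\<^sub>M lebesgue)"
    proof -
      have 1: "(\<lambda>z::'a \<times> 'a. indicator (box a b) (fst z) :: real) \<in> borel_measurable (lebesgue \<Otimes>\<^sub>M lebesgue)"
        by (rule lebesgue_pair_measurable_comp(2)) simp
      have 2: "(\<lambda>z::'a \<times> 'a. w (snd z)) \<in> borel_measurable (lebesgue \<Otimes>\<^sub>M lebesgue)"
        by (rule lebesgue_pair_measurable_comp(1)[OF wm])
      have 3: "(\<lambda>z::'a \<times> 'a. k n (fst z - snd z)) \<in> borel_measurable (lebesgue \<Otimes>\<^sub>M lebesgue)"
        unfolding k_def
        by (intro borel_measurable_divide borel_measurable_const
            measurable_compose[OF borel_measurable_lebesgue_pair_diff mollifier_measurable])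
      show ?thesis using borel_measurable_times[OF 1 borel_measurable_times[OF 2 3]]
        by (simp add: F_def[abs_def] case_prod_beta')
    qed
    \<comment> \<open>Fubini asks for integrability of the absolute value, so |w| is smoothed as
      well; the result is bounded, and the box has finite measure.\<close>
    have loc': "locally_integrable (\<lambda>y. \<bar>w y\<bar>)"
      unfolding locally_integrable_def
    proof (intro allI impI)
      fix K :: "'a set" assume "compact K"
      then have "integrable lebesgue (\<lambda>x. \<bar>indicator K x *\<^sub>R w x\<bar>)"
        using loc by (intro integrable_abs) (simp add: locally_integrable_def set_integrable_def)
      then show "set_integrable lebesgue K (\<lambda>y. \<bar>w y\<bar>)" by (simp add: set_integrable_def abs_mult)
    qed
    define E where "E = (\<integral>y. (w y)\<^sup>2 \<partial>lebesgue)"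
    have "0 \<le> E" by (simp add: E_def)
    obtain C where C: "0 \<le> C" "\<And>(v::'a \<Rightarrow> real) x. locally_integrable v \<Longrightarrow>
        (\<integral>\<^sup>+y. ennreal ((v y)\<^sup>2) \<partial>lebesgue) \<le> ennreal E \<Longrightarrow> \<bar>smoothing n v x\<bar> \<le> C"
      by (rule smoothing_bound[OF order_refl \<open>0 \<le> E\<close>, of n]) (rule that, assumption, blast)
    have "(\<integral>\<^sup>+y. ennreal ((w y)\<^sup>2) \<partial>lebesgue) = ennreal E"
      unfolding E_def using w2 by (intro nn_integral_eq_integral) (auto simp: mem_Lp_2)
    then have smb: "\<bar>smoothing n (\<lambda>y. \<bar>w y\<bar>) x\<bar> \<le> C" for x by (intro C(2) loc') simp
    have int: "integrable (lebesgue \<Otimes>\<^sub>M lebesgue) (case_prod F)"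
    proof (rule lebesgue_pair.Fubini_integrable[OF Fm])
      have "(\<lambda>x. \<integral>y. norm (case_prod F (x, y)) \<partial>lebesgue) = (\<lambda>x. indicator (box a b) x * smoothing n (\<lambda>y. \<bar>w y\<bar>) x)"
        by (simp add: F_def sm abs_mult k0 fun_eq_iff)
      moreover have "integrable lebesgue (\<lambda>x. indicator (box a b) x * smoothing n (\<lambda>y. \<bar>w y\<bar>) x)"
      proof (rule Bochner_Integration.integrable_bound)
        show "integrable lebesgue (\<lambda>x. C * indicator (box a b) x :: real)"
          by (intro integrable_mult_right integrable_real_indicator) (use emeasure_lborel_box_finite[of a b] in \<open>auto simp: infinity_ennreal_def\<close>)
        show "(\<lambda>x. indicator (box a b) x * smoothing n (\<lambda>y. \<bar>w y\<bar>) x) \<in> borel_measurable lebesgue"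
          using wm by (intro borel_measurable_times smoothing_measurable) auto
        show "AE x in lebesgue. norm (indicator (box a b) x * smoothing n (\<lambda>y. \<bar>w y\<bar>) x) \<le>
            norm (C * indicator (box a b) x :: real)"
          using smb C(1) by (intro AE_I2) (auto simp: indicator_def)
      qed
      ultimately show "integrable lebesgue (\<lambda>x. \<integral>y. norm (case_prod F (x, y)) \<partial>lebesgue)" by simp
      show "AE x in lebesgue. integrable lebesgue (\<lambda>y. case_prod F (x, y))"
        using integrable_mollify[OF loc, of "(1 / 2) ^ n"] by (intro AE_I2) (simp add: F_def k_def)
    qed
    have "(\<integral>x. indicator (box a b) x * smoothing n w x \<partial>lebesgue) = (\<integral>x. (\<integral>y. F x y \<partial>lebesgue) \<partial>lebesgue)"
      by (simp add: sm F_def)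
    also have "\<dots> = (\<integral>y. (\<integral>x. F x y \<partial>lebesgue) \<partial>lebesgue)"
      by (rule lebesgue_pair.Fubini_integral[OF int, symmetric])
    also have "\<dots> = (\<integral>y. w y * \<psi> n y \<partial>lebesgue)"
    proof (intro Bochner_Integration.integral_cong refl)
      fix y
      have "(\<integral>x. F x y \<partial>lebesgue) = (\<integral>x. w y * (indicator (box a b) x * k n (x - y)) \<partial>lebesgue)"
        by (simp add: F_def mult_ac)
      then show "(\<integral>x. F x y \<partial>lebesgue) = w y * \<psi> n y" by (simp add: \<psi>_def)
    qed
    finally show ?thesis .
  qed
  \<comment> \<open>All scales are at most 1, so the box enlarged by 1 contains the support of every
    \<open>\<psi> n\<close> and provides one dominating function.\<close>
  define R where "R = cbox (a - One) (b + One)"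
  have \<psi>R: "\<psi> n y = 0" if "y \<notin> R" for n y
  proof -
    have "indicator (box a b) x * k n (x - y) = 0" for x
    proof (cases "x \<in> box a b \<and> x \<in> cube ((1 / 2) ^ n) y")
      case True
      have "y \<in> R" unfolding R_def mem_box
      proof
        fix i :: 'a assume i: "i \<in> Basis"
        have "\<bar>y \<bullet> i - x \<bullet> i\<bar> \<le> 1"
          using True i power_le_one[of "1 / 2 :: real" n] by (force simp: mem_cube)
        moreover have "a \<bullet> i < x \<bullet> i" "x \<bullet> i < b \<bullet> i" using True i by (auto simp: mem_box)
        ultimately show "(a - One) \<bullet> i \<le> y \<bullet> i \<and> y \<bullet> i \<le> (b + One) \<bullet> i"
          using i by (auto simp: inner_diff_left inner_add_left inner_sum_left_Basis abs_le_iff)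
      qed
      with that show ?thesis by simp
    next
      case False
      then show ?thesis using kz[of x n y] by auto
    qed
    then show ?thesis unfolding \<psi>_def by (simp only: integral_zero)
  qed
  have lim: "(\<lambda>n. \<psi> n y) \<longlonglongrightarrow> indicator (box a b) y" if y: "y \<notin> cbox a b - box a b" for y
  proof (cases "y \<in> box a b")
    case True
    have "\<forall>\<^sub>F n in sequentially. \<psi> n y = indicator (box a b) y"
      using small_cube_in_open[OF open_box True]
    proof eventually_elim
      case (elim n)
      have "indicator (box a b) x * k n (x - y) = k n (x - y)" for x
        using elim kz[of x n y] by (auto simp: indicator_def)
      then have "\<psi> n y = 1" unfolding \<psi>_def by (simp only: k1)
      then show ?case using True by simp
    qed
    then show ?thesis by (rule tendsto_eventually)
  next
    case False
    with y have "y \<in> - cbox a b" by auto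
    then have "\<forall>\<^sub>F n in sequentially. cube ((1 / 2) ^ n) y \<subseteq> - cbox a b"
      by (intro small_cube_in_open) (auto intro: open_Compl closed_cbox)
    then have "\<forall>\<^sub>F n in sequentially. \<psi> n y = indicator (box a b) y"
    proof eventually_elim
      case (elim n)
      have "indicator (box a b) x * k n (x - y) = 0" for x
        using elim kz[of x n y] box_subset_cbox[of a b] by (auto simp: indicator_def)
      then have "\<psi> n y = 0" unfolding \<psi>_def by (simp only: integral_zero)
      then show ?case using False by simp
    qed
    then show ?thesis by (rule tendsto_eventually)
  qed
  have "(\<lambda>n. \<integral>y. w y * \<psi> n y \<partial>lebesgue) \<longlonglongrightarrow> (\<integral>y. w y * indicator (box a b) y \<partial>lebesgue)"
  proof (rule integral_dominated_convergence[where w = "\<lambda>y. \<bar>indicator R y *\<^sub>R w y\<bar>"])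
    show "(\<lambda>y. w y * indicator (box a b) y) \<in> borel_measurable lebesgue"
      using wm by (intro borel_measurable_times) auto
    show "(\<lambda>y. w y * \<psi> n y) \<in> borel_measurable lebesgue" for n
    proof (intro borel_measurable_times wm)
      have 1: "(\<lambda>z::'a \<times> 'a. indicator (box a b) (snd z) :: real) \<in> borel_measurable (lebesgue \<Otimes>\<^sub>M lebesgue)"
        by (rule lebesgue_pair_measurable_comp(1)) simp
      have "(\<lambda>z::'a \<times> 'a. snd z - fst z) \<in> borel_measurable (lebesgue \<Otimes>\<^sub>M lebesgue)"
        using borel_measurable_uminus[OF borel_measurable_lebesgue_pair_diff] by simp
      then have 3: "(\<lambda>z::'a \<times> 'a. k n (snd z - fst z)) \<in> borel_measurable (lebesgue \<Otimes>\<^sub>M lebesgue)"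
        unfolding k_def
        by (intro borel_measurable_divide borel_measurable_const measurable_compose[OF _ mollifier_measurable])
      have "(\<lambda>(y, x). indicator (box a b) x * k n (x - y)) \<in> borel_measurable (lebesgue \<Otimes>\<^sub>M lebesgue)"
        using borel_measurable_times[OF 1 3] by (simp add: case_prod_beta)
      from lebesgue.borel_measurable_lebesgue_integral[OF this]
      show "\<psi> n \<in> borel_measurable lebesgue" by (simp add: \<psi>_def[abs_def])
    qed
    show "integrable lebesgue (\<lambda>y. \<bar>indicator R y *\<^sub>R w y\<bar>)"
      using loc by (intro integrable_abs) (simp add: locally_integrable_def set_integrable_def R_def compact_cbox)
    have "negligible (cbox a b - box a b)" by (rule negligible_frontier_interval)
    then have "AE y in lebesgue. y \<notin> cbox a b - box a b"
      unfolding negligible_iff_null_sets by (rule AE_not_in)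
    then show "AE y in lebesgue. (\<lambda>n. w y * \<psi> n y) \<longlonglongrightarrow> w y * indicator (box a b) y"
      by eventually_elim (intro tendsto_mult_left lim)
    show "AE y in lebesgue. norm (w y * \<psi> n y) \<le> \<bar>indicator R y *\<^sub>R w y\<bar>" for n
    proof (intro AE_I2)
      fix y
      show "norm (w y * \<psi> n y) \<le> \<bar>indicator R y *\<^sub>R w y\<bar>"
        using \<psi>0[of n y] mult_left_mono[OF \<psi>1[of n y], of "\<bar>w y\<bar>"] \<psi>R[of y n]
        by (cases "y \<in> R") (auto simp: abs_mult)
    qed
  qed
  moreover have "(\<integral>y. w y * indicator (box a b) y \<partial>lebesgue) = (\<integral>y. indicator (box a b) y * w y \<partial>lebesgue)"
    by (simp only: mult.commute)
  ultimately show ?thesis unfolding eq by simp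
qed

text \<open>Summing before integrating yields one function of x that controls all later scales at
  once; its integral still decays with the starting scale n.\<close>

lemma smoothing_tail_bound:
  fixes E s :: real
  assumes s: "2 \<le> s" and E: "0 \<le> E"
  defines "\<gamma> \<equiv> 2 - (real DIM('a::euclidean_space) - 2) * (s - 2) / 2"
  assumes \<gamma>: "0 < \<gamma>"
  obtains C \<rho> where "0 \<le> C" "0 < \<rho>" "\<rho> < 1"
    "\<And>(w::'a \<Rightarrow> real) n. w \<in> H1 \<Longrightarrow>
       (\<integral>\<^sup>+y. ennreal ((norm (weak_gradient w y))\<^sup>2) \<partial>lebesgue) \<le> ennreal E \<Longrightarrow>
       (\<integral>\<^sup>+x. (\<Sum>j. ennreal ((\<bar>smoothing (n + j) w x - smoothing (n + Suc j) w x\<bar> / \<rho> ^ j) powr s)) \<partial>lebesgue) \<le>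
         ennreal (C * ((1 / 2) powr \<gamma>) ^ n)"
proof -
  obtain C where C: "0 \<le> C"
    "\<And>(w::'a::euclidean_space \<Rightarrow> real) j. w \<in> H1 \<Longrightarrow>
       (\<integral>\<^sup>+y. ennreal ((norm (weak_gradient w y))\<^sup>2) \<partial>lebesgue) \<le> ennreal E \<Longrightarrow>
       (\<integral>\<^sup>+x. ennreal (\<bar>smoothing j w x - smoothing (Suc j) w x\<bar> powr s) \<partial>lebesgue) \<le>
         ennreal (C * ((1 / 2) ^ j) powr \<gamma>)"
    unfolding \<gamma>_def by (fact smoothing_step_bound[OF s E])
  \<comment> \<open>Each scale decays by 2^(-\<gamma>). Half of this exponent pays for the weights
    \<rho>^(-s), the other half is the ratio \<open>r\<close> of the remaining geometric
    series.\<close>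
  define \<rho> where "\<rho> = (1 / 2 :: real) powr (\<gamma> / (2 * s))"
  define r where "r = (1 / 2 :: real) powr (\<gamma> / 2)"
  have \<rho>: "0 < \<rho>" "\<rho> < 1" using \<gamma> s by (auto simp: \<rho>_def powr01_less_one)
  have r: "0 < r" "r < 1" using \<gamma> by (auto simp: r_def powr01_less_one)
  have \<rho>r: "\<rho> powr (- s) * (1 / 2) powr \<gamma> = r"
  proof -
    have "\<rho> powr (- s) = (1 / 2) powr (- \<gamma> / 2)" using s by (simp add: \<rho>_def powr_powr)
    moreover have "(1 / 2 :: real) powr (- \<gamma> / 2) * (1 / 2) powr \<gamma> = r"
      unfolding r_def by (subst powr_add[symmetric]) simp
    ultimately show ?thesis by simp
  qed
  show thesis
  proof (rule that[of "C / (1 - r)" \<rho>])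
    show "0 \<le> C / (1 - r)" using C(1) r by simp
    fix w :: "'a \<Rightarrow> real" and n
    assume w: "w \<in> H1" "(\<integral>\<^sup>+y. ennreal ((norm (weak_gradient w y))\<^sup>2) \<partial>lebesgue) \<le> ennreal E"
    have wm: "w \<in> borel_measurable lebesgue" using H1_weak_gradient(3)[OF w(1)] by (auto simp: mem_Lp_2)
    define d where "d j x = \<bar>smoothing (n + j) w x - smoothing (n + Suc j) w x\<bar>" for j x
    have dm: "d j \<in> borel_measurable lebesgue" for j
      unfolding d_def[abs_def] by (intro borel_measurable_abs borel_measurable_diff smoothing_measurable wm)
    have scale: "ennreal ((d j x / \<rho> ^ j) powr s) = ennreal ((\<rho> powr (- s)) ^ j) * ennreal (d j x powr s)" for j x
    proof -
      have "(d j x / \<rho> ^ j) powr s = d j x powr s / (\<rho> ^ j) powr s"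
        using \<rho> by (simp add: powr_divide d_def)
      also have "(\<rho> ^ j) powr s = (\<rho> powr s) ^ j" using \<rho> by (simp add: powr_realpow[symmetric] powr_powr mult.commute)
      finally have "(d j x / \<rho> ^ j) powr s = (\<rho> powr (- s)) ^ j * d j x powr s"
        using \<rho> by (simp add: powr_minus power_inverse divide_inverse)
      then show ?thesis by (simp add: ennreal_mult')
    qed
    have "(\<integral>\<^sup>+x. (\<Sum>j. ennreal ((d j x / \<rho> ^ j) powr s)) \<partial>lebesgue) =
        (\<Sum>j. (\<integral>\<^sup>+x. ennreal ((d j x / \<rho> ^ j) powr s) \<partial>lebesgue))"
      using dm by (intro nn_integral_suminf) auto
    also have "\<dots> = (\<Sum>j. ennreal ((\<rho> powr (- s)) ^ j) * (\<integral>\<^sup>+x. ennreal (d j x powr s) \<partial>lebesgue))"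
      unfolding scale using dm by (intro suminf_cong nn_integral_cmult) auto
    also have "\<dots> \<le> (\<Sum>j. ennreal (C * ((1 / 2) powr \<gamma>) ^ n * r ^ j))"
    proof (rule suminf_le)
      fix j
      have "(\<integral>\<^sup>+x. ennreal (d j x powr s) \<partial>lebesgue) \<le> ennreal (C * ((1 / 2) ^ (n + j)) powr \<gamma>)"
        using C(2)[OF w, of "n + j"] by (simp add: d_def)
      then have "ennreal ((\<rho> powr (- s)) ^ j) * (\<integral>\<^sup>+x. ennreal (d j x powr s) \<partial>lebesgue) \<le>
          ennreal ((\<rho> powr (- s)) ^ j) * ennreal (C * ((1 / 2) ^ (n + j)) powr \<gamma>)"
        by (intro mult_left_mono) auto
      also have "\<dots> = ennreal ((\<rho> powr (- s)) ^ j * (C * ((1 / 2) ^ (n + j)) powr \<gamma>))"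
        by (simp add: ennreal_mult')
      also have "((1 / 2 :: real) ^ (n + j)) powr \<gamma> = ((1 / 2) powr \<gamma>) ^ n * ((1 / 2) powr \<gamma>) ^ j"
      proof -
        have "((1 / 2 :: real) ^ i) powr \<gamma> = ((1 / 2) powr \<gamma>) ^ i" for i
        proof -
          have "((1 / 2 :: real) ^ i) powr \<gamma> = ((1 / 2) powr real i) powr \<gamma>" by (subst powr_realpow) auto
          also have "\<dots> = ((1 / 2) powr \<gamma>) powr real i" by (simp only: powr_powr mult.commute)
          also have "\<dots> = ((1 / 2) powr \<gamma>) ^ i" by (intro powr_realpow) simp
          finally show ?thesis .
        qed
        from this[of "n + j"] show ?thesis by (simp only: power_add)
      qed
      also have "(\<rho> powr (- s)) ^ j * (C * (((1 / 2) powr \<gamma>) ^ n * ((1 / 2) powr \<gamma>) ^ j)) = C * ((1 / 2) powr \<gamma>) ^ n * r ^ j"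
        unfolding \<rho>r[symmetric] by (simp add: power_mult_distrib mult_ac)
      finally show "ennreal ((\<rho> powr (- s)) ^ j) * (\<integral>\<^sup>+x. ennreal (d j x powr s) \<partial>lebesgue) \<le>
         ennreal (C * ((1 / 2) powr \<gamma>) ^ n * r ^ j)" .
    qed auto
    also have "\<dots> = ennreal (\<Sum>j. C * ((1 / 2) powr \<gamma>) ^ n * r ^ j)"
      using r C(1) by (intro suminf_ennreal2 summable_mult summable_geometric) auto
    also have "(\<Sum>j. C * ((1 / 2) powr \<gamma>) ^ n * r ^ j) = C * ((1 / 2) powr \<gamma>) ^ n * (1 / (1 - r))"
      using r by (subst suminf_mult) (auto simp: suminf_geometric summable_geometric)
    finally show "(\<integral>\<^sup>+x. (\<Sum>j. ennreal ((\<bar>smoothing (n + j) w x - smoothing (n + Suc j) w x\<bar> / \<rho> ^ j) powr s)) \<partial>lebesgue) \<le>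
         ennreal (C / (1 - r) * ((1 / 2) powr \<gamma>) ^ n)"
      by (simp add: d_def mult_ac)
  qed (rule \<rho>)+
qed

lemma H1_integrals_eq:
  assumes "w \<in> H1"
  shows "(\<integral>\<^sup>+y. ennreal ((norm (weak_gradient w y))\<^sup>2) \<partial>lebesgue) =
      ennreal (\<integral>y. (norm (weak_gradient w y))\<^sup>2 \<partial>lebesgue)"
    and "(\<integral>\<^sup>+y. ennreal ((w y)\<^sup>2) \<partial>lebesgue) = ennreal (\<integral>y. (w y)\<^sup>2 \<partial>lebesgue)"
  using H1_weak_gradient[OF assms] by (auto simp: mem_Lp_2 intro!: nn_integral_eq_integral)

lemma H1_locally_integrable: "w \<in> H1 \<Longrightarrow> locally_integrable w"
  using H1_weak_gradient(1) by (auto simp: has_weak_gradient_def)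

text \<open>For s = 2 the exponent of decay is 2 in every dimension, so the weighted sum is
  integrable, hence finite almost everywhere. This gives convergence and a locally integrable
  majorant, and box integrals identify the limit.\<close>

lemma smoothing_tendsto_AE:
  fixes w :: "'a::euclidean_space \<Rightarrow> real"
  assumes w: "w \<in> H1"
  shows "AE x in lebesgue. (\<lambda>n. smoothing n w x) \<longlonglongrightarrow> w x"
proof -
  have w2: "w \<in> Lp 2" and loc: "locally_integrable w"
    using H1_weak_gradient[OF w] H1_locally_integrable[OF w] by auto
  have wm: "w \<in> borel_measurable lebesgue" by (rule locally_integrable_measurable[OF loc])
  note sm = smoothing_measurable[OF wm]
  define E where "E = (\<integral>y. (norm (weak_gradient w y))\<^sup>2 \<partial>lebesgue)"
  define E' where "E' = (\<integral>y. (w y)\<^sup>2 \<partial>lebesgue)"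
  have E: "0 \<le> E" "0 \<le> E'" by (simp_all add: E_def E'_def)
  have exponent: "0 < 2 - (real DIM('a) - 2) * (2 - 2) / (2::real)" by simp
  obtain C \<rho> where C: "0 \<le> C" "0 < \<rho>" "\<rho> < 1"
    "\<And>(w::'a \<Rightarrow> real) n. w \<in> H1 \<Longrightarrow>
       (\<integral>\<^sup>+y. ennreal ((norm (weak_gradient w y))\<^sup>2) \<partial>lebesgue) \<le> ennreal E \<Longrightarrow>
       (\<integral>\<^sup>+x. (\<Sum>j. ennreal ((\<bar>smoothing (n + j) w x - smoothing (n + Suc j) w x\<bar> / \<rho> ^ j) powr 2)) \<partial>lebesgue) \<le>
         ennreal (C * ((1 / 2) powr (2 - (real DIM('a) - 2) * (2 - 2) / 2)) ^ n)"
    by (fact smoothing_tail_bound[OF order_refl E(1) exponent])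
  define T where "T x = (\<Sum>j. ennreal ((\<bar>smoothing j w x - smoothing (Suc j) w x\<bar> / \<rho> ^ j) powr 2))" for x
  have Tm: "T \<in> borel_measurable lebesgue"
    unfolding T_def[abs_def] using sm by auto
  have "(\<integral>\<^sup>+x. T x \<partial>lebesgue) \<le> ennreal (C * ((1 / 2) powr (2 - (real DIM('a) - 2) * (2 - 2) / 2)) ^ 0)"
    using C(4)[OF w eq_refl[OF H1_integrals_eq(1)[OF w, folded E_def]], of 0] unfolding T_def add_0 .
  also have "\<dots> < \<infinity>" by simp
  finally have Tfin: "(\<integral>\<^sup>+x. T x \<partial>lebesgue) < \<infinity>" .
  then have TAE: "AE x in lebesgue. T x \<noteq> \<infinity>" by (intro nn_integral_PInf_AE Tm) auto
  define R where "R x = enn2real (T x)" for x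
  have Rm: "R \<in> borel_measurable lebesgue" unfolding R_def[abs_def] using Tm by auto
  have R0: "0 \<le> R x" for x by (simp add: R_def)
  have "(\<integral>\<^sup>+x. ennreal (R x) \<partial>lebesgue) = (\<integral>\<^sup>+x. T x \<partial>lebesgue)"
    using TAE by (intro nn_integral_cong_AE) (auto simp: R_def less_top[symmetric] elim!: eventually_mono)
  with Tfin have Rint: "integrable lebesgue R" using Rm R0
    by (intro integrableI_nonneg) auto
  obtain C0 where C0: "0 \<le> C0" "\<And>x. \<bar>smoothing 0 w x\<bar> \<le> C0"
  proof (rule smoothing_bound[OF order_refl E(2), of 0, where 'a = 'a])
    fix D assume D: "0 \<le> D" "\<And>(v::'a \<Rightarrow> real) x. locally_integrable v \<Longrightarrow>
        (\<integral>\<^sup>+y. ennreal ((v y)\<^sup>2) \<partial>lebesgue) \<le> ennreal E' \<Longrightarrow> \<bar>smoothing 0 v x\<bar> \<le> D"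
    show thesis by (rule that[OF D(1)], rule D(2)[OF loc]) (simp add: H1_integrals_eq(2)[OF w] E'_def)
  qed
  \<comment> \<open>The telescoping bound contains the square root of \<open>R\<close>; it is
    replaced by 1 + R, which is locally integrable because R is integrable.\<close>
  define H where "H x = (C0 + 1 / (1 - \<rho>)) + R x / (1 - \<rho>)" for x
  have H0: "0 \<le> H x" for x using C0(1) C R0[of x] by (simp add: H_def)
  have bd: "AE x in lebesgue. (\<forall>n. \<bar>smoothing n w x\<bar> \<le> H x) \<and> convergent (\<lambda>n. smoothing n w x)"
    using TAE
  proof eventually_elim
    case (elim x)
    have TR: "T x = ennreal (R x)" using elim by (simp add: R_def less_top)
    then have le: "(\<Sum>j. ennreal ((\<bar>smoothing j w x - smoothing (Suc j) w x\<bar> / \<rho> ^ j) powr 2)) \<le> ennreal (R x)"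
      by (simp add: T_def)
    have "\<bar>smoothing n w x\<bar> \<le> H x" for n
    proof -
      have "\<bar>smoothing n w x - smoothing 0 w x\<bar> \<le> R x powr (1 / 2) / (1 - \<rho>)"
        by (rule telescoping_powr(1)[OF _ C(2,3) R0 le]) simp
      also have "\<dots> \<le> (1 + R x) / (1 - \<rho>)"
      proof (rule divide_right_mono)
        show "R x powr (1 / 2) \<le> 1 + R x"
          using R0[of x] by (simp add: powr_half_sqrt real_le_lsqrt power2_eq_square algebra_simps)
      qed (use C in simp)
      finally show ?thesis using C0(2)[of x] by (simp add: H_def add_divide_distrib)
    qed
    moreover have "convergent (\<lambda>n. smoothing n w x)"
      by (rule telescoping_powr(2)[OF _ C(2,3) R0 le]) simp
    ultimately show ?case by blast
  qed
  define l where "l x = lim (\<lambda>n. smoothing n w x)" for x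
  have lm: "l \<in> borel_measurable lebesgue" unfolding l_def[abs_def] using sm by (rule borel_measurable_lim_metric)
  have lim: "AE x in lebesgue. (\<lambda>n. smoothing n w x) \<longlonglongrightarrow> l x"
    using bd by eventually_elim (auto simp: l_def convergent_LIMSEQ_iff)
  have lH: "AE x in lebesgue. \<bar>l x\<bar> \<le> H x"
    using bd lim
  proof eventually_elim
    case (elim x)
    show ?case by (rule Lim_bounded[OF tendsto_rabs[OF elim(2)], of 0]) (use elim in auto)
  qed
  have Hloc: "locally_integrable H"
    unfolding H_def[abs_def]
  proof (rule locally_integrable_add[OF locally_integrable_const])
    show "locally_integrable (\<lambda>x. R x / (1 - \<rho>))"
      unfolding locally_integrable_def
    proof (intro allI impI)
      fix K :: "'a set" assume "compact K"
      then have K: "K \<in> sets lebesgue" by (meson lmeasurable_compact fmeasurableD)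
      show "set_integrable lebesgue K (\<lambda>x. R x / (1 - \<rho>))"
        unfolding set_integrable_def
        by (rule integrable_mult_indicator[OF K]) (intro integrable_divide_zero Rint)
    qed
  qed
  have lloc: "locally_integrable l"
    unfolding locally_integrable_def set_integrable_def
  proof (intro allI impI)
    fix K :: "'a set" assume K: "compact K"
    then have Km: "K \<in> sets lebesgue" by (meson lmeasurable_compact fmeasurableD)
    show "integrable lebesgue (\<lambda>x. indicator K x *\<^sub>R l x)"
    proof (rule Bochner_Integration.integrable_bound)
      show "integrable lebesgue (\<lambda>x. indicator K x *\<^sub>R H x)"
        using Hloc K by (simp add: locally_integrable_def set_integrable_def)
      show "(\<lambda>x. indicator K x *\<^sub>R l x) \<in> borel_measurable lebesgue"
        using lm Km by (intro borel_measurable_scaleR borel_measurable_indicator)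
      show "AE x in lebesgue. norm (indicator K x *\<^sub>R l x) \<le> norm (indicator K x *\<^sub>R H x)"
        using lH by eventually_elim (auto simp: indicator_def)
    qed
  qed
  have "AE x in lebesgue. l x + (-1) *\<^sub>R w x = 0"
  proof (rule AE_zero_if_box_integrals_zero)
    show "locally_integrable (\<lambda>x. l x + - 1 *\<^sub>R w x)"
      by (rule locally_integrable_add[OF lloc locally_integrable_scaleR[OF loc]])
    fix a b :: 'a
    have "(\<lambda>n. \<integral>x. indicator (box a b) x * smoothing n w x \<partial>lebesgue) \<longlonglongrightarrow>
        (\<integral>x. indicator (box a b) x * l x \<partial>lebesgue)"
    proof (rule integral_dominated_convergence[where w = "\<lambda>x. indicator (cbox a b) x *\<^sub>R H x"])
      show "(\<lambda>x. indicator (box a b) x * l x) \<in> borel_measurable lebesgue"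
        using lm by (intro borel_measurable_times) auto
      show "(\<lambda>x. indicator (box a b) x * smoothing n w x) \<in> borel_measurable lebesgue" for n
        using sm by (intro borel_measurable_times) auto
      show "integrable lebesgue (\<lambda>x. indicator (cbox a b) x *\<^sub>R H x)"
        using Hloc compact_cbox by (simp add: locally_integrable_def set_integrable_def)
      show "AE x in lebesgue. (\<lambda>n. indicator (box a b) x * smoothing n w x) \<longlonglongrightarrow> indicator (box a b) x * l x"
        using lim by eventually_elim (intro tendsto_mult_left)
      show "AE x in lebesgue. norm (indicator (box a b) x * smoothing n w x) \<le> indicator (cbox a b) x *\<^sub>R H x" for n
        using bd
      proof eventually_elim
        case (elim x)
        then show ?case using H0[of x] box_subset_cbox[of a b] by (auto simp: indicator_def)
      qed
    qed
    with box_integral_smoothing_tendsto[OF loc w2, of a b]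
    have eq: "(\<integral>x. indicator (box a b) x * l x \<partial>lebesgue) = (\<integral>x. indicator (box a b) x * w x \<partial>lebesgue)"
      using LIMSEQ_unique by blast
    have int: "integrable lebesgue (\<lambda>x. indicator (box a b) x * v x)" if "locally_integrable v" for v :: "'a \<Rightarrow> real"
    proof -
      have "set_integrable lebesgue (cbox a b) v" using that compact_cbox by (auto simp: locally_integrable_def)
      then have "set_integrable lebesgue (box a b) v"
        by (rule set_integrable_subset) (auto simp: box_subset_cbox)
      then show ?thesis by (simp add: set_integrable_def)
    qed
    have "(\<integral>x. indicator (box a b) x * (l x + - 1 *\<^sub>R w x) \<partial>lebesgue) =
       (\<integral>x. indicator (box a b) x * l x - indicator (box a b) x * w x \<partial>lebesgue)"
      by (simp add: algebra_simps)
    then show "(\<integral>x. indicator (box a b) x * (l x + - 1 *\<^sub>R w x) \<partial>lebesgue) = 0"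
      using Bochner_Integration.integral_diff[OF int[OF lloc] int[OF loc]] eq by simp
  qed
  with lim show ?thesis by eventually_elim simp
qed

text \<open>This takes the place of the Sobolev embedding and of Rellich's theorem; the condition on \<open>s\<close>
  says that \<open>s\<close> is below the critical exponent.\<close>

lemma smoothing_approximation:
  fixes E s :: real
  assumes s: "2 \<le> s" and E: "0 \<le> E"
    and sub: "(real DIM('a::euclidean_space) - 2) * (s - 2) < 4"
  obtains c :: "nat \<Rightarrow> real" where "c \<longlonglongrightarrow> 0" "\<And>n. 0 \<le> c n"
    "\<And>(w::'a \<Rightarrow> real) n. w \<in> H1 \<Longrightarrow>
       (\<integral>\<^sup>+y. ennreal ((norm (weak_gradient w y))\<^sup>2) \<partial>lebesgue) \<le> ennreal E \<Longrightarrow>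
       (\<integral>\<^sup>+x. ennreal (\<bar>w x - smoothing n w x\<bar> powr s) \<partial>lebesgue) \<le> ennreal (c n)"
proof -
  define \<gamma> where "\<gamma> = 2 - (real DIM('a) - 2) * (s - 2) / 2"
  have \<gamma>: "0 < \<gamma>" using sub by (simp add: \<gamma>_def)
  obtain C \<rho> where C: "0 \<le> C" "0 < \<rho>" "\<rho> < 1"
    "\<And>(w::'a \<Rightarrow> real) n. w \<in> H1 \<Longrightarrow>
       (\<integral>\<^sup>+y. ennreal ((norm (weak_gradient w y))\<^sup>2) \<partial>lebesgue) \<le> ennreal E \<Longrightarrow>
       (\<integral>\<^sup>+x. (\<Sum>j. ennreal ((\<bar>smoothing (n + j) w x - smoothing (n + Suc j) w x\<bar> / \<rho> ^ j) powr s)) \<partial>lebesgue) \<le>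
         ennreal (C * ((1 / 2) powr \<gamma>) ^ n)"
    unfolding \<gamma>_def by (fact smoothing_tail_bound[OF s E \<gamma>[unfolded \<gamma>_def]])
  define M where "M = (1 / (1 - \<rho>)) powr s"
  define c where "c n = M * (C * ((1 / 2) powr \<gamma>) ^ n)" for n
  show thesis
  proof (rule that)
    have "(1 / 2 :: real) powr \<gamma> < 1" using \<gamma> by (simp add: powr01_less_one)
    then have "c \<longlonglongrightarrow> M * (C * 0)" unfolding c_def
      by (intro tendsto_mult_left LIMSEQ_realpow_zero) auto
    then show "c \<longlonglongrightarrow> 0" by simp
    show "0 \<le> c n" for n using C by (simp add: c_def M_def)
    fix w :: "'a \<Rightarrow> real" and n
    assume w: "w \<in> H1" "(\<integral>\<^sup>+y. ennreal ((norm (weak_gradient w y))\<^sup>2) \<partial>lebesgue) \<le> ennreal E"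
    have wm: "w \<in> borel_measurable lebesgue" using H1_weak_gradient(3)[OF w(1)] by (auto simp: mem_Lp_2)
    note sm = smoothing_measurable[OF wm]
    define T where "T x = (\<Sum>j. ennreal ((\<bar>smoothing (n + j) w x - smoothing (n + Suc j) w x\<bar> / \<rho> ^ j) powr s))" for x
    have Tm: "T \<in> borel_measurable lebesgue" unfolding T_def[abs_def] using sm by auto
    have le: "AE x in lebesgue. ennreal (\<bar>w x - smoothing n w x\<bar> powr s) \<le> ennreal M * T x"
      using smoothing_tendsto_AE[OF w(1)]
    proof eventually_elim
      case (elim x)
      show ?case
      proof (cases "T x = \<infinity>")
        case True
        \<comment> \<open>Positivity matters here: in \<open>ennreal\<close> the product of 0 and
          infinity is 0.\<close>
        have "0 < M" using C by (simp add: M_def)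
        then show ?thesis by (simp add: True ennreal_mult_top)
      next
        case False
        define t where "t = enn2real (T x)"
        have t: "0 \<le> t" "T x = ennreal t" using False by (auto simp: t_def less_top)
        have le: "(\<Sum>j. ennreal ((\<bar>smoothing (n + j) w x - smoothing (n + Suc j) w x\<bar> / \<rho> ^ j) powr s)) \<le> ennreal t"
          using t by (simp add: T_def)
        have b: "\<bar>smoothing (n + k) w x - smoothing (n + 0) w x\<bar> \<le> t powr (1 / s) / (1 - \<rho>)" for k
          by (rule telescoping_powr(1)[where a = "\<lambda>j. smoothing (n + j) w x", OF _ C(2,3) t(1) le])
             (use s in simp)
        have "(\<lambda>k. smoothing (k + n) w x) \<longlonglongrightarrow> w x" using elim by (rule LIMSEQ_ignore_initial_segment)
        then have "(\<lambda>k. \<bar>smoothing (n + k) w x - smoothing (n + 0) w x\<bar>) \<longlonglongrightarrow> \<bar>w x - smoothing (n + 0) w x\<bar>"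
          by (intro tendsto_intros) (simp add: add.commute)
        then have "\<bar>w x - smoothing (n + 0) w x\<bar> \<le> t powr (1 / s) / (1 - \<rho>)"
          by (rule Lim_bounded[where M = 0]) (use b in blast)
        then have "\<bar>w x - smoothing n w x\<bar> \<le> t powr (1 / s) / (1 - \<rho>)" by simp
        then have "\<bar>w x - smoothing n w x\<bar> powr s \<le> (1 / (1 - \<rho>) * t powr (1 / s)) powr s"
          using s by (intro powr_mono2) auto
        also have "\<dots> = M * t"
          unfolding powr_mult powr_powr M_def using s t(1) by (simp add: powr_one)
        finally show ?thesis using t by (simp add: ennreal_mult'[symmetric] ennreal_leI M_def)
      qed
    qed
    have "(\<integral>\<^sup>+x. ennreal (\<bar>w x - smoothing n w x\<bar> powr s) \<partial>lebesgue) \<le> (\<integral>\<^sup>+x. ennreal M * T x \<partial>lebesgue)"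
      by (rule nn_integral_mono_AE[OF le])
    also have "\<dots> = ennreal M * (\<integral>\<^sup>+x. T x \<partial>lebesgue)" by (rule nn_integral_cmult[OF Tm])
    also have "\<dots> \<le> ennreal M * ennreal (C * ((1 / 2) powr \<gamma>) ^ n)"
      unfolding T_def by (intro mult_left_mono C(4) w) simp
    also have "\<dots> = ennreal (c n)" by (simp add: c_def ennreal_mult'[symmetric] M_def)
    finally show "(\<integral>\<^sup>+x. ennreal (\<bar>w x - smoothing n w x\<bar> powr s) \<partial>lebesgue) \<le> ennreal (c n)" .
  qed
qed

section \<open>Domination of the weighted kernel by powers of |x - y|, |x| and |y|, and the bound
  for the form\<close>

section \<open>The doubly weighted kernel\<close>

text \<open>A crude weighted inequality of arithmetic and geometric means: every base is at most the
  sum, and the exponents add up to 1.\<close>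

lemma prod_powr_le_sum:
  fixes a b c :: real
  assumes "0 \<le> a" "0 \<le> b" "0 \<le> c" "0 \<le> p" "0 \<le> q" "0 \<le> r" "p + q + r = 1"
  shows "a powr p * b powr q * c powr r \<le> a + b + c"
proof -
  define M where "M = a + b + c"
  have M: "0 \<le> M" "a \<le> M" "b \<le> M" "c \<le> M" using assms by (auto simp: M_def)
  have "a powr p * b powr q * c powr r \<le> M powr p * M powr q * M powr r"
    using assms M by (intro mult_mono powr_mono2) auto
  also have "\<dots> = M powr (p + q + r)" by (simp add: powr_add)
  also have "\<dots> = M" using M assms by simp
  finally show ?thesis by (simp add: M_def)
qed

text \<open>Pointwise form of Young's convolution inequality, with 2 / t + 1 / m = 2 for m = t / (2
  (t - 1)). Each summand on the right omits one of the three functions and so integrates to a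
  product of two integrals. The weight 2 / t - 1 of the first summand is nonnegative because t is at
  most 2.\<close>

lemma trilinear_young:
  fixes u v k t :: real
  assumes "0 \<le> u" "0 \<le> v" "0 \<le> k" and t: "1 < t" "t \<le> 2"
  shows "u * v * k \<le> u powr t * v powr t + u powr t * k powr (t / (2 * (t - 1))) + v powr t * k powr (t / (2 * (t - 1)))"
proof (cases "u = 0 \<or> v = 0 \<or> k = 0")
  case True
  then show ?thesis by auto
next
  case False
  with assms have pos: "0 < u" "0 < v" "0 < k" by auto
  define m where "m = t / (2 * (t - 1))"
  have "1 - 1 / t = (t - 1) / t" using t by (simp add: field_simps)
  then have "m * (1 - 1 / t) = 1 / 2" using t by (simp add: m_def)
  then have ex1: "m * (1 - 1 / t) + m * (1 - 1 / t) = 1" by linarith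
  have ex2: "t * (2 / t - 1) + t * (1 - 1 / t) = 1" using t by (simp add: right_diff_distrib)
  have "(u powr t * v powr t) powr (2 / t - 1) * (u powr t * k powr m) powr (1 - 1 / t) * (v powr t * k powr m) powr (1 - 1 / t)
     \<le> u powr t * v powr t + u powr t * k powr m + v powr t * k powr m"
    by (rule prod_powr_le_sum) (use t in \<open>auto simp: field_simps\<close>)
  also have "(u powr t * v powr t) powr (2 / t - 1) * (u powr t * k powr m) powr (1 - 1 / t) * (v powr t * k powr m) powr (1 - 1 / t)
     = (u powr (t * (2 / t - 1)) * u powr (t * (1 - 1 / t))) * (v powr (t * (2 / t - 1)) * v powr (t * (1 - 1 / t))) *
       (k powr (m * (1 - 1 / t)) * k powr (m * (1 - 1 / t)))"
    by (simp only: powr_mult powr_powr mult_ac)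
  also have "\<dots> = u * v * k"
    unfolding powr_add[symmetric] ex1 ex2 using pos by simp
  finally show ?thesis unfolding m_def .
qed

lemma bilinear_young:
  fixes u h t :: real
  assumes "0 \<le> u" "0 \<le> h" and t: "1 < t"
  shows "u * h \<le> u powr t + h powr (t / (t - 1))"
proof (cases "u = 0 \<or> h = 0")
  case True
  then show ?thesis by auto
next
  case False
  with assms have pos: "0 < u" "0 < h" by auto
  define M where "M = u powr t + h powr (t / (t - 1))"
  have M: "0 \<le> M" "u powr t \<le> M" "h powr (t / (t - 1)) \<le> M" by (auto simp: M_def)
  have e: "t * (1 / t) = 1" "t / (t - 1) * (1 - 1 / t) = 1" using t by (auto simp: field_simps)
  have "u * h = (u powr t) powr (1 / t) * (h powr (t / (t - 1))) powr (1 - 1 / t)"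
    unfolding powr_powr e using pos by simp
  also have "\<dots> \<le> M powr (1 / t) * M powr (1 - 1 / t)"
    using M t by (intro mult_mono powr_mono2) auto
  also have "\<dots> = M" using M by (subst powr_add[symmetric]) simp
  finally show ?thesis by (simp add: M_def)
qed

text \<open>If Z is at least Y / 2, the factor in Z is absorbed by Y, and X <= Y allows half of
  \<mu> to be shifted to X, which gives the symmetric product. Otherwise Z is the smallest of the
  three and absorbs everything. Both results have total degree -(2 \<alpha> + \<mu>).\<close>

lemma weight_bound_ordered:
  fixes X Y Z \<alpha> \<mu> :: real
  assumes pos: "0 < X" "0 < Y" "0 < Z" and XY: "X \<le> Y" and Z: "Y - X \<le> Z" and \<alpha>: "0 \<le> \<alpha>" and \<mu>: "0 \<le> \<mu>"
  shows "1 / (X powr \<alpha> * Z powr \<mu> * Y powr \<alpha>) \<le>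
    2 powr \<mu> * (Z powr (- (2 * \<alpha> + \<mu>)) + X powr (- ((2 * \<alpha> + \<mu>) / 2)) * Y powr (- ((2 * \<alpha> + \<mu>) / 2)))"
proof -
  have K: "1 / (X powr \<alpha> * Z powr \<mu> * Y powr \<alpha>) = X powr (- \<alpha>) * Z powr (- \<mu>) * Y powr (- \<alpha>)"
    by (simp add: powr_minus field_simps)
  show ?thesis
  proof (cases "Y / 2 \<le> Z")
    case True
    have "Z powr (- \<mu>) \<le> (Y / 2) powr (- \<mu>)" using pos True \<mu> by (intro powr_mono2') auto
    also have "\<dots> = 2 powr \<mu> * Y powr (- \<mu>)" using pos by (simp add: powr_divide powr_minus field_simps)
    finally have 1: "Z powr (- \<mu>) \<le> 2 powr \<mu> * Y powr (- \<mu>)" .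
    have 2: "X powr (\<mu> / 2) \<le> Y powr (\<mu> / 2)" using pos XY \<mu> by (intro powr_mono2) auto
    have "X powr (- \<alpha>) * Z powr (- \<mu>) * Y powr (- \<alpha>) \<le> X powr (- \<alpha>) * (2 powr \<mu> * Y powr (- \<mu>)) * Y powr (- \<alpha>)"
      by (intro mult_right_mono mult_left_mono 1) auto
    also have "\<dots> = 2 powr \<mu> * (X powr (\<mu> / 2) * X powr (- ((2 * \<alpha> + \<mu>) / 2))) * (Y powr (- (\<mu> / 2)) * Y powr (- ((2 * \<alpha> + \<mu>) / 2)))"
    proof -
      have "X powr (\<mu> / 2) * X powr (- ((2 * \<alpha> + \<mu>) / 2)) = X powr (- \<alpha>)"
        by (subst powr_add[symmetric]) (simp add: field_simps)
      moreover have "Y powr (- (\<mu> / 2)) * Y powr (- ((2 * \<alpha> + \<mu>) / 2)) = Y powr (- \<mu>) * Y powr (- \<alpha>)"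
        unfolding powr_add[symmetric] by (rule arg_cong[where f = "(powr) Y"]) (simp add: field_simps)
      ultimately show ?thesis by (simp only: mult_ac)
    qed
    also have "\<dots> \<le> 2 powr \<mu> * (Y powr (\<mu> / 2) * X powr (- ((2 * \<alpha> + \<mu>) / 2))) * (Y powr (- (\<mu> / 2)) * Y powr (- ((2 * \<alpha> + \<mu>) / 2)))"
      by (intro mult_right_mono mult_left_mono 2) auto
    also have "\<dots> = 2 powr \<mu> * (X powr (- ((2 * \<alpha> + \<mu>) / 2)) * Y powr (- ((2 * \<alpha> + \<mu>) / 2))) * (Y powr (\<mu> / 2) * Y powr (- (\<mu> / 2)))"
      by (simp only: mult_ac)
    also have "Y powr (\<mu> / 2) * Y powr (- (\<mu> / 2)) = 1" using pos by (simp add: powr_minus)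
    finally have "X powr (- \<alpha>) * Z powr (- \<mu>) * Y powr (- \<alpha>) \<le>
       2 powr \<mu> * (X powr (- ((2 * \<alpha> + \<mu>) / 2)) * Y powr (- ((2 * \<alpha> + \<mu>) / 2)))" by simp
    also have "\<dots> \<le> 2 powr \<mu> * (Z powr (- (2 * \<alpha> + \<mu>)) + X powr (- ((2 * \<alpha> + \<mu>) / 2)) * Y powr (- ((2 * \<alpha> + \<mu>) / 2)))"
      by (intro mult_left_mono) auto
    finally show ?thesis unfolding K .
  next
    case False
    \<comment> \<open>Here X >= Y - Z > Y / 2 > Z.\<close>
    with Z have "Z \<le> X" "Z \<le> Y" using XY by auto
    then have "X powr (- \<alpha>) \<le> Z powr (- \<alpha>)" "Y powr (- \<alpha>) \<le> Z powr (- \<alpha>)"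
      using pos \<alpha> by (auto intro!: powr_mono2')
    then have "X powr (- \<alpha>) * Z powr (- \<mu>) * Y powr (- \<alpha>) \<le> Z powr (- \<alpha>) * Z powr (- \<mu>) * Z powr (- \<alpha>)"
      by (intro mult_mono) auto
    also have "\<dots> = Z powr (- (2 * \<alpha> + \<mu>))"
      unfolding powr_add[symmetric] by (rule arg_cong[where f = "(powr) Z"]) simp
    also have "\<dots> \<le> 1 * (Z powr (- (2 * \<alpha> + \<mu>)) + X powr (- ((2 * \<alpha> + \<mu>) / 2)) * Y powr (- ((2 * \<alpha> + \<mu>) / 2)))" by simp
    also have "\<dots> \<le> 2 powr \<mu> * (Z powr (- (2 * \<alpha> + \<mu>)) + X powr (- ((2 * \<alpha> + \<mu>) / 2)) * Y powr (- ((2 * \<alpha> + \<mu>) / 2)))"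
      using \<mu> by (intro mult_right_mono) (auto simp: ge_one_powr_ge_zero)
    finally show ?thesis unfolding K .
  qed
qed

lemma weight_bound:
  fixes x y :: "'a::euclidean_space"
  assumes \<alpha>: "0 \<le> \<alpha>" and \<mu>: "0 \<le> \<mu>"
  shows "1 / (norm x powr \<alpha> * norm (x - y) powr \<mu> * norm y powr \<alpha>) \<le>
    2 powr \<mu> * (norm (x - y) powr (- (2 * \<alpha> + \<mu>)) +
      norm x powr (- ((2 * \<alpha> + \<mu>) / 2)) * norm y powr (- ((2 * \<alpha> + \<mu>) / 2)))"
proof (cases "x = 0 \<or> y = 0 \<or> x = y")
  case True
  \<comment> \<open>On the singular set the quotient is 0, as division by 0 yields 0, and only the
    sign of the right side matters.\<close>
  then have W: "norm x powr \<alpha> * norm (x - y) powr \<mu> * norm y powr \<alpha> = 0" by auto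
  show ?thesis unfolding W div_by_0 by (intro mult_nonneg_nonneg add_nonneg_nonneg) auto
next
  case False
  then have pos: "0 < norm x" "0 < norm y" "0 < norm (x - y)" by auto
  have tri: "norm y - norm x \<le> norm (x - y)" "norm x - norm y \<le> norm (x - y)"
    using norm_triangle_ineq2[of y x] norm_triangle_ineq2[of x y] by (auto simp: norm_minus_commute)
  show ?thesis
  proof (cases "norm x \<le> norm y")
    case True
    show ?thesis by (rule weight_bound_ordered[OF pos True tri(1) \<alpha> \<mu>])
  next
    case False
    then have "norm y \<le> norm x" by simp
    from weight_bound_ordered[OF pos(2,1,3) this tri(2) \<alpha> \<mu>]
    show ?thesis by (simp only: mult_ac)
  qed
qed

text \<open>Common core for the neighbourhood of the origin (c = 1 / 2) and of infinity (c = 2). The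
  set is covered by shells of outer radius c^j; each is enlarged to its ball and contributes a
  multiple of c^(j (N - a)), a geometric series.\<close>

lemma nn_integral_norm_powr_finite:
  fixes S :: "'a::euclidean_space set"
  assumes c: "0 < c" "c powr (real DIM('a) - a) < 1" and a: "0 \<le> a"
    and S: "\<And>z. z \<in> S \<Longrightarrow> z \<noteq> 0 \<Longrightarrow> \<exists>j::nat. c ^ j / 2 \<le> norm z \<and> norm z \<le> c ^ j"
  shows "(\<integral>\<^sup>+z. ennreal (indicator S z * norm z powr (- a)) \<partial>lborel) < \<infinity>"
proof -
  define V where "V = unit_ball_vol (real DIM('a))"
  have V: "0 \<le> V" by (simp add: V_def)
  define r where "r = c powr (real DIM('a) - a)"
  have r: "0 \<le> r" "r < 1" using c by (auto simp: r_def)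
  have pt: "ennreal (indicator S z * norm z powr (- a)) \<le>
      (\<Sum>j. ennreal ((c ^ j / 2) powr (- a)) * indicator (cball 0 (c ^ j)) z)" for z :: 'a
  proof (cases "z \<in> S \<and> z \<noteq> 0")
    case True
    then obtain j where j: "c ^ j / 2 \<le> norm z" "norm z \<le> c ^ j" using S by blast
    define D where "D j = ennreal ((c ^ j / 2) powr (- a)) * indicator (cball 0 (c ^ j)) z" for j
    have "ennreal (indicator S z * norm z powr (- a)) \<le> ennreal ((c ^ j / 2) powr (- a))"
      using True j c a by (intro ennreal_leI) (auto intro!: powr_mono2')
    also have "\<dots> = D j" using j by (simp add: D_def)
    also have "\<dots> \<le> (\<Sum>j. D j)" using sum_le_suminf[of D "{j}"] by simp
    finally show ?thesis by (simp add: D_def)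
  next
    \<comment> \<open>The origin contributes nothing, because 0 powr any exponent is 0.\<close>
    case False
    then show ?thesis by auto
  qed
  have "(\<integral>\<^sup>+z. ennreal (indicator S z * norm z powr (- a)) \<partial>lborel) \<le>
      (\<integral>\<^sup>+z. (\<Sum>j. ennreal ((c ^ j / 2) powr (- a)) * indicator (cball (0::'a) (c ^ j)) z) \<partial>lborel)"
    by (rule nn_integral_mono) (rule pt)
  also have "\<dots> = (\<Sum>j. ennreal ((c ^ j / 2) powr (- a)) * emeasure lborel (cball (0::'a) (c ^ j)))"
  proof -
    define G where "G j z = ennreal ((c ^ j / 2) powr (- a)) * indicator (cball (0::'a) (c ^ j)) z" for j z
    have G: "G j \<in> borel_measurable lborel" for j
      unfolding G_def[abs_def]
      by (intro borel_measurable_times_ennreal borel_measurable_const borel_measurable_indicator) simp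
    have "(\<integral>\<^sup>+z. (\<Sum>j. G j z) \<partial>lborel) = (\<Sum>j. (\<integral>\<^sup>+z. G j z \<partial>lborel))"
      by (rule nn_integral_suminf[OF G])
    moreover have "(\<integral>\<^sup>+z. G j z \<partial>lborel) = ennreal ((c ^ j / 2) powr (- a)) * emeasure lborel (cball (0::'a) (c ^ j))" for j
      unfolding G_def by (rule nn_integral_cmult_indicator) simp
    ultimately show ?thesis unfolding G_def by (simp only:)
  qed
  also have "\<dots> = (\<Sum>j. ennreal (2 powr a * V * r ^ j))"
  proof (intro suminf_cong)
    fix j
    have "emeasure lborel (cball (0::'a) (c ^ j)) = ennreal (V * (c ^ j) ^ DIM('a))"
      using c by (simp add: emeasure_cball V_def)
    then have "ennreal ((c ^ j / 2) powr (- a)) * emeasure lborel (cball (0::'a) (c ^ j)) =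
        ennreal ((c ^ j / 2) powr (- a) * (V * (c ^ j) ^ DIM('a)))" by (simp add: ennreal_mult')
    also have "(c ^ j / 2) powr (- a) * (V * (c ^ j) ^ DIM('a)) = 2 powr a * V * r ^ j"
    proof -
      have "(c ^ j / 2) powr (- a) = 2 powr a * (c ^ j) powr (- a)"
        using c by (simp add: powr_divide powr_minus field_simps)
      moreover have "(c ^ j) ^ DIM('a) = (c ^ j) powr real DIM('a)" using c by (simp add: powr_realpow)
      moreover have "(c ^ j) powr (- a) * (c ^ j) powr real DIM('a) = r ^ j"
      proof -
        have "(c ^ j) powr (- a) * (c ^ j) powr real DIM('a) = (c ^ j) powr (real DIM('a) - a)"
          by (subst powr_add[symmetric]) simp
        also have "\<dots> = (c powr real j) powr (real DIM('a) - a)" using c by (simp add: powr_realpow)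
        also have "\<dots> = r powr real j" unfolding r_def by (simp only: powr_powr mult.commute)
        also have "\<dots> = r ^ j" using c by (intro powr_realpow) (simp add: r_def)
        finally show ?thesis .
      qed
      ultimately show ?thesis by (simp only: mult_ac)
    qed
    finally show "ennreal ((c ^ j / 2) powr (- a)) * emeasure lborel (cball (0::'a) (c ^ j)) = ennreal (2 powr a * V * r ^ j)" .
  qed
  also have "\<dots> = ennreal (\<Sum>j. 2 powr a * V * r ^ j)"
    using r V by (intro suminf_ennreal2 summable_mult summable_geometric) auto
  also have "\<dots> < \<infinity>" by simp
  finally show ?thesis .
qed

lemma nn_integral_norm_powr_inside:
  assumes a: "0 \<le> a" "a < real DIM('a::euclidean_space)"
  shows "(\<integral>\<^sup>+z. ennreal (indicator {z::'a. norm z \<le> 1} z * norm z powr (- a)) \<partial>lborel) < \<infinity>"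
proof (rule nn_integral_norm_powr_finite[of "1 / 2"])
  show "(1 / 2 :: real) powr (real DIM('a) - a) < 1" using a by (simp add: powr01_less_one)
  fix z :: 'a assume z: "z \<in> {z. norm z \<le> 1}" "z \<noteq> 0"
  then obtain n where "(1 / 2 :: real) ^ n < norm z" using real_arch_pow_inv[of "norm z" "1 / 2"] by auto
  define n where "n = (LEAST n. (1 / 2 :: real) ^ n < norm z)"
  have n: "(1 / 2 :: real) ^ n < norm z" unfolding n_def by (rule LeastI) fact
  have "n \<noteq> 0" using n z by (intro notI) simp
  then obtain j where j: "n = Suc j" by (cases n) auto
  have "\<not> (1 / 2 :: real) ^ j < norm z" using not_less_Least[of j "\<lambda>n. (1 / 2 :: real) ^ n < norm z"] j by (auto simp: n_def)
  with n j show "\<exists>j. (1 / 2) ^ j / 2 \<le> norm z \<and> norm z \<le> (1 / 2) ^ j" by (intro exI[of _ j]) auto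
qed (use a in auto)

lemma nn_integral_norm_powr_outside:
  assumes a: "real DIM('a::euclidean_space) < a"
  shows "(\<integral>\<^sup>+z. ennreal (indicator {z::'a. 1 < norm z} z * norm z powr (- a)) \<partial>lborel) < \<infinity>"
proof (rule nn_integral_norm_powr_finite[of 2])
  show "(2 :: real) powr (real DIM('a) - a) < 1" using a by (simp add: powr_less_one)
  fix z :: 'a assume z: "z \<in> {z. 1 < norm z}" "z \<noteq> 0"
  obtain n where "norm z < (2 :: real) ^ n" using real_arch_pow[of 2 "norm z"] by auto
  define n where "n = (LEAST n. norm z < (2 :: real) ^ n)"
  have n: "norm z < (2 :: real) ^ n" unfolding n_def by (rule LeastI) fact
  have "n \<noteq> 0" using n z by (intro notI) simp
  then obtain j where j: "n = Suc j" by (cases n) auto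
  have "\<not> norm z < (2 :: real) ^ j" using not_less_Least[of j "\<lambda>n. norm z < (2 :: real) ^ n"] j by (auto simp: n_def)
  \<comment> \<open>The index names the outer radius of the shell: here it is \<open>n\<close>
    itself, near the origin it is n - 1.\<close>
  with n j show "\<exists>j. 2 ^ j / 2 \<le> norm z \<and> norm z \<le> 2 ^ j" by (intro exI[of _ "Suc j"]) auto
qed (use a in auto)

text \<open>The polarised form of \<open>double_integral\<close>, in \<open>ennreal\<close>:
  additivity and the change of the order of integration need only measurability and signs.\<close>

definition weighted_form :: "real \<Rightarrow> real \<Rightarrow> ('a::euclidean_space \<Rightarrow> real) \<Rightarrow> ('a \<Rightarrow> real) \<Rightarrow> ennreal" where
  "weighted_form \<alpha> \<mu> f g = (\<integral>\<^sup>+y. (\<integral>\<^sup>+x. ennreal ((f x * g y) /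
      (norm x powr \<alpha> * norm (x - y) powr \<mu> * norm y powr \<alpha>)) \<partial>lebesgue) \<partial>lebesgue)"

lemma weighted_integrand_measurable:
  fixes f g :: "'a::euclidean_space \<Rightarrow> real"
  assumes "f \<in> borel_measurable lebesgue" "g \<in> borel_measurable lebesgue"
  shows "(\<lambda>z::'a \<times> 'a. (f (fst z) * g (snd z)) /
      (norm (fst z) powr \<alpha> * norm (fst z - snd z) powr \<mu> * norm (snd z) powr \<alpha>))
    \<in> borel_measurable (lebesgue \<Otimes>\<^sub>M lebesgue)"
proof -
  have n: "(norm :: 'a \<Rightarrow> real) \<in> borel_measurable lebesgue"
    by (rule borel_measurable_lebesgueI) simp
  note n1 = lebesgue_pair_measurable_comp(2)[OF n] and n2 = lebesgue_pair_measurable_comp(1)[OF n]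
  note d = measurable_compose[OF borel_measurable_lebesgue_pair_diff borel_measurable_norm]
  note f = lebesgue_pair_measurable_comp(2)[OF assms(1)] and g = lebesgue_pair_measurable_comp(1)[OF assms(2)]
  have powr: "(\<lambda>z. h z powr c) \<in> borel_measurable (lebesgue \<Otimes>\<^sub>M lebesgue)"
    if "h \<in> borel_measurable (lebesgue \<Otimes>\<^sub>M lebesgue)" for h :: "'a \<times> 'a \<Rightarrow> real" and c
    using that by measurable
  show ?thesis
    by (rule borel_measurable_divide[OF borel_measurable_times[OF f g] borel_measurable_times[OF
        borel_measurable_times[OF powr[OF n1] powr[OF d]] powr[OF n2]]])
qed

lemma nn_integral_translate:
  fixes k :: "'a::euclidean_space \<Rightarrow> ennreal"
  assumes k: "k \<in> borel_measurable borel"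
  shows "(\<integral>\<^sup>+x. k (x - y) \<partial>lebesgue) = (\<integral>\<^sup>+x. k x \<partial>lborel)"
proof -
  have "(\<integral>\<^sup>+x. k x \<partial>lborel) = (\<integral>\<^sup>+x. k x \<partial>distr lborel borel ((+) (- y)))"
    by (simp add: lborel_distr_plus)
  also have "\<dots> = (\<integral>\<^sup>+x. k (- y + x) \<partial>lborel)" using k by (intro nn_integral_distr) auto
  finally show ?thesis by (simp add: nn_integral_completion)
qed

text \<open>\<open>t1\<close> is used away from the singularity and \<open>t2\<close> near it: the
  power of the kernel that Young's inequality produces has degree above the dimension for
  \<open>t1\<close> and below it for \<open>t2\<close>, hence is integrable on the respective
  region. \<kappa> collects the two kernel integrals; it is added because Young's inequality is not
  homogeneous.\<close>

lemma weighted_form_bound: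
  fixes \<alpha> \<mu> t1 t2 :: real
  assumes \<alpha>: "0 \<le> \<alpha>" and \<mu>: "0 < \<mu>"
    and t: "1 < t1" "t1 \<le> 2" "1 < t2" "t2 \<le> 2"
    and a1: "real DIM('a::euclidean_space) < (2 * \<alpha> + \<mu>) * (t1 / (2 * (t1 - 1)))"
    and a2: "(2 * \<alpha> + \<mu>) * (t2 / (2 * (t2 - 1))) < real DIM('a)"
  obtains \<kappa> where "0 \<le> \<kappa>"
    "\<And>f g :: 'a \<Rightarrow> real. f \<in> borel_measurable lebesgue \<Longrightarrow> g \<in> borel_measurable lebesgue \<Longrightarrow>
      (\<And>x. 0 \<le> f x) \<Longrightarrow> (\<And>x. 0 \<le> g x) \<Longrightarrow>
      weighted_form \<alpha> \<mu> f g \<le> ennreal (2 * 2 powr \<mu>) *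
        (((\<integral>\<^sup>+x. ennreal (f x powr t1) \<partial>lebesgue) + (\<integral>\<^sup>+x. ennreal (f x powr t2) \<partial>lebesgue) + ennreal \<kappa>) *
         ((\<integral>\<^sup>+x. ennreal (g x powr t1) \<partial>lebesgue) + (\<integral>\<^sup>+x. ennreal (g x powr t2) \<partial>lebesgue) + ennreal \<kappa>))"
proof -
  define l where "l = 2 * \<alpha> + \<mu>"
  have l: "0 < l" using \<alpha> \<mu> by (simp add: l_def)
  define m1 where "m1 = t1 / (2 * (t1 - 1))"
  define m2 where "m2 = t2 / (2 * (t2 - 1))"
  have m: "0 < m1" "0 < m2" using t by (auto simp: m1_def m2_def)
  define k1 where "k1 z = indicator {z::'a. 1 < norm z} z * norm z powr (- (l * m1))" for z
  define k2 where "k2 z = indicator {z::'a. norm z \<le> 1} z * norm z powr (- (l * m2))" for z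
  have k0: "0 \<le> k1 z" "0 \<le> k2 z" for z by (auto simp: k1_def k2_def)
  have km: "k1 \<in> borel_measurable borel" "k2 \<in> borel_measurable borel"
    unfolding k1_def[abs_def] k2_def[abs_def] by measurable
  define \<kappa>1 where "\<kappa>1 = (\<integral>\<^sup>+z. ennreal (k1 z) \<partial>lborel)"
  define \<kappa>2 where "\<kappa>2 = (\<integral>\<^sup>+z. ennreal (k2 z) \<partial>lborel)"
  have \<kappa>fin: "\<kappa>1 < \<infinity>" "\<kappa>2 < \<infinity>"
    unfolding \<kappa>1_def \<kappa>2_def k1_def k2_def
    using a1 a2 mult_pos_pos[OF l m(2)]
    by (auto simp only: l_def[symmetric] m1_def[symmetric] m2_def[symmetric] less_imp_le
        intro!: nn_integral_norm_powr_outside nn_integral_norm_powr_inside)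
  define \<kappa> where "\<kappa> = enn2real (\<kappa>1 + \<kappa>2)"
  have \<kappa>: "0 \<le> \<kappa>" "ennreal \<kappa> = \<kappa>1 + \<kappa>2" using \<kappa>fin by (auto simp: \<kappa>_def less_top)
  have pointwise: "(u * v) / (norm x powr \<alpha> * norm (x - y) powr \<mu> * norm y powr \<alpha>) \<le> 2 powr \<mu> *
     (((u powr t1 * v powr t1 + u powr t1 * k1 (x - y) + v powr t1 * k1 (x - y)) +
      (u powr t2 * v powr t2 + u powr t2 * k2 (x - y) + v powr t2 * k2 (x - y))) +
      (u powr t1 + u powr t2 + k1 x + k2 x) * (v powr t1 + v powr t2 + k1 y + k2 y))"
    if uv: "0 \<le> u" "0 \<le> v" for u v and x y :: 'a
  proof -
    have A: "u * v * norm z powr (- l) \<le>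
        (u powr t1 * v powr t1 + u powr t1 * k1 z + v powr t1 * k1 z) +
        (u powr t2 * v powr t2 + u powr t2 * k2 z + v powr t2 * k2 z)" for z :: 'a
    proof (cases "norm z \<le> 1")
      case True
      have "u * v * norm z powr (- l) \<le> u powr t2 * v powr t2 + u powr t2 * k2 z + v powr t2 * k2 z"
        using trilinear_young[OF uv _ t(3,4), of "norm z powr (- l)"] True
        by (simp add: k2_def powr_powr m2_def)
      moreover have "0 \<le> u powr t1 * v powr t1 + u powr t1 * k1 z + v powr t1 * k1 z" by (simp add: k0)
      ultimately show ?thesis by linarith
    next
      case False
      have "u * v * norm z powr (- l) \<le> u powr t1 * v powr t1 + u powr t1 * k1 z + v powr t1 * k1 z"
        using trilinear_young[OF uv _ t(1,2), of "norm z powr (- l)"] False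
        by (simp add: k1_def powr_powr m1_def)
      moreover have "0 \<le> u powr t2 * v powr t2 + u powr t2 * k2 z + v powr t2 * k2 z" by (simp add: k0)
      ultimately show ?thesis by linarith
    qed
    \<comment> \<open>The product weight is treated in each variable separately. As (l / 2) t / (t -
      1) equals l t / (2 (t - 1)), the same functions \<open>k1\<close> and \<open>k2\<close>
      arise.\<close>
    have B: "u * norm z powr (- (l / 2)) \<le> u powr t1 + u powr t2 + k1 z + k2 z" if "0 \<le> u" for u and z :: 'a
    proof (cases "norm z \<le> 1")
      case True
      have "u * norm z powr (- (l / 2)) \<le> u powr t2 + (norm z powr (- (l / 2))) powr (t2 / (t2 - 1))"
        by (rule bilinear_young[OF that _ t(3)]) simp
      also have "(norm z powr (- (l / 2))) powr (t2 / (t2 - 1)) = k2 z"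
      proof -
        have "- (l / 2) * (t2 / (t2 - 1)) = - (l * m2)" by (simp add: m2_def)
        then show ?thesis using True by (simp only: powr_powr k2_def) simp
      qed
      finally have "u * norm z powr (- (l / 2)) \<le> u powr t2 + k2 z" .
      moreover have "0 \<le> u powr t1" by simp
      ultimately show ?thesis using k0(1)[of z] by linarith
    next
      case False
      have "u * norm z powr (- (l / 2)) \<le> u powr t1 + (norm z powr (- (l / 2))) powr (t1 / (t1 - 1))"
        by (rule bilinear_young[OF that _ t(1)]) simp
      also have "(norm z powr (- (l / 2))) powr (t1 / (t1 - 1)) = k1 z"
      proof -
        have "- (l / 2) * (t1 / (t1 - 1)) = - (l * m1)" by (simp add: m1_def)
        then show ?thesis using False by (simp only: powr_powr k1_def) simp
      qed
      finally have "u * norm z powr (- (l / 2)) \<le> u powr t1 + k1 z" .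
      moreover have "0 \<le> u powr t2" by simp
      ultimately show ?thesis using k0(2)[of z] by linarith
    qed
    have "(u * v) / (norm x powr \<alpha> * norm (x - y) powr \<mu> * norm y powr \<alpha>) =
        (u * v) * (1 / (norm x powr \<alpha> * norm (x - y) powr \<mu> * norm y powr \<alpha>))" by simp
    also have "\<dots> \<le> (u * v) * (2 powr \<mu> * (norm (x - y) powr (- l) + norm x powr (- (l / 2)) * norm y powr (- (l / 2))))"
      unfolding l_def using uv \<alpha> \<mu> by (intro mult_left_mono weight_bound) auto
    also have "\<dots> = 2 powr \<mu> * (u * v * norm (x - y) powr (- l) + (u * norm x powr (- (l / 2))) * (v * norm y powr (- (l / 2))))"
      by (simp add: algebra_simps)
    also have "\<dots> \<le> 2 powr \<mu> *
     (((u powr t1 * v powr t1 + u powr t1 * k1 (x - y) + v powr t1 * k1 (x - y)) +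
      (u powr t2 * v powr t2 + u powr t2 * k2 (x - y) + v powr t2 * k2 (x - y))) +
      (u powr t1 + u powr t2 + k1 x + k2 x) * (v powr t1 + v powr t2 + k1 y + k2 y))"
      using uv by (intro mult_left_mono add_mono A mult_mono B) (auto simp: k0)
    finally show ?thesis .
  qed
  show thesis
  proof (rule that[OF \<kappa>(1)])
    fix f g :: "'a \<Rightarrow> real"
    assume fm: "f \<in> borel_measurable lebesgue" and gm: "g \<in> borel_measurable lebesgue"
      and f0: "\<And>x. 0 \<le> f x" and g0: "\<And>x. 0 \<le> g x"
    define F1 where "F1 x = ennreal (f x powr t1)" for x
    define F2 where "F2 x = ennreal (f x powr t2)" for x
    define G1 where "G1 x = ennreal (g x powr t1)" for x
    define G2 where "G2 x = ennreal (g x powr t2)" for x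
    define K1 where "K1 z = ennreal (k1 z)" for z
    define K2 where "K2 z = ennreal (k2 z)" for z
    define A1 where "A1 = (\<integral>\<^sup>+x. F1 x \<partial>lebesgue)"
    define A2 where "A2 = (\<integral>\<^sup>+x. F2 x \<partial>lebesgue)"
    define B1 where "B1 = (\<integral>\<^sup>+x. G1 x \<partial>lebesgue)"
    define B2 where "B2 = (\<integral>\<^sup>+x. G2 x \<partial>lebesgue)"
    have m: "F1 \<in> borel_measurable lebesgue" "F2 \<in> borel_measurable lebesgue"
      "G1 \<in> borel_measurable lebesgue" "G2 \<in> borel_measurable lebesgue"
      unfolding F1_def[abs_def] F2_def[abs_def] G1_def[abs_def] G2_def[abs_def] using fm gm by auto
    have Km: "K1 \<in> borel_measurable borel" "K2 \<in> borel_measurable borel"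
      unfolding K1_def[abs_def] K2_def[abs_def] using km by auto
    note Kl = Km[THEN borel_measurable_lebesgueI]
    have Kdm: "(\<lambda>x. K (x - y)) \<in> borel_measurable lebesgue" if "K \<in> borel_measurable borel"
      for K :: "'a \<Rightarrow> ennreal" and y
      by (rule borel_measurable_lebesgueI, rule measurable_compose[OF _ that]) simp
    have KI: "(\<integral>\<^sup>+x. K1 (x - y) \<partial>lebesgue) = \<kappa>1" "(\<integral>\<^sup>+x. K2 (x - y) \<partial>lebesgue) = \<kappa>2"
      "(\<integral>\<^sup>+x. K1 x \<partial>lebesgue) = \<kappa>1" "(\<integral>\<^sup>+x. K2 x \<partial>lebesgue) = \<kappa>2" for y
      using nn_integral_translate[OF Km(1), of y] nn_integral_translate[OF Km(2), of y]
      by (simp_all add: \<kappa>1_def \<kappa>2_def K1_def K2_def nn_integral_completion)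
    have even: "K1 (x - y) = K1 (y - x)" "K2 (x - y) = K2 (y - x)" for x y
      by (auto simp: K1_def K2_def k1_def k2_def norm_minus_commute[of x y] indicator_def)
    define P where "P x = F1 x + F2 x + K1 x + K2 x" for x
    define Q where "Q x = G1 x + G2 x + K1 x + K2 x" for x
    have PQm: "P \<in> borel_measurable lebesgue" "Q \<in> borel_measurable lebesgue"
      unfolding P_def[abs_def] Q_def[abs_def] using m Kl by auto
    have PI: "(\<integral>\<^sup>+x. P x \<partial>lebesgue) = A1 + A2 + \<kappa>1 + \<kappa>2" "(\<integral>\<^sup>+x. Q x \<partial>lebesgue) = B1 + B2 + \<kappa>1 + \<kappa>2"
      unfolding P_def Q_def using m Kl by (simp_all add: nn_integral_add KI A1_def A2_def B1_def B2_def)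
    define D where "D x y = ((F1 x * G1 y + F1 x * K1 (x - y) + G1 y * K1 (x - y)) +
      (F2 x * G2 y + F2 x * K2 (x - y) + G2 y * K2 (x - y))) + P x * Q y" for x y
    have le: "ennreal ((f x * g y) / (norm x powr \<alpha> * norm (x - y) powr \<mu> * norm y powr \<alpha>)) \<le> ennreal (2 powr \<mu>) * D x y" for x y
    proof -
      have "ennreal ((f x * g y) / (norm x powr \<alpha> * norm (x - y) powr \<mu> * norm y powr \<alpha>)) \<le>
        ennreal (2 powr \<mu> * (((f x powr t1 * g y powr t1 + f x powr t1 * k1 (x - y) + g y powr t1 * k1 (x - y)) +
      (f x powr t2 * g y powr t2 + f x powr t2 * k2 (x - y) + g y powr t2 * k2 (x - y))) +
      (f x powr t1 + f x powr t2 + k1 x + k2 x) * (g y powr t1 + g y powr t2 + k1 y + k2 y)))"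
        by (intro ennreal_leI pointwise f0 g0)
      also have "\<dots> = ennreal (2 powr \<mu>) * D x y"
        by (simp add: D_def P_def Q_def F1_def F2_def G1_def G2_def K1_def K2_def ennreal_mult' ennreal_plus k0)
      finally show ?thesis .
    qed
    define c1 where "c1 y = (\<integral>\<^sup>+x. F1 x * K1 (x - y) \<partial>lebesgue)" for y
    define c2 where "c2 y = (\<integral>\<^sup>+x. F2 x * K2 (x - y) \<partial>lebesgue)" for y
    have conv: "(\<lambda>y. \<integral>\<^sup>+x. F x * K (x - y) \<partial>lebesgue) \<in> borel_measurable lebesgue"
       "(\<integral>\<^sup>+y. (\<integral>\<^sup>+x. F x * K (x - y) \<partial>lebesgue) \<partial>lebesgue) = (\<integral>\<^sup>+x. F x \<partial>lebesgue) * (\<integral>\<^sup>+x. K x \<partial>lborel)"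
      if F: "F \<in> borel_measurable lebesgue" and K: "K \<in> borel_measurable borel" and e: "\<And>x y. K (x - y) = K (y - x)"
      for F K :: "'a \<Rightarrow> ennreal"
    proof -
      have pm: "(\<lambda>z::'a \<times> 'a. F (fst z) * K (fst z - snd z)) \<in> borel_measurable (lebesgue \<Otimes>\<^sub>M lebesgue)"
        by (intro borel_measurable_times_ennreal lebesgue_pair_measurable_comp(2) F
            measurable_compose[OF borel_measurable_lebesgue_pair_diff K])
      have pm': "(\<lambda>z::'a \<times> 'a. F (snd z) * K (snd z - fst z)) \<in> borel_measurable (lebesgue \<Otimes>\<^sub>M lebesgue)"
        unfolding e[of "snd _" "fst _"]
        by (intro borel_measurable_times_ennreal lebesgue_pair_measurable_comp(1) F
            measurable_compose[OF borel_measurable_lebesgue_pair_diff K])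
      show "(\<lambda>y. \<integral>\<^sup>+x. F x * K (x - y) \<partial>lebesgue) \<in> borel_measurable lebesgue"
        using lebesgue.borel_measurable_nn_integral_fst[OF pm'] by simp
      have "(\<integral>\<^sup>+y. (\<integral>\<^sup>+x. F x * K (x - y) \<partial>lebesgue) \<partial>lebesgue) = (\<integral>\<^sup>+x. (\<integral>\<^sup>+y. F x * K (x - y) \<partial>lebesgue) \<partial>lebesgue)"
        using lebesgue_pair.Fubini[OF pm] by simp
      also have "\<dots> = (\<integral>\<^sup>+x. F x * (\<integral>\<^sup>+x. K x \<partial>lborel) \<partial>lebesgue)"
      proof (intro nn_integral_cong)
        fix x
        have "(\<integral>\<^sup>+y. F x * K (x - y) \<partial>lebesgue) = F x * (\<integral>\<^sup>+y. K (y - x) \<partial>lebesgue)"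
          unfolding e[of x] using Kdm[OF K] by (intro nn_integral_cmult)
        then show "(\<integral>\<^sup>+y. F x * K (x - y) \<partial>lebesgue) = F x * (\<integral>\<^sup>+x. K x \<partial>lborel)"
          by (simp add: nn_integral_translate[OF K])
      qed
      also have "\<dots> = (\<integral>\<^sup>+x. F x \<partial>lebesgue) * (\<integral>\<^sup>+x. K x \<partial>lborel)" by (intro nn_integral_multc F)
      finally show "(\<integral>\<^sup>+y. (\<integral>\<^sup>+x. F x * K (x - y) \<partial>lebesgue) \<partial>lebesgue) = (\<integral>\<^sup>+x. F x \<partial>lebesgue) * (\<integral>\<^sup>+x. K x \<partial>lborel)" .
    qed
    have cm: "c1 \<in> borel_measurable lebesgue" "c2 \<in> borel_measurable lebesgue"
      unfolding c1_def[abs_def] c2_def[abs_def] using conv(1) m Km even by auto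
    have cI: "(\<integral>\<^sup>+y. c1 y \<partial>lebesgue) = A1 * \<kappa>1" "(\<integral>\<^sup>+y. c2 y \<partial>lebesgue) = A2 * \<kappa>2"
      unfolding c1_def c2_def
      using conv(2)[OF m(1) Km(1) even(1)] conv(2)[OF m(2) Km(2) even(2)]
      by (simp_all add: A1_def A2_def \<kappa>1_def \<kappa>2_def K1_def K2_def)
    have inner: "(\<integral>\<^sup>+x. D x y \<partial>lebesgue) = ((A1 * G1 y + c1 y + G1 y * \<kappa>1) + (A2 * G2 y + c2 y + G2 y * \<kappa>2)) +
        (A1 + A2 + \<kappa>1 + \<kappa>2) * Q y" for y
      unfolding D_def c1_def c2_def using m Kdm[OF Km(1), of y] Kdm[OF Km(2), of y] PQm
      by (simp add: nn_integral_add nn_integral_cmult nn_integral_multc KI PI A1_def A2_def)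
    have "weighted_form \<alpha> \<mu> f g \<le> (\<integral>\<^sup>+y. (\<integral>\<^sup>+x. ennreal (2 powr \<mu>) * D x y \<partial>lebesgue) \<partial>lebesgue)"
      unfolding weighted_form_def by (intro nn_integral_mono le)
    also have "\<dots> = (\<integral>\<^sup>+y. ennreal (2 powr \<mu>) * (\<integral>\<^sup>+x. D x y \<partial>lebesgue) \<partial>lebesgue)"
      unfolding D_def using m Kdm[OF Km(1)] Kdm[OF Km(2)] PQm
      by (intro nn_integral_cong nn_integral_cmult) auto
    also have "\<dots> = ennreal (2 powr \<mu>) * ((A1 * B1 + A1 * \<kappa>1 + B1 * \<kappa>1) + (A2 * B2 + A2 * \<kappa>2 + B2 * \<kappa>2) +
        (A1 + A2 + \<kappa>1 + \<kappa>2) * (B1 + B2 + \<kappa>1 + \<kappa>2))"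
      unfolding inner using m cm PQm
      by (simp add: nn_integral_add nn_integral_cmult nn_integral_multc cI PI B1_def B2_def)
    also have "\<dots> \<le> ennreal (2 powr \<mu>) * ((A1 + A2 + \<kappa>1 + \<kappa>2) * (B1 + B2 + \<kappa>1 + \<kappa>2) +
        (A1 + A2 + \<kappa>1 + \<kappa>2) * (B1 + B2 + \<kappa>1 + \<kappa>2))"
    proof (intro mult_left_mono add_right_mono)
      have "(A1 + A2 + \<kappa>1 + \<kappa>2) * (B1 + B2 + \<kappa>1 + \<kappa>2) =
         ((A1 * B1 + A1 * \<kappa>1 + B1 * \<kappa>1) + (A2 * B2 + A2 * \<kappa>2 + B2 * \<kappa>2)) +
         (\<kappa>1 * \<kappa>1 + \<kappa>2 * \<kappa>2 + A1 * B2 + A2 * B1 + A1 * \<kappa>2 + A2 * \<kappa>1 + \<kappa>1 * B2 + \<kappa>2 * B1 + \<kappa>1 * \<kappa>2 + \<kappa>2 * \<kappa>1)"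
        by (simp add: algebra_simps)
      then show "(A1 * B1 + A1 * \<kappa>1 + B1 * \<kappa>1) + (A2 * B2 + A2 * \<kappa>2 + B2 * \<kappa>2) \<le>
         (A1 + A2 + \<kappa>1 + \<kappa>2) * (B1 + B2 + \<kappa>1 + \<kappa>2)"
        by (metis le_iff_add)
    qed simp
    also have "\<dots> = ennreal (2 * 2 powr \<mu>) * ((A1 + A2 + ennreal \<kappa>) * (B1 + B2 + ennreal \<kappa>))"
    proof -
      have "ennreal (2 * 2 powr \<mu>) = ennreal (2 powr \<mu>) * 2" by (simp add: ennreal_mult' mult.commute)
      then show ?thesis unfolding \<kappa>(2) by (simp only: mult_2[symmetric] mult.assoc add.assoc)
    qed
    finally show "weighted_form \<alpha> \<mu> f g \<le> ennreal (2 * 2 powr \<mu>) *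
        (((\<integral>\<^sup>+x. ennreal (f x powr t1) \<partial>lebesgue) + (\<integral>\<^sup>+x. ennreal (f x powr t2) \<partial>lebesgue) + ennreal \<kappa>) *
         ((\<integral>\<^sup>+x. ennreal (g x powr t1) \<partial>lebesgue) + (\<integral>\<^sup>+x. ennreal (g x powr t2) \<partial>lebesgue) + ennreal \<kappa>))"
      by (simp only: A1_def A2_def B1_def B2_def F1_def F2_def G1_def G2_def)
  qed
qed

section \<open>Decay of b|z_k|^p in L^t for weakly null sequences in H1\<close>

section \<open>Compactness of the weighted powers\<close>

lemma young_scaled:
  fixes \<theta> \<delta> :: real
  assumes \<theta>: "0 < \<theta>" "\<theta> < 1" and \<delta>: "0 < \<delta>"
  obtains C where "0 < C" "\<And>X Y. 0 \<le> X \<Longrightarrow> 0 \<le> Y \<Longrightarrow> X powr \<theta> * Y powr (1 - \<theta>) \<le> C * X + \<delta> * Y"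
proof -
  \<comment> \<open>Chosen so that C^\<theta> \<delta>^(1 - \<theta>) = 1; inserting the two
    constants does not change the product.\<close>
  define C where "C = \<delta> powr (- (1 - \<theta>) / \<theta>)"
  have C: "0 < C" using \<delta> by (simp add: C_def)
  have one: "C powr \<theta> * \<delta> powr (1 - \<theta>) = 1"
  proof -
    have "C powr \<theta> = \<delta> powr (- (1 - \<theta>))" using \<theta> by (simp add: C_def powr_powr)
    then have "C powr \<theta> * \<delta> powr (1 - \<theta>) = \<delta> powr (- (1 - \<theta>) + (1 - \<theta>))" by (simp only: powr_add)
    then show ?thesis using \<delta> by simp
  qed
  show thesis
  proof (rule that[OF C])
    fix X Y :: real assume XY: "0 \<le> X" "0 \<le> Y"
    define M where "M = C * X + \<delta> * Y"
    have M: "0 \<le> M" "C * X \<le> M" "\<delta> * Y \<le> M" using C \<delta> XY by (auto simp: M_def)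
    have "X powr \<theta> * Y powr (1 - \<theta>) = (C powr \<theta> * \<delta> powr (1 - \<theta>)) * (X powr \<theta> * Y powr (1 - \<theta>))"
      unfolding one by simp
    also have "\<dots> = (C * X) powr \<theta> * (\<delta> * Y) powr (1 - \<theta>)" by (simp only: powr_mult mult_ac)
    also have "\<dots> \<le> M powr \<theta> * M powr (1 - \<theta>)"
      using M \<theta> C \<delta> XY by (intro mult_mono powr_mono2) auto
    also have "\<dots> = M" using M by (subst powr_add[symmetric]) simp
    finally show "X powr \<theta> * Y powr (1 - \<theta>) \<le> C * X + \<delta> * Y" by (simp add: M_def)
  qed
qed

lemma ennreal_tendsto_0_iff_eventually_le:
  fixes f :: "nat \<Rightarrow> ennreal"
  assumes "\<And>e. 0 < e \<Longrightarrow> \<forall>\<^sub>F k in sequentially. f k \<le> ennreal e"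
  shows "f \<longlonglongrightarrow> 0"
proof (rule order_tendstoI)
  fix a :: ennreal assume "0 < a"
  then obtain e where e: "0 < e" "ennreal e < a"
    by (metis dense ennreal_cases ennreal_less_iff ennreal_0 less_le order.strict_iff_not zero_le top.extremum_strict not_less_zero le_less_trans ennreal_neg linorder_not_less)
  show "\<forall>\<^sub>F k in sequentially. f k < a"
    using assms[OF e(1)] by eventually_elim (use e(2) in auto)
qed simp

text \<open>The relation \<open>e\<close> is the exponent balance of Hoelder's inequality: it makes
  the t-th power a weighted geometric mean of b^\<sigma> and v^s, to which Young's inequality
  applies.\<close>

lemma powr_factor:
  fixes b v p t \<sigma> s :: real
  assumes "0 \<le> b" "0 \<le> v" and t: "0 < t" and \<sigma>: "0 < \<sigma>" and s: "0 < s" and e: "t / \<sigma> + p * t / s = 1"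
  shows "(b * v powr p) powr t = (b powr \<sigma>) powr (t / \<sigma>) * (v powr s) powr (1 - t / \<sigma>)"
proof -
  have "s * (1 - t / \<sigma>) = p * t" using e s by (simp add: field_simps)
  then show ?thesis using \<sigma> by (simp add: powr_mult powr_powr)
qed

text \<open>The truncated integrands \<open>(b |z\<^sub>k|\<^sup>p)\<^sup>t - \<delta> |z\<^sub>k|\<^sup>s\<close> are dominated by a multiple of
  \<open>b\<^sup>\<sigma>\<close> through Young's inequality, although the integrands themselves are not dominated.\<close>

lemma weighted_power_vanishing:
  fixes z :: "nat \<Rightarrow> 'a::euclidean_space \<Rightarrow> real" and b :: "'a \<Rightarrow> real"
  assumes bm: "b \<in> borel_measurable lebesgue" and b0: "\<And>x. 0 \<le> b x"
    and bI: "(\<integral>\<^sup>+x. ennreal (b x powr \<sigma>) \<partial>lebesgue) < \<infinity>"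
    and t: "0 < t" "t < \<sigma>" and p: "0 < p" and s: "0 < s" and e: "t / \<sigma> + p * t / s = 1"
    and zm: "\<And>k. z k \<in> borel_measurable lebesgue"
    and z0: "\<And>x. (\<lambda>k. z k x) \<longlonglongrightarrow> 0"
    and M: "\<And>k. (\<integral>\<^sup>+x. ennreal (\<bar>z k x\<bar> powr s) \<partial>lebesgue) \<le> ennreal M"
  shows "(\<lambda>k. \<integral>\<^sup>+x. ennreal ((b x * \<bar>z k x\<bar> powr p) powr t) \<partial>lebesgue) \<longlonglongrightarrow> 0"
proof (rule ennreal_tendsto_0_iff_eventually_le)
  fix \<epsilon> :: real assume \<epsilon>: "0 < \<epsilon>"
  \<comment> \<open>Keeps \<delta> * M at most \<epsilon> / 2; the expression |M| + 1 avoids any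
    case distinction on M.\<close>
  define \<delta> where "\<delta> = \<epsilon> / (2 * (\<bar>M\<bar> + 1))"
  have \<delta>: "0 < \<delta>" using \<epsilon> by (simp add: \<delta>_def)
  have \<delta>M: "\<delta> * M \<le> \<epsilon> / 2"
  proof -
    have "\<delta> * M \<le> \<delta> * (\<bar>M\<bar> + 1)" using \<delta> by (intro mult_left_mono) auto
    also have "\<dots> = \<epsilon> / 2" by (simp add: \<delta>_def field_simps)
    finally show ?thesis .
  qed
  obtain C where C: "0 < C" "\<And>X Y. 0 \<le> X \<Longrightarrow> 0 \<le> Y \<Longrightarrow> X powr (t / \<sigma>) * Y powr (1 - t / \<sigma>) \<le> C * X + \<delta> * Y"
    using young_scaled[of "t / \<sigma>" \<delta>] t \<delta> by auto
  define h where "h k x = (b x * \<bar>z k x\<bar> powr p) powr t" for k x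
  define g where "g k x = max 0 (h k x - \<delta> * \<bar>z k x\<bar> powr s)" for k x
  have hm: "h k \<in> borel_measurable lebesgue" for k unfolding h_def[abs_def] using bm zm by auto
  have gm: "g k \<in> borel_measurable lebesgue" for k unfolding g_def[abs_def] using hm zm by auto
  have hle: "h k x \<le> C * b x powr \<sigma> + \<delta> * \<bar>z k x\<bar> powr s" for k x
    unfolding h_def powr_factor[OF b0 abs_ge_zero t(1) less_trans[OF t] s e] by (rule C(2)) auto
  have gle: "g k x \<le> C * b x powr \<sigma>" for k x
    using hle[of k x] C(1) by (simp add: g_def)
  have "(\<lambda>k. \<integral>\<^sup>+x. ennreal (g k x) \<partial>lebesgue) \<longlonglongrightarrow> (\<integral>\<^sup>+x. 0 \<partial>(lebesgue :: 'a measure))"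
  proof (rule nn_integral_dominated_convergence[where w = "\<lambda>x. ennreal (C * b x powr \<sigma>)"])
    show "(\<lambda>x. ennreal (g k x)) \<in> borel_measurable lebesgue" for k using gm by auto
    show "(\<lambda>x. ennreal (C * b x powr \<sigma>)) \<in> borel_measurable lebesgue" using bm by auto
    show "AE x in lebesgue. ennreal (g k x) \<le> ennreal (C * b x powr \<sigma>)" for k
      by (intro AE_I2 ennreal_leI gle)
    have "(\<integral>\<^sup>+x. ennreal (C * b x powr \<sigma>) \<partial>lebesgue) = ennreal C * (\<integral>\<^sup>+x. ennreal (b x powr \<sigma>) \<partial>lebesgue)"
      using bm C(1) by (simp add: ennreal_mult' nn_integral_cmult)
    then show "(\<integral>\<^sup>+x. ennreal (C * b x powr \<sigma>) \<partial>lebesgue) < \<infinity>"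
      using bI by (simp add: ennreal_mult_less_top)
    show "AE x in lebesgue. (\<lambda>k. ennreal (g k x)) \<longlonglongrightarrow> 0"
    proof (intro AE_I2)
      fix x
      have "(\<lambda>k. \<bar>z k x\<bar> powr p) \<longlonglongrightarrow> 0 powr p" "(\<lambda>k. \<bar>z k x\<bar> powr s) \<longlonglongrightarrow> 0 powr s"
        using tendsto_powr2[OF tendsto_rabs_zero[OF z0[of x]] tendsto_const, of p]
          tendsto_powr2[OF tendsto_rabs_zero[OF z0[of x]] tendsto_const, of s] p s by auto
      moreover from tendsto_mult_left[OF this(1), of "b x"]
      have "(\<lambda>k. h k x) \<longlonglongrightarrow> (b x * 0 powr p) powr t"
        unfolding h_def using t b0 by (intro tendsto_powr2 tendsto_const) (auto simp: b0)
      ultimately have "(\<lambda>k. g k x) \<longlonglongrightarrow> max 0 ((b x * 0 powr p) powr t - \<delta> * 0 powr s)"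
        unfolding g_def by (intro tendsto_max tendsto_diff tendsto_mult_left tendsto_const)
      then have "(\<lambda>k. g k x) \<longlonglongrightarrow> 0" by simp
      then show "(\<lambda>k. ennreal (g k x)) \<longlonglongrightarrow> 0" using tendsto_ennrealI by fastforce
    qed
  qed auto
  then have "\<forall>\<^sub>F k in sequentially. (\<integral>\<^sup>+x. ennreal (g k x) \<partial>lebesgue) < ennreal (\<epsilon> / 2)"
    using \<epsilon> by (intro order_tendstoD(2)) auto
  then show "\<forall>\<^sub>F k in sequentially. (\<integral>\<^sup>+x. ennreal ((b x * \<bar>z k x\<bar> powr p) powr t) \<partial>lebesgue) \<le> ennreal \<epsilon>"
  proof eventually_elim
    case (elim k)
    have "(\<integral>\<^sup>+x. ennreal (h k x) \<partial>lebesgue) \<le> (\<integral>\<^sup>+x. ennreal (g k x) + ennreal \<delta> * ennreal (\<bar>z k x\<bar> powr s) \<partial>lebesgue)"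
    proof (rule nn_integral_mono)
      fix x
      have "ennreal (h k x) \<le> ennreal (g k x + \<delta> * \<bar>z k x\<bar> powr s)" by (intro ennreal_leI) (simp add: g_def)
      also have "\<dots> = ennreal (g k x) + ennreal \<delta> * ennreal (\<bar>z k x\<bar> powr s)"
        using \<delta> by (simp add: ennreal_plus g_def ennreal_mult')
      finally show "ennreal (h k x) \<le> ennreal (g k x) + ennreal \<delta> * ennreal (\<bar>z k x\<bar> powr s)" .
    qed
    also have "\<dots> = (\<integral>\<^sup>+x. ennreal (g k x) \<partial>lebesgue) + ennreal \<delta> * (\<integral>\<^sup>+x. ennreal (\<bar>z k x\<bar> powr s) \<partial>lebesgue)"
      using gm zm by (subst nn_integral_add) (auto simp: nn_integral_cmult)
    also have "\<dots> \<le> ennreal (\<epsilon> / 2) + ennreal \<delta> * ennreal M"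
      using elim by (intro add_mono mult_left_mono M) auto
    also have "ennreal \<delta> * ennreal M = ennreal (\<delta> * M)" using \<delta> by (simp add: ennreal_mult')
    also have "ennreal (\<epsilon> / 2) + ennreal (\<delta> * M) \<le> ennreal (\<epsilon> / 2) + ennreal (\<epsilon> / 2)"
      by (intro add_left_mono ennreal_leI \<delta>M)
    also have "\<dots> = ennreal \<epsilon>" using \<epsilon> by (subst ennreal_plus[symmetric]) auto
    finally show ?case by (simp add: h_def)
  qed
qed

lemma powr_add_le:
  fixes a b p :: real
  assumes "0 \<le> a" "0 \<le> b" "0 \<le> p"
  shows "(a + b) powr p \<le> 2 powr p * (a powr p + b powr p)"
proof -
  have "(a + b) powr p \<le> (2 * max a b) powr p" using assms by (intro powr_mono2) auto
  also have "\<dots> = 2 powr p * max a b powr p" by (simp add: powr_mult)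
  also have "\<dots> \<le> 2 powr p * (a powr p + b powr p)" by (intro mult_left_mono) (auto simp: max_def)
  finally show ?thesis .
qed

lemma weighted_power_add_le:
  fixes b v z p t :: real
  assumes "0 \<le> b" "0 \<le> p" "0 \<le> t"
  shows "(b * \<bar>v + z\<bar> powr p) powr t \<le>
    2 powr (p * t) * ((b * \<bar>v\<bar> powr p) powr t + (b * \<bar>z\<bar> powr p) powr t)"
proof -
  have "(b * \<bar>v + z\<bar> powr p) powr t = b powr t * \<bar>v + z\<bar> powr (p * t)" by (simp add: powr_mult powr_powr)
  also have "\<dots> \<le> b powr t * (2 powr (p * t) * (\<bar>v\<bar> powr (p * t) + \<bar>z\<bar> powr (p * t)))"
  proof (rule mult_left_mono)
    have "\<bar>v + z\<bar> powr (p * t) \<le> (\<bar>v\<bar> + \<bar>z\<bar>) powr (p * t)" using assms by (intro powr_mono2) auto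
    also have "\<dots> \<le> 2 powr (p * t) * (\<bar>v\<bar> powr (p * t) + \<bar>z\<bar> powr (p * t))" using assms by (intro powr_add_le) auto
    finally show "\<bar>v + z\<bar> powr (p * t) \<le> 2 powr (p * t) * (\<bar>v\<bar> powr (p * t) + \<bar>z\<bar> powr (p * t))" .
  qed simp
  also have "\<dots> = 2 powr (p * t) * ((b * \<bar>v\<bar> powr p) powr t + (b * \<bar>z\<bar> powr p) powr t)"
    by (simp add: powr_mult powr_powr algebra_simps)
  finally show ?thesis .
qed

text \<open>Subcritical Sobolev embedding: the smoothing at scale 1 is in L^s by the bounds on cube
  averages of w, and the error is in L^s by the summation over the finer scales.\<close>

lemma H1_powr_integrable:
  fixes w :: "'a::euclidean_space \<Rightarrow> real"
  assumes w: "w \<in> H1" and s: "2 \<le> s" and sub: "(real DIM('a) - 2) * (s - 2) < 4"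
  shows "(\<integral>\<^sup>+x. ennreal (\<bar>w x\<bar> powr s) \<partial>lebesgue) < \<infinity>"
proof -
  define E where "E = (\<integral>y. (norm (weak_gradient w y))\<^sup>2 \<partial>lebesgue)"
  define E' where "E' = (\<integral>y. (w y)\<^sup>2 \<partial>lebesgue)"
  have E: "0 \<le> E" "0 \<le> E'" by (simp_all add: E_def E'_def)
  have wm: "w \<in> borel_measurable lebesgue" by (rule locally_integrable_measurable[OF H1_locally_integrable[OF w]])
  note sm = smoothing_measurable[OF wm, of 0]
  obtain c :: "nat \<Rightarrow> real" where c: "c \<longlonglongrightarrow> 0" "\<And>n. 0 \<le> c n"
    "\<And>(w::'a \<Rightarrow> real) n. w \<in> H1 \<Longrightarrow>
       (\<integral>\<^sup>+y. ennreal ((norm (weak_gradient w y))\<^sup>2) \<partial>lebesgue) \<le> ennreal E \<Longrightarrow>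
       (\<integral>\<^sup>+x. ennreal (\<bar>w x - smoothing n w x\<bar> powr s) \<partial>lebesgue) \<le> ennreal (c n)"
    by (fact smoothing_approximation[OF s E(1) sub])
  obtain C where C: "0 \<le> C"
    "\<And>(w::'a::euclidean_space \<Rightarrow> real) x. locally_integrable w \<Longrightarrow> (\<integral>\<^sup>+y. ennreal ((w y)\<^sup>2) \<partial>lebesgue) \<le> ennreal E' \<Longrightarrow>
       \<bar>smoothing 0 w x\<bar> \<le> C"
    "\<And>w::'a::euclidean_space \<Rightarrow> real. locally_integrable w \<Longrightarrow> (\<integral>\<^sup>+y. ennreal ((w y)\<^sup>2) \<partial>lebesgue) \<le> ennreal E' \<Longrightarrow>
       (\<integral>\<^sup>+x. ennreal (\<bar>smoothing 0 w x\<bar> powr s) \<partial>lebesgue) \<le> ennreal C"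
    by (fact smoothing_bound[OF s E(2)])
  have "(\<integral>\<^sup>+x. ennreal (\<bar>w x\<bar> powr s) \<partial>lebesgue) \<le>
      (\<integral>\<^sup>+x. ennreal (2 powr s) * (ennreal (\<bar>w x - smoothing 0 w x\<bar> powr s) + ennreal (\<bar>smoothing 0 w x\<bar> powr s)) \<partial>lebesgue)"
  proof (rule nn_integral_mono)
    fix x
    have "\<bar>w x\<bar> powr s \<le> (\<bar>w x - smoothing 0 w x\<bar> + \<bar>smoothing 0 w x\<bar>) powr s"
      using s by (intro powr_mono2) auto
    also have "\<dots> \<le> 2 powr s * (\<bar>w x - smoothing 0 w x\<bar> powr s + \<bar>smoothing 0 w x\<bar> powr s)"
      using s by (intro powr_add_le) auto
    finally have "ennreal (\<bar>w x\<bar> powr s) \<le> ennreal (2 powr s * (\<bar>w x - smoothing 0 w x\<bar> powr s + \<bar>smoothing 0 w x\<bar> powr s))"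
      by (rule ennreal_leI)
    then show "ennreal (\<bar>w x\<bar> powr s) \<le> ennreal (2 powr s) * (ennreal (\<bar>w x - smoothing 0 w x\<bar> powr s) + ennreal (\<bar>smoothing 0 w x\<bar> powr s))"
      by (simp add: ennreal_mult' ennreal_plus)
  qed
  also have "\<dots> = ennreal (2 powr s) * ((\<integral>\<^sup>+x. ennreal (\<bar>w x - smoothing 0 w x\<bar> powr s) \<partial>lebesgue) + (\<integral>\<^sup>+x. ennreal (\<bar>smoothing 0 w x\<bar> powr s) \<partial>lebesgue))"
    using wm sm by (subst nn_integral_cmult, simp, subst nn_integral_add) auto
  also have "\<dots> \<le> ennreal (2 powr s) * (ennreal (c 0) + ennreal C)"
    using H1_integrals_eq[OF w] by (intro mult_left_mono add_mono c C w H1_locally_integrable) (auto simp: E_def E'_def)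
  also have "\<dots> < \<infinity>" by (simp add: ennreal_mult_less_top)
  finally show ?thesis .
qed

lemma weighted_power_integrable:
  fixes w b :: "'a::euclidean_space \<Rightarrow> real"
  assumes bm: "b \<in> borel_measurable lebesgue" and b0: "\<And>x. 0 \<le> b x"
    and bI: "(\<integral>\<^sup>+x. ennreal (b x powr \<sigma>) \<partial>lebesgue) < \<infinity>"
    and t: "0 < t" "t < \<sigma>" and s: "2 \<le> s" and e: "t / \<sigma> + p * t / s = 1"
    and sub: "(real DIM('a) - 2) * (s - 2) < 4" and w: "w \<in> H1"
  shows "(\<integral>\<^sup>+x. ennreal ((b x * \<bar>w x\<bar> powr p) powr t) \<partial>lebesgue) < \<infinity>"
proof -
  have wm: "w \<in> borel_measurable lebesgue" by (rule locally_integrable_measurable[OF H1_locally_integrable[OF w]])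
  obtain C where C: "0 < C" "\<And>X Y. 0 \<le> X \<Longrightarrow> 0 \<le> Y \<Longrightarrow> X powr (t / \<sigma>) * Y powr (1 - t / \<sigma>) \<le> C * X + 1 * Y"
    using young_scaled[of "t / \<sigma>" 1] t by auto
  have s0: "0 < s" using s by simp
  have "(\<integral>\<^sup>+x. ennreal ((b x * \<bar>w x\<bar> powr p) powr t) \<partial>lebesgue) \<le>
      (\<integral>\<^sup>+x. ennreal C * ennreal (b x powr \<sigma>) + ennreal (\<bar>w x\<bar> powr s) \<partial>lebesgue)"
  proof (rule nn_integral_mono)
    fix x
    have "(b x * \<bar>w x\<bar> powr p) powr t \<le> C * b x powr \<sigma> + 1 * \<bar>w x\<bar> powr s"
      unfolding powr_factor[OF b0 abs_ge_zero t(1) less_trans[OF t] s0 e] by (rule C(2)) auto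
    then have "ennreal ((b x * \<bar>w x\<bar> powr p) powr t) \<le> ennreal (C * b x powr \<sigma> + 1 * \<bar>w x\<bar> powr s)"
      by (rule ennreal_leI)
    then show "ennreal ((b x * \<bar>w x\<bar> powr p) powr t) \<le> ennreal C * ennreal (b x powr \<sigma>) + ennreal (\<bar>w x\<bar> powr s)"
      using C(1) by (simp add: ennreal_plus ennreal_mult')
  qed
  also have "\<dots> = ennreal C * (\<integral>\<^sup>+x. ennreal (b x powr \<sigma>) \<partial>lebesgue) + (\<integral>\<^sup>+x. ennreal (\<bar>w x\<bar> powr s) \<partial>lebesgue)"
    using bm wm by (subst nn_integral_add) (auto simp: nn_integral_cmult)
  also have "\<dots> < \<infinity>" using bI H1_powr_integrable[OF w s sub] by (simp add: ennreal_mult_less_top)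
  finally show ?thesis .
qed

text \<open>The error of the smoothing is small uniformly in k once the scale is fine enough; at
  that fixed scale the smoothed sequence converges pointwise to 0 and stays bounded in L^s.\<close>

lemma weighted_power_compactness:
  fixes z :: "nat \<Rightarrow> 'a::euclidean_space \<Rightarrow> real" and b :: "'a \<Rightarrow> real"
  assumes bm: "b \<in> borel_measurable lebesgue" and b0: "\<And>x. 0 \<le> b x"
    and bI: "(\<integral>\<^sup>+x. ennreal (b x powr \<sigma>) \<partial>lebesgue) < \<infinity>"
    and t: "0 < t" "t < \<sigma>" and p: "0 < p" and s: "2 \<le> s" and e: "t / \<sigma> + p * t / s = 1"
    and sub: "(real DIM('a) - 2) * (s - 2) < 4"
    and z: "\<And>k. z k \<in> H1"
    and E: "0 \<le> E" "\<And>k. (\<integral>x. (z k x)\<^sup>2 \<partial>lebesgue) \<le> E" "\<And>k. (\<integral>x. (norm (weak_gradient (z k) x))\<^sup>2 \<partial>lebesgue) \<le> E"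
    and weak: "\<And>f. f \<in> Lp 2 \<Longrightarrow> (\<lambda>k. \<integral>x. f x * z k x \<partial>lebesgue) \<longlonglongrightarrow> 0"
  shows "(\<lambda>k. \<integral>\<^sup>+x. ennreal ((b x * \<bar>z k x\<bar> powr p) powr t) \<partial>lebesgue) \<longlonglongrightarrow> 0"
proof (rule ennreal_tendsto_0_iff_eventually_le)
  fix \<epsilon> :: real assume \<epsilon>: "0 < \<epsilon>"
  have s0: "0 < s" using s by simp
  have zm: "z k \<in> borel_measurable lebesgue" for k
    by (rule locally_integrable_measurable[OF H1_locally_integrable[OF z]])
  note sm = smoothing_measurable[OF zm]
  have zE: "(\<integral>\<^sup>+y. ennreal ((norm (weak_gradient (z k) y))\<^sup>2) \<partial>lebesgue) \<le> ennreal E"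
    "(\<integral>\<^sup>+y. ennreal ((z k y)\<^sup>2) \<partial>lebesgue) \<le> ennreal E" for k
    unfolding H1_integrals_eq[OF z] by (intro ennreal_leI E)+
  define B where "B = enn2real (\<integral>\<^sup>+x. ennreal (b x powr \<sigma>) \<partial>lebesgue)"
  have B: "0 \<le> B" "(\<integral>\<^sup>+x. ennreal (b x powr \<sigma>) \<partial>lebesgue) = ennreal B" using bI by (auto simp: B_def less_top)
  define q where "q = (2 :: real) powr (p * t)"
  have q: "0 < q" by (simp add: q_def)
  define \<delta> where "\<delta> = \<epsilon> / (3 * q * (B + 1))"
  have \<delta>: "0 < \<delta>" using \<epsilon> q B by (simp add: \<delta>_def)
  have \<delta>B: "q * (\<delta> * B) \<le> \<epsilon> / 3"
  proof -
    have "q * (\<delta> * B) \<le> q * (\<delta> * (B + 1))" using q \<delta> by (intro mult_left_mono) auto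
    also have "\<dots> = \<epsilon> / 3"
    proof -
      have "B + 1 \<noteq> 0" using B(1) by simp
      then show ?thesis using q by (simp add: \<delta>_def)
    qed
    finally show ?thesis .
  qed
  \<comment> \<open>The roles are opposite to those in \<open>weighted_power_vanishing\<close>: the
    small factor \<delta> goes to b^\<sigma>, whose integral is fixed, and the large one to |v|^s,
    whose integral is at most \<open>c n\<close>.\<close>
  have \<theta>: "0 < 1 - t / \<sigma>" "1 - t / \<sigma> < 1" using t by auto
  obtain C where C: "0 < C" "\<And>X Y. 0 \<le> X \<Longrightarrow> 0 \<le> Y \<Longrightarrow> X powr (1 - t / \<sigma>) * Y powr (1 - (1 - t / \<sigma>)) \<le> C * X + \<delta> * Y"
    using young_scaled[OF \<theta> \<delta>] by auto
  obtain c :: "nat \<Rightarrow> real" where c: "c \<longlonglongrightarrow> 0" "\<And>n. 0 \<le> c n"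
    "\<And>(w::'a \<Rightarrow> real) n. w \<in> H1 \<Longrightarrow>
       (\<integral>\<^sup>+y. ennreal ((norm (weak_gradient w y))\<^sup>2) \<partial>lebesgue) \<le> ennreal E \<Longrightarrow>
       (\<integral>\<^sup>+x. ennreal (\<bar>w x - smoothing n w x\<bar> powr s) \<partial>lebesgue) \<le> ennreal (c n)"
    by (fact smoothing_approximation[OF s E(1) sub])
  have "(\<lambda>n. q * (C * c n)) \<longlonglongrightarrow> q * (C * 0)" by (intro tendsto_mult_left c)
  then have "\<forall>\<^sub>F n in sequentially. q * (C * c n) < \<epsilon> / 3" using \<epsilon> by (intro order_tendstoD(2)) auto
  \<comment> \<open>The scale is fixed before k: the error bound holds for all k at once, whereas
    \<open>D\<close> may depend on this scale.\<close>
  then obtain n where n: "q * (C * c n) < \<epsilon> / 3" by (auto simp: eventually_sequentially)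
  obtain D where D: "0 \<le> D"
    "\<And>(w::'a::euclidean_space \<Rightarrow> real) x. locally_integrable w \<Longrightarrow> (\<integral>\<^sup>+y. ennreal ((w y)\<^sup>2) \<partial>lebesgue) \<le> ennreal E \<Longrightarrow>
       \<bar>smoothing n w x\<bar> \<le> D"
    "\<And>w::'a::euclidean_space \<Rightarrow> real. locally_integrable w \<Longrightarrow> (\<integral>\<^sup>+y. ennreal ((w y)\<^sup>2) \<partial>lebesgue) \<le> ennreal E \<Longrightarrow>
       (\<integral>\<^sup>+x. ennreal (\<bar>smoothing n w x\<bar> powr s) \<partial>lebesgue) \<le> ennreal D"
    by (fact smoothing_bound[OF s E(1)])
  have "(\<lambda>k. \<integral>\<^sup>+x. ennreal ((b x * \<bar>smoothing n (z k) x\<bar> powr p) powr t) \<partial>lebesgue) \<longlonglongrightarrow> 0"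
  proof (rule weighted_power_vanishing[OF bm b0 bI t p s0 e sm])
    show "(\<lambda>k. smoothing n (z k) x) \<longlonglongrightarrow> 0" for x
      unfolding smoothing_eq_integral by (rule weak[OF smoothing_kernel_Lp_2])
    show "(\<integral>\<^sup>+x. ennreal (\<bar>smoothing n (z k) x\<bar> powr s) \<partial>lebesgue) \<le> ennreal D" for k
      by (intro D H1_locally_integrable z zE)
  qed
  then have "\<forall>\<^sub>F k in sequentially.
      (\<integral>\<^sup>+x. ennreal ((b x * \<bar>smoothing n (z k) x\<bar> powr p) powr t) \<partial>lebesgue) < ennreal (\<epsilon> / (3 * q))"
    using \<epsilon> q by (intro order_tendstoD(2)) auto
  then show "\<forall>\<^sub>F k in sequentially. (\<integral>\<^sup>+x. ennreal ((b x * \<bar>z k x\<bar> powr p) powr t) \<partial>lebesgue) \<le> ennreal \<epsilon>"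
  proof eventually_elim
    case (elim k)
    define v where "v x = z k x - smoothing n (z k) x" for x
    define y where "y x = smoothing n (z k) x" for x
    have vm: "v \<in> borel_measurable lebesgue" and ym: "y \<in> borel_measurable lebesgue"
      unfolding v_def[abs_def] y_def[abs_def] using zm sm by auto
    have vle: "(b x * \<bar>v x\<bar> powr p) powr t \<le> C * \<bar>v x\<bar> powr s + \<delta> * b x powr \<sigma>" for x
    proof -
      have "(b x * \<bar>v x\<bar> powr p) powr t = (\<bar>v x\<bar> powr s) powr (1 - t / \<sigma>) * (b x powr \<sigma>) powr (1 - (1 - t / \<sigma>))"
        unfolding powr_factor[OF b0 abs_ge_zero t(1) less_trans[OF t] s0 e] by (simp add: mult.commute)
      also have "\<dots> \<le> C * \<bar>v x\<bar> powr s + \<delta> * b x powr \<sigma>" by (rule C(2)) auto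
      finally show ?thesis .
    qed
    have "(\<integral>\<^sup>+x. ennreal ((b x * \<bar>z k x\<bar> powr p) powr t) \<partial>lebesgue) \<le>
       (\<integral>\<^sup>+x. ennreal q * ((ennreal C * ennreal (\<bar>v x\<bar> powr s) + ennreal \<delta> * ennreal (b x powr \<sigma>)) +
           ennreal ((b x * \<bar>y x\<bar> powr p) powr t)) \<partial>lebesgue)"
    proof (rule nn_integral_mono)
      fix x
      have "(b x * \<bar>z k x\<bar> powr p) powr t \<le> q * ((b x * \<bar>v x\<bar> powr p) powr t + (b x * \<bar>y x\<bar> powr p) powr t)"
        using weighted_power_add_le[OF b0, of p t x "v x" "y x"] p t by (simp add: v_def y_def q_def)
      also have "\<dots> \<le> q * ((C * \<bar>v x\<bar> powr s + \<delta> * b x powr \<sigma>) + (b x * \<bar>y x\<bar> powr p) powr t)"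
        using q by (intro mult_left_mono add_right_mono vle) auto
      finally have "ennreal ((b x * \<bar>z k x\<bar> powr p) powr t) \<le>
          ennreal (q * ((C * \<bar>v x\<bar> powr s + \<delta> * b x powr \<sigma>) + (b x * \<bar>y x\<bar> powr p) powr t))"
        by (rule ennreal_leI)
      then show "ennreal ((b x * \<bar>z k x\<bar> powr p) powr t) \<le>
          ennreal q * ((ennreal C * ennreal (\<bar>v x\<bar> powr s) + ennreal \<delta> * ennreal (b x powr \<sigma>)) + ennreal ((b x * \<bar>y x\<bar> powr p) powr t))"
        using q C \<delta> by (simp add: ennreal_mult' ennreal_plus)
    qed
    also have "\<dots> = ennreal q * ((ennreal C * (\<integral>\<^sup>+x. ennreal (\<bar>v x\<bar> powr s) \<partial>lebesgue) + ennreal \<delta> * ennreal B) +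
        (\<integral>\<^sup>+x. ennreal ((b x * \<bar>y x\<bar> powr p) powr t) \<partial>lebesgue))"
    proof -
      have 1: "(\<lambda>x. ennreal (\<bar>v x\<bar> powr s)) \<in> borel_measurable lebesgue" using vm by auto
      have 2: "(\<lambda>x. ennreal (b x powr \<sigma>)) \<in> borel_measurable lebesgue" using bm by auto
      have 3: "(\<lambda>x. ennreal ((b x * \<bar>y x\<bar> powr p) powr t)) \<in> borel_measurable lebesgue" using bm ym by auto
      show ?thesis using 1 2 3 by (simp add: nn_integral_cmult nn_integral_add B(2))
    qed
    also have "\<dots> \<le> ennreal q * ((ennreal C * ennreal (c n) + ennreal \<delta> * ennreal B) + ennreal (\<epsilon> / (3 * q)))"
      using elim unfolding v_def y_def by (intro mult_left_mono add_mono c z zE order_refl) auto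
    also have "\<dots> = ennreal (q * ((C * c n + \<delta> * B) + \<epsilon> / (3 * q)))"
      using q C \<delta> B c(2)[of n] \<epsilon> by (simp add: ennreal_mult' ennreal_plus)
    also have "\<dots> \<le> ennreal \<epsilon>"
    proof (rule ennreal_leI)
      have "q * ((C * c n + \<delta> * B) + \<epsilon> / (3 * q)) = q * (C * c n) + q * (\<delta> * B) + \<epsilon> / 3"
        using q by (simp add: field_simps)
      then show "q * ((C * c n + \<delta> * B) + \<epsilon> / (3 * q)) \<le> \<epsilon>" using n \<delta>B by linarith
    qed
    finally show ?case .
  qed
qed

section \<open>Bilinearity, vanishing cross terms, choice of exponents and the limit\<close>

section \<open>Bilinear estimates and the conclusion\<close>

lemma weighted_form_mono:
  fixes f g f' g' :: "'a::euclidean_space \<Rightarrow> real"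
  assumes "\<And>x. 0 \<le> f x" "\<And>x. 0 \<le> g x" "\<And>x. f x \<le> f' x" "\<And>x. g x \<le> g' x"
  shows "weighted_form \<alpha> \<mu> f g \<le> weighted_form \<alpha> \<mu> f' g'"
  unfolding weighted_form_def
  by (intro nn_integral_mono ennreal_leI divide_right_mono mult_mono order_trans[OF assms(1) assms(3)] assms)
     auto

lemma weighted_form_measurable:
  fixes f g :: "'a::euclidean_space \<Rightarrow> real"
  assumes f: "f \<in> borel_measurable lebesgue" and g: "g \<in> borel_measurable lebesgue"
  shows "(\<lambda>x. ennreal ((f x * g y) / (norm x powr \<alpha> * norm (x - y) powr \<mu> * norm y powr \<alpha>))) \<in> borel_measurable lebesgue"
    and "(\<lambda>y. \<integral>\<^sup>+x. ennreal ((f x * g y) / (norm x powr \<alpha> * norm (x - y) powr \<mu> * norm y powr \<alpha>)) \<partial>lebesgue) \<in> borel_measurable lebesgue"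
proof -
  define G where "G z = ennreal ((f (fst z) * g (snd z)) /
      (norm (fst z) powr \<alpha> * norm (fst z - snd z) powr \<mu> * norm (snd z) powr \<alpha>))" for z
  have m: "G \<in> borel_measurable (lebesgue \<Otimes>\<^sub>M lebesgue)"
    unfolding G_def[abs_def] using weighted_integrand_measurable[OF f g] by (rule measurable_compose) simp
  have "(\<lambda>x. G (x, y)) \<in> borel_measurable lebesgue" by (rule measurable_compose[OF measurable_Pair2' m]) simp
  then show "(\<lambda>x. ennreal ((f x * g y) / (norm x powr \<alpha> * norm (x - y) powr \<mu> * norm y powr \<alpha>))) \<in> borel_measurable lebesgue"
    by (simp add: G_def)
  have "(\<lambda>(y, x). G (x, y)) \<in> borel_measurable (lebesgue \<Otimes>\<^sub>M lebesgue)"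
    using measurable_compose[OF measurable_pair_swap' m] by (simp add: case_prod_beta')
  from lebesgue.borel_measurable_nn_integral[OF this]
  show "(\<lambda>y. \<integral>\<^sup>+x. ennreal ((f x * g y) / (norm x powr \<alpha> * norm (x - y) powr \<mu> * norm y powr \<alpha>)) \<partial>lebesgue) \<in> borel_measurable lebesgue"
    by (simp add: G_def)
qed

lemma weighted_form_add:
  fixes f g h :: "'a::euclidean_space \<Rightarrow> real"
  assumes m: "f \<in> borel_measurable lebesgue" "g \<in> borel_measurable lebesgue" "h \<in> borel_measurable lebesgue"
    and nn: "\<And>x. 0 \<le> f x" "\<And>x. 0 \<le> g x" "\<And>x. 0 \<le> h x"
  shows "weighted_form \<alpha> \<mu> (\<lambda>x. f x + g x) h = weighted_form \<alpha> \<mu> f h + weighted_form \<alpha> \<mu> g h"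
    and "weighted_form \<alpha> \<mu> h (\<lambda>x. f x + g x) = weighted_form \<alpha> \<mu> h f + weighted_form \<alpha> \<mu> h g"
proof -
  have split: "ennreal (((a + b) * c) / d) = ennreal ((a * c) / d) + ennreal ((b * c) / d)"
    "ennreal ((c * (a + b)) / d) = ennreal ((c * a) / d) + ennreal ((c * b) / d)"
    if "0 \<le> a" "0 \<le> b" "0 \<le> c" "0 \<le> d" for a b c d :: real
    using that by (simp_all add: ennreal_plus[symmetric] distrib_left distrib_right add_divide_distrib del: ennreal_plus)
  show "weighted_form \<alpha> \<mu> (\<lambda>x. f x + g x) h = weighted_form \<alpha> \<mu> f h + weighted_form \<alpha> \<mu> g h"
    unfolding weighted_form_def
    using weighted_form_measurable[OF m(1) m(3)] weighted_form_measurable[OF m(2) m(3)]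
    by (subst split) (auto simp: nn nn_integral_add)
  show "weighted_form \<alpha> \<mu> h (\<lambda>x. f x + g x) = weighted_form \<alpha> \<mu> h f + weighted_form \<alpha> \<mu> h g"
    unfolding weighted_form_def
    using weighted_form_measurable[OF m(3) m(1)] weighted_form_measurable[OF m(3) m(2)]
    by (subst split) (auto simp: nn nn_integral_add)
qed

lemma weighted_form_scale:
  fixes f g :: "'a::euclidean_space \<Rightarrow> real"
  assumes m: "f \<in> borel_measurable lebesgue" "g \<in> borel_measurable lebesgue" and c: "0 \<le> c"
  shows "weighted_form \<alpha> \<mu> (\<lambda>x. c * f x) g = ennreal c * weighted_form \<alpha> \<mu> f g"
    and "weighted_form \<alpha> \<mu> f (\<lambda>x. c * g x) = ennreal c * weighted_form \<alpha> \<mu> f g"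
proof -
  have s: "ennreal ((c * a * b) / d) = ennreal c * ennreal ((a * b) / d)"
    "ennreal ((a * (c * b)) / d) = ennreal c * ennreal ((a * b) / d)" for a b d :: real
    using c by (simp_all add: ennreal_mult'[symmetric] mult_ac)
  show "weighted_form \<alpha> \<mu> (\<lambda>x. c * f x) g = ennreal c * weighted_form \<alpha> \<mu> f g"
    unfolding weighted_form_def s using weighted_form_measurable[OF m]
    by (simp add: nn_integral_cmult)
  show "weighted_form \<alpha> \<mu> f (\<lambda>x. c * g x) = ennreal c * weighted_form \<alpha> \<mu> f g"
    unfolding weighted_form_def s using weighted_form_measurable[OF m]
    by (simp add: nn_integral_cmult)
qed

text \<open>Monotonicity and bilinearity in \<open>ennreal\<close>. The two mixed terms stay
  separate; each is later shown to vanish by itself.\<close>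

lemma weighted_form_compare:
  fixes f g h :: "'a::euclidean_space \<Rightarrow> real"
  assumes m: "f \<in> borel_measurable lebesgue" "g \<in> borel_measurable lebesgue" "h \<in> borel_measurable lebesgue"
    and nn: "\<And>x. 0 \<le> f x" "\<And>x. 0 \<le> g x" "\<And>x. 0 \<le> h x"
    and c: "0 \<le> a" "0 \<le> c" and le: "\<And>x. f x \<le> a * g x + c * h x"
  shows "weighted_form \<alpha> \<mu> f f \<le> ennreal (a * a) * weighted_form \<alpha> \<mu> g g +
    (ennreal (a * c) * weighted_form \<alpha> \<mu> g h + (ennreal (c * a) * weighted_form \<alpha> \<mu> h g +
     ennreal (c * c) * weighted_form \<alpha> \<mu> h h))"
proof -
  have ms: "(\<lambda>x. a * g x) \<in> borel_measurable lebesgue" "(\<lambda>x. c * h x) \<in> borel_measurable lebesgue"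
    "(\<lambda>x. a * g x + c * h x) \<in> borel_measurable lebesgue" using m by auto
  have ns: "\<And>x. 0 \<le> a * g x" "\<And>x. 0 \<le> c * h x" "\<And>x. 0 \<le> a * g x + c * h x" using nn c by auto
  have "weighted_form \<alpha> \<mu> f f \<le> weighted_form \<alpha> \<mu> (\<lambda>x. a * g x + c * h x) (\<lambda>x. a * g x + c * h x)"
    by (intro weighted_form_mono nn le)
  also have "\<dots> = weighted_form \<alpha> \<mu> (\<lambda>x. a * g x) (\<lambda>x. a * g x) + weighted_form \<alpha> \<mu> (\<lambda>x. a * g x) (\<lambda>x. c * h x) +
     (weighted_form \<alpha> \<mu> (\<lambda>x. c * h x) (\<lambda>x. a * g x) + weighted_form \<alpha> \<mu> (\<lambda>x. c * h x) (\<lambda>x. c * h x))"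
    by (simp only: weighted_form_add(1)[OF ms(1,2,3) ns(1,2,3)] weighted_form_add(2)[OF ms(1,2,1) ns(1,2,1)]
        weighted_form_add(2)[OF ms(1,2,2) ns(1,2,2)])
  also have "\<dots> = ennreal (a * a) * weighted_form \<alpha> \<mu> g g +
    (ennreal (a * c) * weighted_form \<alpha> \<mu> g h + (ennreal (c * a) * weighted_form \<alpha> \<mu> h g +
     ennreal (c * c) * weighted_form \<alpha> \<mu> h h))"
    by (simp only: weighted_form_scale(1)[OF m(2) ms(1) c(1)] weighted_form_scale(1)[OF m(2) ms(2) c(1)]
        weighted_form_scale(1)[OF m(3) ms(1) c(2)] weighted_form_scale(1)[OF m(3) ms(2) c(2)]
        weighted_form_scale(2)[OF m(2) m(2) c(1)] weighted_form_scale(2)[OF m(2) m(3) c(2)]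
        weighted_form_scale(2)[OF m(3) m(2) c(1)] weighted_form_scale(2)[OF m(3) m(3) c(2)]
        ennreal_mult'[OF c(1)] ennreal_mult'[OF c(2)] mult.assoc add.assoc)
  finally show ?thesis .
qed

text \<open>An infinite inner integral is read as 0 by the Bochner integral, and so is a divergent
  outer one. Finiteness of the form confines the first to a null set of y and excludes the
  second.\<close>

lemma double_integral_eq_weighted_form:
  fixes b w :: "'a::euclidean_space \<Rightarrow> real"
  assumes m: "b \<in> borel_measurable lebesgue" "w \<in> borel_measurable lebesgue" and b0: "\<And>x. 0 \<le> b x"
    and fin: "weighted_form \<alpha> \<mu> (\<lambda>x. b x * \<bar>w x\<bar> powr p) (\<lambda>x. b x * \<bar>w x\<bar> powr p) < \<infinity>"
  shows "double_integral b p \<alpha> \<mu> w =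
    enn2real (weighted_form \<alpha> \<mu> (\<lambda>x. b x * \<bar>w x\<bar> powr p) (\<lambda>x. b x * \<bar>w x\<bar> powr p))"
proof -
  define f where "f x = b x * \<bar>w x\<bar> powr p" for x
  have f: "f \<in> borel_measurable lebesgue" unfolding f_def[abs_def] using m by auto
  have f0: "0 \<le> f x" for x using b0 by (simp add: f_def)
  define k where "k x y = (f x * f y) / (norm x powr \<alpha> * norm (x - y) powr \<mu> * norm y powr \<alpha>)" for x y
  define I where "I y = (\<integral>\<^sup>+x. ennreal (k x y) \<partial>lebesgue)" for y
  have Im: "I \<in> borel_measurable lebesgue"
    unfolding I_def[abs_def] k_def by (rule weighted_form_measurable(2)[OF f f])
  have WI: "weighted_form \<alpha> \<mu> f f = (\<integral>\<^sup>+y. I y \<partial>lebesgue)"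
    by (simp add: weighted_form_def I_def k_def)
  have AEfin: "AE y in lebesgue. I y \<noteq> \<infinity>"
    using fin WI by (intro nn_integral_PInf_AE Im) (auto simp: f_def[abs_def])
  have k0: "0 \<le> k x y" for x y by (simp add: k_def f0)
  have km: "(\<lambda>x. k x y) \<in> borel_measurable lebesgue" for y
  proof -
    have "(\<lambda>x. enn2real (ennreal (k x y))) \<in> borel_measurable lebesgue"
      using weighted_form_measurable(1)[OF f f] unfolding k_def by (intro borel_measurable_enn2real)
    then show ?thesis by (simp add: k0)
  qed
  have "(\<integral>x. k x y \<partial>lebesgue) = enn2real (I y)" for y
    unfolding I_def by (intro integral_eq_nn_integral km AE_I2 k0)
  then have "double_integral b p \<alpha> \<mu> w = (\<integral>y. enn2real (I y) \<partial>lebesgue)"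
    unfolding double_integral_def k_def f_def by simp
  also have "\<dots> = enn2real (\<integral>\<^sup>+y. ennreal (enn2real (I y)) \<partial>lebesgue)"
    using Im by (intro integral_eq_nn_integral) auto
  also have "(\<integral>\<^sup>+y. ennreal (enn2real (I y)) \<partial>lebesgue) = (\<integral>\<^sup>+y. I y \<partial>lebesgue)"
    using AEfin by (intro nn_integral_cong_AE) (auto simp: less_top[symmetric] elim!: eventually_mono)
  finally show ?thesis by (simp add: WI[symmetric] f_def[abs_def])
qed

text \<open>Rescaling the small argument turns the additive bound into a vanishing one.\<close>

lemma weighted_form_tendsto_0:
  fixes h g :: "nat \<Rightarrow> 'a::euclidean_space \<Rightarrow> real" and \<Phi> :: "('a \<Rightarrow> real) \<Rightarrow> ennreal"
  assumes \<kappa>: "0 \<le> \<kappa>" and K: "0 \<le> K"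
    and t: "0 < t1" "t1 \<le> 2" "0 < t2" "t2 \<le> 2"
  defines "\<Phi> f \<equiv> (\<integral>\<^sup>+x. ennreal (f x powr t1) \<partial>lebesgue) + (\<integral>\<^sup>+x. ennreal (f x powr t2) \<partial>lebesgue)"
  assumes bound: "\<And>f g :: 'a \<Rightarrow> real. f \<in> borel_measurable lebesgue \<Longrightarrow> g \<in> borel_measurable lebesgue \<Longrightarrow>
      (\<And>x. 0 \<le> f x) \<Longrightarrow> (\<And>x. 0 \<le> g x) \<Longrightarrow>
      weighted_form \<alpha> \<mu> f g \<le> ennreal K * ((\<Phi> f + ennreal \<kappa>) * (\<Phi> g + ennreal \<kappa>))"
    and m: "\<And>k. h k \<in> borel_measurable lebesgue" "\<And>k. g k \<in> borel_measurable lebesgue"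
    and nn: "\<And>k x. 0 \<le> h k x" "\<And>k x. 0 \<le> g k x"
    and h: "(\<lambda>k. \<Phi> (h k)) \<longlonglongrightarrow> 0" and G: "\<forall>\<^sub>F k in sequentially. \<Phi> (g k) \<le> ennreal G"
  shows "(\<lambda>k. weighted_form \<alpha> \<mu> (h k) (g k)) \<longlonglongrightarrow> 0" "(\<lambda>k. weighted_form \<alpha> \<mu> (g k) (h k)) \<longlonglongrightarrow> 0"
proof -
  \<comment> \<open>Both exponents are at most 2, so for c >= 1 the single factor c^2 serves both
    integrals.\<close>
  have scale: "\<Phi> (\<lambda>x. c * f x) \<le> ennreal (c\<^sup>2) * \<Phi> f" if c: "1 \<le> c" and f: "f \<in> borel_measurable lebesgue"
    for c and f :: "'a \<Rightarrow> real"
  proof -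
    have "(\<integral>\<^sup>+x. ennreal ((c * f x) powr t) \<partial>lebesgue) \<le> ennreal (c\<^sup>2) * (\<integral>\<^sup>+x. ennreal (f x powr t) \<partial>lebesgue)"
      if t: "0 < t" "t \<le> 2" for t
    proof -
      have "(\<integral>\<^sup>+x. ennreal ((c * f x) powr t) \<partial>lebesgue) \<le> (\<integral>\<^sup>+x. ennreal (c\<^sup>2) * ennreal (f x powr t) \<partial>lebesgue)"
      proof (rule nn_integral_mono)
        fix x
        have "c powr t \<le> c powr 2" using c t by (intro powr_mono) auto
        then have "c powr t \<le> c\<^sup>2" using c by (simp add: powr_numeral)
        then have "(c * f x) powr t \<le> c\<^sup>2 * f x powr t" unfolding powr_mult by (intro mult_right_mono) auto
        then show "ennreal ((c * f x) powr t) \<le> ennreal (c\<^sup>2) * ennreal (f x powr t)"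
          by (simp add: ennreal_mult'[symmetric] ennreal_leI)
      qed
      also have "\<dots> = ennreal (c\<^sup>2) * (\<integral>\<^sup>+x. ennreal (f x powr t) \<partial>lebesgue)"
        using f by (intro nn_integral_cmult) auto
      finally show ?thesis .
    qed
    from add_mono[OF this[OF t(1,2)] this[OF t(3,4)]] show ?thesis by (simp add: \<Phi>_def distrib_left)
  qed
  have main: "\<forall>\<^sub>F k in sequentially. weighted_form \<alpha> \<mu> (h k) (g k) \<le> ennreal e \<and> weighted_form \<alpha> \<mu> (g k) (h k) \<le> ennreal e"
    if e: "0 < e" for e
  proof -
    define B where "B = K * ((1 + \<kappa>) * (\<bar>G\<bar> + \<kappa>))"
    have B: "0 \<le> B" using K \<kappa> by (simp add: B_def)
    \<comment> \<open>The form of \<open>h k\<close> is 1 / c times the form of its c-fold multiple.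
      The latter is at most \<open>B\<close> once \<Phi> of the multiple is at most 1, and the
      choice of c makes B / c at most e.\<close>
    define c where "c = max 1 (B / e)"
    have c: "1 \<le> c" "B / c \<le> e"
    proof -
      show "1 \<le> c" by (simp add: c_def)
      have "B / e \<le> c" by (simp add: c_def)
      then show "B / c \<le> e" using e \<open>1 \<le> c\<close> by (simp add: field_simps)
    qed
    have "\<forall>\<^sub>F k in sequentially. \<Phi> (h k) < ennreal (1 / c\<^sup>2)"
      using h c by (intro order_tendstoD(2)[OF h]) auto
    with G show ?thesis
    proof eventually_elim
      case (elim k)
      have "\<Phi> (\<lambda>x. c * h k x) \<le> ennreal (c\<^sup>2) * ennreal (1 / c\<^sup>2)"
        using elim by (intro order_trans[OF scale[OF c(1) m(1)]] mult_left_mono) auto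
      also have "\<dots> = ennreal 1" using c by (simp add: ennreal_mult'[symmetric])
      finally have h1: "\<Phi> (\<lambda>x. c * h k x) \<le> ennreal 1" .
      have gG: "\<Phi> (g k) \<le> ennreal \<bar>G\<bar>" using elim(1) by (rule order_trans) (intro ennreal_leI, simp)
      have cm: "(\<lambda>x. c * h k x) \<in> borel_measurable lebesgue" using m(1)[of k] by auto
      have cn: "0 \<le> c * h k x" for x using c nn(1)[of k x] by simp
      have prod: "ennreal K * ((\<Phi> (\<lambda>x. c * h k x) + ennreal \<kappa>) * (\<Phi> (g k) + ennreal \<kappa>)) \<le> ennreal B"
      proof -
        have "ennreal K * ((\<Phi> (\<lambda>x. c * h k x) + ennreal \<kappa>) * (\<Phi> (g k) + ennreal \<kappa>)) \<le>
           ennreal K * ((ennreal 1 + ennreal \<kappa>) * (ennreal \<bar>G\<bar> + ennreal \<kappa>))"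
          by (intro mult_left_mono mult_mono add_right_mono h1 gG) auto
        also have "\<dots> = ennreal B"
          using K \<kappa> by (simp add: B_def ennreal_mult' ennreal_plus[symmetric] del: ennreal_plus ennreal_1)
        finally show ?thesis .
      qed
      have cancel: "W \<le> ennreal e" if "ennreal c * W \<le> ennreal B" for W
      proof -
        have "W = ennreal (1 / c) * (ennreal c * W)"
          using c by (simp add: mult.assoc[symmetric] ennreal_mult'[symmetric])
        also have "\<dots> \<le> ennreal (1 / c) * ennreal B" using that by (intro mult_left_mono) auto
        also have "\<dots> = ennreal (B / c)" using c by (simp add: ennreal_mult'[symmetric])
        also have "\<dots> \<le> ennreal e" by (intro ennreal_leI c)
        finally show ?thesis .
      qed
      have "ennreal c * weighted_form \<alpha> \<mu> (h k) (g k) \<le> ennreal B"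
        unfolding weighted_form_scale(1)[OF m(1) m(2) order_trans[OF zero_le_one c(1)], symmetric]
        by (rule order_trans[OF bound[OF cm m(2) cn nn(2)] prod])
      moreover have "ennreal c * weighted_form \<alpha> \<mu> (g k) (h k) \<le> ennreal B"
        unfolding weighted_form_scale(2)[OF m(2) m(1) order_trans[OF zero_le_one c(1)], symmetric]
        by (rule order_trans[OF bound[OF m(2) cm nn(2) cn]]) (use prod in \<open>simp only: mult.commute\<close>)
      ultimately show ?case using cancel by blast
    qed
  qed
  show "(\<lambda>k. weighted_form \<alpha> \<mu> (h k) (g k)) \<longlonglongrightarrow> 0"
    by (rule ennreal_tendsto_0_iff_eventually_le, rule eventually_mono[OF main]) auto
  show "(\<lambda>k. weighted_form \<alpha> \<mu> (g k) (h k)) \<longlonglongrightarrow> 0"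
    by (rule ennreal_tendsto_0_iff_eventually_le, rule eventually_mono[OF main]) auto
qed

text \<open>Either u - v is small relative to v, at the cost of the factor (1 + \<theta>)^p = a, or
  it dominates both u and v. The leading factor can thus be taken arbitrarily close to 1, at the
  expense of C.\<close>

lemma abs_powr_perturbation:
  fixes p a :: real
  assumes p: "0 < p" and a: "1 < a"
  obtains C where "0 \<le> C" "\<And>u v :: real. \<bar>u\<bar> powr p \<le> a * \<bar>v\<bar> powr p + C * \<bar>u - v\<bar> powr p"
proof -
  define \<theta> where "\<theta> = a powr (1 / p) - 1"
  have \<theta>: "0 < \<theta>" using a p by (simp add: \<theta>_def gr_one_powr)
  have \<theta>a: "(1 + \<theta>) powr p = a" using a p by (simp add: \<theta>_def powr_powr)
  define C where "C = (1 + 1 / \<theta>) powr p"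
  show thesis
  proof (rule that[of C])
    show "0 \<le> C" by (simp add: C_def)
    fix u v :: real
    show "\<bar>u\<bar> powr p \<le> a * \<bar>v\<bar> powr p + C * \<bar>u - v\<bar> powr p"
    proof (cases "\<bar>u - v\<bar> \<le> \<theta> * \<bar>v\<bar>")
      case True
      then have "\<bar>u\<bar> \<le> (1 + \<theta>) * \<bar>v\<bar>" by (simp add: distrib_right)
      then have "\<bar>u\<bar> powr p \<le> ((1 + \<theta>) * \<bar>v\<bar>) powr p" using p by (intro powr_mono2) auto
      also have "\<dots> = a * \<bar>v\<bar> powr p" by (simp add: powr_mult \<theta>a)
      also have "\<dots> \<le> a * \<bar>v\<bar> powr p + C * \<bar>u - v\<bar> powr p" by (simp add: C_def)
      finally show ?thesis .
    next
      case False
      then have "\<bar>v\<bar> \<le> (1 / \<theta>) * \<bar>u - v\<bar>" using \<theta> by (simp add: field_simps)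
      then have "\<bar>u\<bar> \<le> (1 + 1 / \<theta>) * \<bar>u - v\<bar>" by (simp add: distrib_right)
      then have "\<bar>u\<bar> powr p \<le> ((1 + 1 / \<theta>) * \<bar>u - v\<bar>) powr p" using p by (intro powr_mono2) auto
      also have "\<dots> = C * \<bar>u - v\<bar> powr p" by (simp add: powr_mult C_def)
      also have "\<dots> \<le> a * \<bar>v\<bar> powr p + C * \<bar>u - v\<bar> powr p" using a by simp
      finally show ?thesis .
    qed
  qed
qed

text \<open>Letting q tend to 1 closes the gap. The lower estimate carries the error (q - 1) * A k
  instead of (q - 1) * L, so the upper one is used first to bound A k.\<close>

lemma tendsto_if_almost_comparable:
  fixes A :: "nat \<Rightarrow> real" and L :: real
  assumes L: "0 \<le> L"
    and upper: "\<And>q. 1 < q \<Longrightarrow> \<exists>r. r \<longlonglongrightarrow> 0 \<and> (\<forall>k. A k \<le> q * L + r k)"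
    and lower: "\<And>q. 1 < q \<Longrightarrow> \<exists>r. r \<longlonglongrightarrow> 0 \<and> (\<forall>k. L \<le> q * A k + r k)"
  shows "A \<longlonglongrightarrow> L"
proof (rule LIMSEQ_I)
  fix e :: real assume e: "0 < e"
  define \<eta> where "\<eta> = min 1 (e / (4 * (L + 1)))"
  have \<eta>: "0 < \<eta>" "\<eta> \<le> 1" "\<eta> * (L + 1) \<le> e / 4"
  proof -
    show "0 < \<eta>" "\<eta> \<le> 1" using e L by (auto simp: \<eta>_def)
    have "\<eta> \<le> e / (4 * (L + 1))" by (simp add: \<eta>_def)
    then show "\<eta> * (L + 1) \<le> e / 4" using L by (simp add: field_simps)
  qed
  define q where "q = 1 + \<eta>"
  have q: "1 < q" "q \<le> 2" using \<eta> by (auto simp: q_def)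
  obtain r r' where r: "r \<longlonglongrightarrow> 0" "\<And>k. A k \<le> q * L + r k" "r' \<longlonglongrightarrow> 0" "\<And>k. L \<le> q * A k + r' k"
    using upper[OF q(1)] lower[OF q(1)] by auto
  define \<rho> where "\<rho> = min (1 / 2) (e / 4)"
  have \<rho>: "0 < \<rho>" using e by (simp add: \<rho>_def)
  have "\<forall>\<^sub>F k in sequentially. norm (r k - 0) < \<rho>" "\<forall>\<^sub>F k in sequentially. norm (r' k - 0) < \<rho>"
    using r(1,3) \<rho> unfolding tendsto_iff dist_norm by blast+
  then have "\<forall>\<^sub>F k in sequentially. norm (A k - L) < e"
  proof eventually_elim
    case (elim k)
    then have rk: "r k < \<rho>" "r' k < \<rho>" by (auto simp: abs_less_iff)
    have \<rho>': "\<rho> \<le> 1 / 2" "\<rho> \<le> e / 4" by (auto simp: \<rho>_def)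
    have \<eta>L: "\<eta> * L \<le> e / 4" using \<eta> by (simp add: distrib_left)
    have up: "A k \<le> L + \<eta> * L + r k" using r(2)[of k] by (simp add: q_def distrib_right)
    have "A k \<le> 2 * (L + 1)"
    proof -
      have "\<eta> * L \<le> 1 * L" using \<eta> L by (intro mult_right_mono) auto
      then show ?thesis using up rk \<rho>' by simp
    qed
    then have "\<eta> * A k \<le> \<eta> * (2 * (L + 1))" using \<eta> by (intro mult_left_mono) auto
    moreover have "\<eta> * (2 * (L + 1)) = 2 * (\<eta> * (L + 1))" by simp
    ultimately have "\<eta> * A k \<le> e / 2" using \<eta>(3) by linarith
    moreover have "L \<le> A k + \<eta> * A k + r' k" using r(4)[of k] by (simp add: q_def distrib_right)
    ultimately have "L - A k < e" "A k - L < e" using up \<eta>L rk \<rho>' e by linarith+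
    then show ?case by (simp add: abs_less_iff)
  qed
  then show "\<exists>no. \<forall>n\<ge>no. norm (A n - L) < e" by (simp add: eventually_sequentially)
qed

text \<open>Additivity of \<open>enn2real\<close> requires finite values, so the error is collected
  in \<open>ennreal\<close> first and converted once.\<close>

lemma enn2real_perturbation:
  fixes w v x y z :: "nat \<Rightarrow> ennreal"
  assumes le: "\<And>k. w k \<le> ennreal q * v k + (ennreal a * x k + (ennreal b * y k + ennreal c * z k))"
    and fin: "\<And>k. v k < \<infinity>" "\<And>k. x k < \<infinity>" "\<And>k. y k < \<infinity>" "\<And>k. z k < \<infinity>"
    and lim: "x \<longlonglongrightarrow> 0" "y \<longlonglongrightarrow> 0" "z \<longlonglongrightarrow> 0" and q: "0 \<le> q"
  shows "\<exists>r. r \<longlonglongrightarrow> 0 \<and> (\<forall>k. enn2real (w k) \<le> q * enn2real (v k) + r k)"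
proof -
  define R where "R k = ennreal a * x k + (ennreal b * y k + ennreal c * z k)" for k
  have Rfin: "R k < \<infinity>" for k using fin by (simp add: R_def ennreal_mult_less_top)
  have "R \<longlonglongrightarrow> ennreal a * 0 + (ennreal b * 0 + ennreal c * 0)"
    unfolding R_def by (intro tendsto_add ennreal_tendsto_cmult lim) auto
  then have "(\<lambda>k. enn2real (R k)) \<longlonglongrightarrow> enn2real (ennreal 0)"
    by (intro tendsto_enn2real) auto
  then have "(\<lambda>k. enn2real (R k)) \<longlonglongrightarrow> 0" by simp
  moreover have "enn2real (w k) \<le> q * enn2real (v k) + enn2real (R k)" for k
  proof -
    have "enn2real (w k) \<le> enn2real (ennreal q * v k + R k)"
      using le[of k] fin(1)[of k] Rfin[of k] unfolding R_def[symmetric]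
      by (intro enn2real_mono) (auto simp: ennreal_mult_less_top)
    also have "\<dots> = enn2real (ennreal q * v k) + enn2real (R k)"
      using fin(1)[of k] Rfin[of k] by (intro enn2real_plus) (auto simp: ennreal_mult_less_top)
    also have "\<dots> = q * enn2real (v k) + enn2real (R k)" using q by (simp add: enn2real_mult)
    finally show ?thesis .
  qed
  ultimately show ?thesis by blast
qed

text \<open>The slack between \<open>p\<close> and the upper critical exponent together with \<open>\<eta> > 0\<close> leaves room for
  exponents \<open>t\<^sub>1\<close>, \<open>t\<^sub>2\<close> on both sides of the Hardy-Littlewood-Sobolev exponent \<open>2N / (2N - 2\<alpha> - \<mu>)\<close>.\<close>

lemma exponents_exist:
  fixes n l p \<sigma> \<eta> :: real
  assumes n: "3 \<le> n" and l: "0 < l" "l < n" and p: "1 < p" "p * (n - 2) < 2 * n - l"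
    and \<sigma>: "\<sigma> = 2 * n / (2 * n - l - p * (n - 2))" and \<eta>: "0 < \<eta>"
  obtains s t1 t2 \<sigma>' where "2 \<le> s" "(n - 2) * (s - 2) < 4" "\<sigma> \<le> \<sigma>'" "\<sigma>' \<le> \<sigma> + \<eta>"
    "1 < t1" "t1 \<le> 2" "t1 < \<sigma>" "t1 / \<sigma> + p * t1 / s = 1" "n < l * (t1 / (2 * (t1 - 1)))"
    "1 < t2" "t2 \<le> 2" "t2 < \<sigma>'" "t2 / \<sigma>' + p * t2 / s = 1" "l * (t2 / (2 * (t2 - 1))) < n"
proof -
  \<comment> \<open>All conditions become linear in the reciprocals of \<sigma>, s and t. They
    balance at \<open>i0\<close>, the reciprocal of 2n / (2n - l): there \<open>i\<sigma>\<close> +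
    p (n - 2) / (2n) = \<open>i0\<close>. Raising p / s by \<epsilon> moves 1 / t1 to
    \<open>i0\<close> + \<epsilon>; lowering 1 / \<sigma> by 2 \<epsilon> in addition moves 1 / t2
    to \<open>i0\<close> - \<epsilon>, with the same s.\<close>
  define i\<sigma> where "i\<sigma> = (2 * n - l - p * (n - 2)) / (2 * n)"
  have i\<sigma>: "0 < i\<sigma>" "\<sigma> = 1 / i\<sigma>" using p n by (auto simp: i\<sigma>_def \<sigma>)
  have \<sigma>0: "0 < \<sigma>" using i\<sigma> by simp
  have gap: "1 / (\<sigma> + \<eta>) < i\<sigma>"
  proof -
    have "1 / (\<sigma> + \<eta>) < 1 / \<sigma>" using \<sigma>0 \<eta> by (intro divide_strict_left_mono) auto
    then show ?thesis using i\<sigma> by simp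
  qed
  \<comment> \<open>In the order written, the four bounds secure 1 < t1, t2 <= 2, \<sigma>' <=
    \<sigma> + \<eta> and 2 <= s.\<close>
  define \<epsilon> where "\<epsilon> = min (min (l / (4 * n)) ((n - l) / (2 * n))) (min ((i\<sigma> - 1 / (\<sigma> + \<eta>)) / 2) (1 / (2 * n)))"
  have \<epsilon>: "0 < \<epsilon>" "\<epsilon> \<le> l / (4 * n)" "\<epsilon> \<le> (n - l) / (2 * n)" "\<epsilon> \<le> (i\<sigma> - 1 / (\<sigma> + \<eta>)) / 2" "\<epsilon> \<le> 1 / (2 * n)"
  proof -
    show "0 < \<epsilon>" using l n gap by (simp add: \<epsilon>_def)
    show "\<epsilon> \<le> l / (4 * n)" "\<epsilon> \<le> (n - l) / (2 * n)" "\<epsilon> \<le> (i\<sigma> - 1 / (\<sigma> + \<eta>)) / 2" "\<epsilon> \<le> 1 / (2 * n)"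
      unfolding \<epsilon>_def
      by (rule min.coboundedI1, rule min.cobounded1) (rule min.coboundedI1, rule min.cobounded2,
        rule min.coboundedI2, rule min.cobounded1, rule min.coboundedI2, rule min.cobounded2)
  qed
  define i0 where "i0 = 1 - l / (2 * n)"
  have i\<sigma>0: "i\<sigma> = i0 - p * (n - 2) / (2 * n)" using n by (simp add: i\<sigma>_def i0_def field_simps)
  define si where "si = (n - 2) / (2 * n) + \<epsilon> / p"
  have si0: "0 < si" using n p \<epsilon> by (auto simp: si_def intro!: add_nonneg_pos)
  have psi: "p * si = p * (n - 2) / (2 * n) + \<epsilon>" using p by (simp add: si_def distrib_left)
  have si2: "si \<le> 1 / 2"
  proof -
    have "\<epsilon> / p \<le> \<epsilon>" using p \<epsilon> by (simp add: field_simps)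
    moreover have "(n - 2) / (2 * n) + 1 / n = 1 / 2" using n by (simp add: field_simps)
    moreover have "1 / (2 * n) \<le> 1 / n" using n by (simp add: field_simps)
    ultimately show ?thesis using \<epsilon>(5) unfolding si_def by linarith
  qed
  have half: "l / (2 * n) < 1 / 2" using l n by (simp add: field_simps)
  define i1 where "i1 = i0 + \<epsilon>"
  define i2 where "i2 = i0 - \<epsilon>"
  have lq: "l / (4 * n) < l / (2 * n)" using l n by (simp add: field_simps)
  have i1: "1 / 2 \<le> i1" "i1 < 1" using half \<epsilon>(1,2) lq by (auto simp: i1_def i0_def)
  have nl: "(n - l) / (2 * n) = 1 / 2 - l / (2 * n)" using n by (simp add: field_simps)
  have l2: "0 < l / (2 * n)" using l n by simp
  have i2: "1 / 2 \<le> i2" "i2 < 1" using \<epsilon>(1,3) nl l2 unfolding i2_def i0_def by linarith+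
  define j where "j = i\<sigma> - 2 * \<epsilon>"
  have j: "1 / (\<sigma> + \<eta>) \<le> j" "j < i\<sigma>" using \<epsilon> by (auto simp: j_def field_simps)
  have j0: "0 < j" using j(1) \<sigma>0 \<eta> by (smt (verit) zero_less_divide_1_iff)
  have recip: "1 / x \<le> 1 / y" if "0 < y" "y \<le> x" for x y :: real using that by (intro divide_left_mono) auto
  have recips: "1 / x < 1 / y" if "0 < y" "y < x" for x y :: real using that by (intro divide_strict_left_mono) auto
  show thesis
  proof (rule that[of "1 / si" "1 / j" "1 / i1" "1 / i2"])
    show "2 \<le> 1 / si" using recip[OF si0 si2] by simp
    show "(n - 2) * (1 / si - 2) < 4"
    proof -
      have "0 < \<epsilon> / p" using \<epsilon> p by simp
      then have "(n - 2) / (2 * n) < si" by (simp add: si_def)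
      then have "n - 2 < 2 * n * si" using n by (simp add: field_simps)
      then have "(n - 2) / si < 2 * n" using si0 by (simp add: field_simps)
      moreover have "(n - 2) * (1 / si - 2) = (n - 2) / si - 2 * n + 4" by (simp add: right_diff_distrib)
      ultimately show ?thesis by linarith
    qed
    show "\<sigma> \<le> 1 / j" unfolding i\<sigma>(2) using j j0 by (intro recip) auto
    show "1 / j \<le> \<sigma> + \<eta>" using recip[OF _ j(1)] \<sigma>0 \<eta> by simp
    show "1 < 1 / i1" "1 / i1 \<le> 2" using i1 recip[of "1 / 2" i1] by auto
    show "1 < 1 / i2" "1 / i2 \<le> 2" using i2 recip[of "1 / 2" i2] by auto
    have sum1: "i\<sigma> + p * si = i1" unfolding psi i1_def i\<sigma>0 by simp
    have sum2: "j + p * si = i2" unfolding psi i2_def i\<sigma>0 j_def by simp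
    have psi0: "0 < p * si" using p si0 by simp
    show "1 / i1 < \<sigma>" unfolding i\<sigma>(2) using sum1 psi0 i\<sigma>(1) by (intro recips) auto
    show "1 / i2 < 1 / j" using sum2 psi0 j0 by (intro recips) auto
    have "1 / i1 / \<sigma> + p * (1 / i1) / (1 / si) = (i\<sigma> + p * si) / i1"
      using i\<sigma> by (simp add: add_divide_distrib)
    then show "1 / i1 / \<sigma> + p * (1 / i1) / (1 / si) = 1" using sum1 i1 by simp
    have "1 / i2 / (1 / j) + p * (1 / i2) / (1 / si) = (j + p * si) / i2"
      by (simp add: add_divide_distrib)
    then show "1 / i2 / (1 / j) + p * (1 / i2) / (1 / si) = 1" using sum2 i2 by simp
    have ratio: "1 / i / (2 * (1 / i - 1)) = 1 / (2 * (1 - i))" if "0 < i" "i < 1" for i :: real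
      using that by (simp add: field_simps)
    have "n * (2 * (1 - i1)) < l" using n \<epsilon>(1) by (simp add: i1_def i0_def field_simps)
    then show "n < l * (1 / i1 / (2 * (1 / i1 - 1)))"
      using i1 by (subst ratio) (auto simp: field_simps)
    have "l < n * (2 * (1 - i2))" using n \<epsilon>(1) by (simp add: i2_def i0_def field_simps)
    then show "l * (1 / i2 / (2 * (1 / i2 - 1))) < n"
      using i2 by (subst ratio) (auto simp: field_simps)
  qed
qed

theorem proposition2p3:
  fixes N :: nat
    and \<alpha> \<mu> p q r \<sigma> \<eta> V\<^sub>0 V\<^sub>i\<^sub>n\<^sub>f :: real
    and V a b u :: "'a::euclidean_space \<Rightarrow> real"
    and u_seq :: "nat \<Rightarrow> 'a \<Rightarrow> real"
  assumes "N = DIM('a)" and "N \<ge> 3"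
    and "0 < \<alpha>" and "\<alpha> < real N"
    and "0 < \<mu>" and "\<mu> < real N"
    and "0 < 2 * \<alpha> + \<mu>" and "2 * \<alpha> + \<mu> < real N"
    and "1 \<le> q" and "q < 2"
    and "lower_critical_exponent N \<alpha> \<mu> < p" and "p < upper_critical_exponent N \<alpha> \<mu>"
    and "V \<in> borel_measurable lebesgue"
    and "0 < V\<^sub>0" and "0 < V\<^sub>i\<^sub>n\<^sub>f" and "\<And>x. V\<^sub>0 \<le> V x" and "\<And>x. V x \<le> V\<^sub>i\<^sub>n\<^sub>f"
    and "\<And>x. a x > 0" and "\<And>x. b x > 0"
    and "r = sobolev_exponent N / (sobolev_exponent N - q)"
    and "a \<in> Lp r"
    and "\<sigma> = 2 * real N / (2 * real N - 2 * \<alpha> - \<mu> - p * (real N - 2))"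
    and "\<eta> > 0"
    and "b \<in> Lp \<sigma> \<inter> Lp (\<sigma> + \<eta>)"
    and "u \<in> H1"
    and "weakly_converges_H1 V u_seq u"
  shows "(\<lambda>k. double_integral b p \<alpha> \<mu> (u_seq k)
              - double_integral b p \<alpha> \<mu> (\<lambda>x. u_seq k x - u x))
          \<longlonglongrightarrow> double_integral b p \<alpha> \<mu> u"
proof -
  interpret H1_potential V V\<^sub>0 V\<^sub>i\<^sub>n\<^sub>f
    by unfold_locales (use assms in auto)
  define n where "n = real N"
  have n: "3 \<le> n" "n = real DIM('a)" using assms(1,2) by (auto simp: n_def)
  have p1: "1 < p"
  proof -
    have "1 < (2 * n - 2 * \<alpha> - \<mu>) / n" using assms(8) n by (simp add: n_def field_simps)
    also have "\<dots> < p" using assms(11) by (simp add: lower_critical_exponent_def n_def)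
    finally show ?thesis .
  qed
  have p2: "p * (n - 2) < 2 * n - (2 * \<alpha> + \<mu>)"
    using assms(12) n by (simp add: upper_critical_exponent_def n_def[symmetric] field_simps)
  have \<sigma>: "\<sigma> = 2 * n / (2 * n - (2 * \<alpha> + \<mu>) - p * (n - 2))" using assms(22) by (simp add: n_def algebra_simps)
  obtain s t1 t2 \<sigma>' where ex: "2 \<le> s" "(n - 2) * (s - 2) < 4" "\<sigma> \<le> \<sigma>'" "\<sigma>' \<le> \<sigma> + \<eta>"
    "1 < t1" "t1 \<le> 2" "t1 < \<sigma>" "t1 / \<sigma> + p * t1 / s = 1" "n < (2 * \<alpha> + \<mu>) * (t1 / (2 * (t1 - 1)))"
    "1 < t2" "t2 \<le> 2" "t2 < \<sigma>'" "t2 / \<sigma>' + p * t2 / s = 1" "(2 * \<alpha> + \<mu>) * (t2 / (2 * (t2 - 1))) < n"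
    using exponents_exist[OF n(1) assms(7) assms(8)[folded n_def] p1 p2 \<sigma> assms(23)] by metis
  have sub: "(real DIM('a) - 2) * (s - 2) < 4" using ex(2) n(2) by simp
  have t0: "0 < t1" "0 < t2" "0 < p" using ex p1 by auto
  have bm: "b \<in> borel_measurable lebesgue" using assms(24) by (simp add: Lp_def)
  have b0: "0 \<le> b x" for x using assms(19)[of x] by simp
  have bI: "(\<integral>\<^sup>+x. ennreal (b x powr c) \<partial>lebesgue) < \<infinity>" if "b \<in> Lp c" for c
    using that b0 by (auto simp: Lp_def integrable_iff_bounded)
  have b\<sigma>: "(\<integral>\<^sup>+x. ennreal (b x powr \<sigma>) \<partial>lebesgue) < \<infinity>" using assms(24) by (intro bI) auto
  have b\<sigma>': "(\<integral>\<^sup>+x. ennreal (b x powr \<sigma>') \<partial>lebesgue) < \<infinity>"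
  proof -
    have "(\<integral>\<^sup>+x. ennreal (b x powr \<sigma>') \<partial>lebesgue) \<le>
        (\<integral>\<^sup>+x. ennreal (b x powr \<sigma>) + ennreal (b x powr (\<sigma> + \<eta>)) \<partial>lebesgue)"
    proof (rule nn_integral_mono)
      fix x
      have "b x powr \<sigma>' \<le> b x powr \<sigma> + b x powr (\<sigma> + \<eta>)"
      proof (cases "b x \<le> 1")
        case True
        then have "b x powr \<sigma>' \<le> b x powr \<sigma>" using assms(19)[of x] ex(3) by (intro powr_mono') auto
        then show ?thesis by (rule order_trans) simp
      next
        case False
        then have "b x powr \<sigma>' \<le> b x powr (\<sigma> + \<eta>)" using ex(4) by (intro powr_mono) auto
        then show ?thesis by (rule order_trans) simp
      qed
      then show "ennreal (b x powr \<sigma>') \<le> ennreal (b x powr \<sigma>) + ennreal (b x powr (\<sigma> + \<eta>))"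
        by (simp add: ennreal_plus[symmetric] ennreal_leI del: ennreal_plus)
    qed
    also have "\<dots> = (\<integral>\<^sup>+x. ennreal (b x powr \<sigma>) \<partial>lebesgue) + (\<integral>\<^sup>+x. ennreal (b x powr (\<sigma> + \<eta>)) \<partial>lebesgue)"
      using bm by (intro nn_integral_add) auto
    also have "\<dots> < \<infinity>" using bI[of \<sigma>] bI[of "\<sigma> + \<eta>"] assms(24) by auto
    finally show ?thesis .
  qed
  define z where "z k = (\<lambda>x. u_seq k x - u x)" for k
  obtain E where E: "0 < E" "\<And>k. z k \<in> H1"
    "\<And>k. (\<integral>x. (z k x)\<^sup>2 \<partial>lebesgue) \<le> E"
    "\<And>k. (\<integral>x. (norm (weak_gradient (z k) x))\<^sup>2 \<partial>lebesgue) \<le> E"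
    "\<And>f. f \<in> Lp 2 \<Longrightarrow> (\<lambda>k. \<integral>x. f x * z k x \<partial>lebesgue) \<longlonglongrightarrow> 0"
    unfolding z_def by (fact weakly_convergent_difference[OF assms(26)])
  have uk: "u_seq k \<in> H1" for k using assms(26) by (simp add: weakly_converges_H1_def)
  define \<Phi> where "\<Phi> f = (\<integral>\<^sup>+x. ennreal (f x powr t1) \<partial>lebesgue) + (\<integral>\<^sup>+x. ennreal (f x powr t2) \<partial>lebesgue)"
    for f :: "'a \<Rightarrow> real"
  define F where "F w x = b x * \<bar>w x\<bar> powr p" for w x
  have Fm: "F w \<in> borel_measurable lebesgue" if "w \<in> H1" for w
    unfolding F_def[abs_def] using bm locally_integrable_measurable[OF H1_locally_integrable[OF that]] by auto
  have F0: "0 \<le> F w x" for w x using b0 by (simp add: F_def)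
  have \<Phi>fin: "\<Phi> (F w) < \<infinity>" if "w \<in> H1" for w
    unfolding \<Phi>_def F_def
    using weighted_power_integrable[OF bm b0 b\<sigma> t0(1) ex(7) ex(1) ex(8) sub that]
      weighted_power_integrable[OF bm b0 b\<sigma>' t0(2) ex(12) ex(1) ex(13) sub that] by simp
  have \<Phi>z: "(\<lambda>k. \<Phi> (F (z k))) \<longlonglongrightarrow> 0"
    unfolding \<Phi>_def F_def
    using tendsto_add[OF weighted_power_compactness[OF bm b0 b\<sigma> t0(1) ex(7) t0(3) ex(1) ex(8) sub E(2) less_imp_le[OF E(1)] E(3,4,5)]
        weighted_power_compactness[OF bm b0 b\<sigma>' t0(2) ex(12) t0(3) ex(1) ex(13) sub E(2) less_imp_le[OF E(1)] E(3,4,5)]]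
    by simp
  obtain \<kappa> where \<kappa>: "0 \<le> \<kappa>"
    "\<And>f g :: 'a \<Rightarrow> real. f \<in> borel_measurable lebesgue \<Longrightarrow> g \<in> borel_measurable lebesgue \<Longrightarrow>
      (\<And>x. 0 \<le> f x) \<Longrightarrow> (\<And>x. 0 \<le> g x) \<Longrightarrow>
      weighted_form \<alpha> \<mu> f g \<le> ennreal (2 * 2 powr \<mu>) * ((\<Phi> f + ennreal \<kappa>) * (\<Phi> g + ennreal \<kappa>))"
    unfolding \<Phi>_def
    by (fact weighted_form_bound[OF less_imp_le[OF assms(3)] assms(5) ex(5,6,10,11) ex(9)[unfolded n(2)] ex(14)[unfolded n(2)]])
  define W where "W f g = weighted_form \<alpha> \<mu> (F f) (F g)" for f g :: "'a \<Rightarrow> real"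
  have Wfin: "W f g < \<infinity>" if "f \<in> H1" "g \<in> H1" for f g
  proof -
    have "W f g \<le> ennreal (2 * 2 powr \<mu>) * ((\<Phi> (F f) + ennreal \<kappa>) * (\<Phi> (F g) + ennreal \<kappa>))"
      unfolding W_def by (intro \<kappa> Fm F0 that)
    also have "\<dots> < \<infinity>" using \<Phi>fin[OF that(1)] \<Phi>fin[OF that(2)] by (simp add: ennreal_mult_less_top)
    finally show ?thesis .
  qed
  \<comment> \<open>The bound on the second argument is only asked eventually: for u_k it comes from
    \<Phi> of z_k being at most 1, which holds from some index on.\<close>
  have Wlim: "(\<lambda>k. W (z k) (g k)) \<longlonglongrightarrow> 0" "(\<lambda>k. W (g k) (z k)) \<longlonglongrightarrow> 0"
    if "\<And>k. g k \<in> H1" "\<forall>\<^sub>F k in sequentially. \<Phi> (F (g k)) \<le> ennreal G" for g G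
    unfolding W_def
    by (rule weighted_form_tendsto_0[OF \<kappa>(1) _ t0(1) ex(6) t0(2) ex(11) \<kappa>(2)[unfolded \<Phi>_def] Fm Fm F0 F0
        \<Phi>z[unfolded \<Phi>_def] that(2)[unfolded \<Phi>_def]]; (assumption | intro E that | simp))+
  have Gz: "\<forall>\<^sub>F k in sequentially. \<Phi> (F (z k)) \<le> ennreal 1"
    using order_tendstoD(2)[OF \<Phi>z, of 1] by (auto elim!: eventually_mono)
  define Gu where "Gu = enn2real (\<Phi> (F u))"
  have Gu: "\<Phi> (F u) = ennreal Gu" "0 \<le> Gu" using \<Phi>fin[OF assms(25)] by (auto simp: Gu_def less_top)
  \<comment> \<open>The constant 2^(p t) from the splitting of u_k, made uniform over both exponents
    by t <= 2.\<close>
  define Q where "Q = (2 :: real) powr (p * 2)"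
  have Guk: "\<forall>\<^sub>F k in sequentially. \<Phi> (F (u_seq k)) \<le> ennreal (Q * (Gu + 1))"
    using Gz
  proof eventually_elim
    case (elim k)
    have part: "(\<integral>\<^sup>+x. ennreal (F (u_seq k) x powr t) \<partial>lebesgue) \<le>
        ennreal Q * ((\<integral>\<^sup>+x. ennreal (F u x powr t) \<partial>lebesgue) + (\<integral>\<^sup>+x. ennreal (F (z k) x powr t) \<partial>lebesgue))"
      if t: "0 < t" "t \<le> 2" for t
    proof -
      have "(\<integral>\<^sup>+x. ennreal (F (u_seq k) x powr t) \<partial>lebesgue) \<le>
        (\<integral>\<^sup>+x. ennreal Q * (ennreal (F u x powr t) + ennreal (F (z k) x powr t)) \<partial>lebesgue)"
      proof (rule nn_integral_mono)
        fix x
        have "F (u_seq k) x powr t \<le> 2 powr (p * t) * (F u x powr t + F (z k) x powr t)"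
          using weighted_power_add_le[OF b0, of p t x "u x" "z k x"] t t0 by (simp add: F_def z_def)
        also have "\<dots> \<le> Q * (F u x powr t + F (z k) x powr t)"
          unfolding Q_def using t t0 by (intro mult_right_mono powr_mono mult_left_mono) auto
        finally show "ennreal (F (u_seq k) x powr t) \<le> ennreal Q * (ennreal (F u x powr t) + ennreal (F (z k) x powr t))"
          by (simp add: ennreal_plus[symmetric] ennreal_mult'[symmetric] ennreal_leI Q_def del: ennreal_plus)
      qed
      also have "\<dots> = ennreal Q * ((\<integral>\<^sup>+x. ennreal (F u x powr t) \<partial>lebesgue) + (\<integral>\<^sup>+x. ennreal (F (z k) x powr t) \<partial>lebesgue))"
      proof -
        have "(\<lambda>x. ennreal (F u x powr t)) \<in> borel_measurable lebesgue" "(\<lambda>x. ennreal (F (z k) x powr t)) \<in> borel_measurable lebesgue"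
          using Fm[OF assms(25)] Fm[OF E(2)[of k]] by auto
        then show ?thesis by (simp add: nn_integral_cmult nn_integral_add)
      qed
      finally show ?thesis .
    qed
    have "\<Phi> (F (u_seq k)) \<le> ennreal Q * (\<Phi> (F u) + \<Phi> (F (z k)))"
      using add_mono[OF part[OF t0(1) ex(6)] part[OF t0(2) ex(11)]]
      by (simp add: \<Phi>_def distrib_left add_ac)
    also have "\<dots> \<le> ennreal Q * (ennreal Gu + ennreal 1)"
      unfolding Gu(1) using elim by (intro mult_left_mono add_left_mono) auto
    also have "\<dots> = ennreal (Q * (Gu + 1))"
      using Gu(2) by (simp add: ennreal_mult' ennreal_plus Q_def)
    finally show ?case .
  qed
  note Wzz = Wlim(1)[OF E(2) Gz]
  have Wu: "(\<lambda>k. W (z k) u) \<longlonglongrightarrow> 0" "(\<lambda>k. W u (z k)) \<longlonglongrightarrow> 0"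
    using Wlim[of "\<lambda>k. u" Gu] assms(25) Gu(1) by auto
  note Wuk = Wlim[OF uk Guk]
  have D: "double_integral b p \<alpha> \<mu> w = enn2real (W w w)" if "w \<in> H1" for w
    using Wfin[OF that that] unfolding W_def F_def[abs_def]
    by (intro double_integral_eq_weighted_form bm b0 locally_integrable_measurable[OF H1_locally_integrable[OF that]])
  have compare: "W f f \<le> ennreal (c * c) * W g g +
      (ennreal (c * C) * W g h + (ennreal (C * c) * W h g + ennreal (C * C) * W h h))"
    if H: "f \<in> H1" "g \<in> H1" "h \<in> H1" and c: "1 < c" "0 \<le> C"
      and le: "\<And>x. \<bar>f x\<bar> powr p \<le> c * \<bar>g x\<bar> powr p + C * \<bar>h x\<bar> powr p" for f g h c C
    unfolding W_def
  proof (rule weighted_form_compare[OF Fm[OF H(1)] Fm[OF H(2)] Fm[OF H(3)] F0 F0 F0])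
    show "F f x \<le> c * F g x + C * F h x" for x
      using mult_left_mono[OF le[of x] b0[of x]] by (simp add: F_def algebra_simps)
  qed (use c in auto)
  have "(\<lambda>k. enn2real (W (u_seq k) (u_seq k))) \<longlonglongrightarrow> enn2real (W u u)"
  proof (rule tendsto_if_almost_comparable)
    fix q :: real assume q: "1 < q"
    \<comment> \<open>The form is quadratic, so the pointwise factor enters twice.\<close>
    define c where "c = sqrt q"
    have c: "1 < c" "c * c = q" using q by (auto simp: c_def)
    obtain C where C: "0 \<le> C" "\<And>u v :: real. \<bar>u\<bar> powr p \<le> c * \<bar>v\<bar> powr p + C * \<bar>u - v\<bar> powr p"
      using abs_powr_perturbation[OF t0(3) c(1)] by metis
    have le: "W (u_seq k) (u_seq k) \<le> ennreal q * W u u +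
      (ennreal (c * C) * W u (z k) + (ennreal (C * c) * W (z k) u + ennreal (C * C) * W (z k) (z k)))" for k
      using compare[OF uk assms(25) E(2) c(1) C(1), of k k] C(2) unfolding c(2) z_def by blast
    show "\<exists>r. r \<longlonglongrightarrow> 0 \<and> (\<forall>k. enn2real (W (u_seq k) (u_seq k)) \<le> q * enn2real (W u u) + r k)"
      by (rule enn2real_perturbation[where v = "\<lambda>k. W u u", OF le]) (use q in \<open>intro Wfin assms(25) E(2) Wu Wzz | simp\<close>)+
    \<comment> \<open>The comparison with u and u_k exchanged gives the lower estimate. Its cross
      terms contain u_k and vanish because \<Phi> of u_k is eventually bounded.\<close>
    have le': "W u u \<le> ennreal q * W (u_seq k) (u_seq k) +
      (ennreal (c * C) * W (u_seq k) (z k) + (ennreal (C * c) * W (z k) (u_seq k) + ennreal (C * C) * W (z k) (z k)))" for k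
    proof -
      have "\<bar>u x\<bar> powr p \<le> c * \<bar>u_seq k x\<bar> powr p + C * \<bar>z k x\<bar> powr p" for x
        using C(2)[of "u x" "u_seq k x"] by (simp add: z_def abs_minus_commute)
      from compare[OF assms(25) uk E(2) c(1) C(1) this] show ?thesis unfolding c(2) .
    qed
    show "\<exists>r. r \<longlonglongrightarrow> 0 \<and> (\<forall>k. enn2real (W u u) \<le> q * enn2real (W (u_seq k) (u_seq k)) + r k)"
      by (rule enn2real_perturbation[where w = "\<lambda>k. W u u", OF le']) (use q in \<open>intro Wfin uk E(2) Wuk Wzz | simp\<close>)+
  qed simp
  moreover have "(\<lambda>k. enn2real (W (z k) (z k))) \<longlonglongrightarrow> enn2real (ennreal 0)"
    by (intro tendsto_enn2real) (use Wzz in auto)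
  ultimately have "(\<lambda>k. enn2real (W (u_seq k) (u_seq k)) - enn2real (W (z k) (z k))) \<longlonglongrightarrow> enn2real (W u u) - enn2real (ennreal 0)"
    by (rule tendsto_diff)
  then show ?thesis
    unfolding D[OF uk] D[OF assms(25)] D[OF E(2), unfolded z_def] by (simp add: z_def)
qed

end
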